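(* Let $\mathscr{X}$ be a locally finite regular affine building of type $R$ with set of good vertices $V_P$. Let $x\in V_P$ and $\lambda\in P^+$ with $\tau(\lambda)=l\in I_P$. Then $$|V_\lambda(x)|=\frac{1}{W_0(q)}\sum_{w\in W_0w_\lambda W_l}q_w=\frac{W_0(q)}{W_{0\lambda}(q)}\,q_{w_\lambda}=|V_{\lambda^*}(x)|.$$
   Context: Root data. $R$ is an irreducible, not necessarily reduced, root system in an $n$-dimensional real inner product space $E$, with base $\{\alpha_i\}_{i\in I_0}$, $I_0=\{1,\ldots,n\}$, and positive roots $R^+$; $\alpha^\vee=2\alpha/\langle\alpha,\alpha\rangle$; $\tilde\alpha=\sum_{i\in I_0}m_i\alpha_i$ is the highest root, $m_0=1$, and $I=I_0\cup\{0\}$. $\{\lambda_i\}_{i\in I_0}$ is the basis of $E$ with $\langle\lambda_i,\alpha_j\rangle=\delta_{i,j}$; $P=\bigoplus_i\mathbb{Z}\lambda_i$ (coweight lattice); $P^+=\{\sum a_i\lambda_i\mid a_i\in\mathbb{Z}_{\ge0}\}$. For $\alpha\in R$, $k\in\mathbb{Z}$: $H_{\alpha;k}=\{x\in E\mid\langle x,\alpha\rangle=k\}$ and $s_{\alpha;k}(x)=x-(\langle x,\alpha\rangle-k)\alpha^\vee$. Put $s_i=s_{\alpha_i;0}$ ($i\in I_0$), $s_0=s_{\tilde\alpha;1}$. $W_0$ is the Weyl group generated by $s_i$, $i\in I_0$, and $W$ is the affine Weyl group generated by all $s_{\alpha;k}$; it is a Coxeter group with generating set $S=\{s_i\mid i\in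 I\}$, and $D$ is its Coxeter graph with vertex set $I$. For $i\in I$, $W_i$ is the subgroup generated by $\{s_j\mid j\in I\setminus\{i\}\}$. $\tilde W=W_0\ltimes P$ acts on $E$, with $\lambda\in P$ acting by $t_\lambda(x)=x+\lambda$. $\Sigma$ is $E$ with chambers the connected components of $E\setminus\bigcup H_{\alpha;k}$ and vertices the extreme points of closures of chambers; it is a realisation of the Coxeter complex of $W$. $C_0=\{x\mid\langle x,\alpha_i\rangle>0\ \forall i\in I_0,\ \langle x,\tilde\alpha\rangle<1\}$. The vertices of $\overline{C}_0$ are $0$ and $\lambda_i/m_i$ ($i\in I_0$); the type map $\tau$ from the vertices of $\Sigma$ to $I$ is the $W$-invariant map with $\tau(0)=0$, $\tau(\lambda_i/m_i)=i$. $I_P=\{\tau(\lambda)\mid\lambda\in P\}=\{i\in I\mid m_i=1\}$. For $w\in\tilde W$, $\ell(w)$ is the number of hyperplanes $H_{\alpha;k}$ separating $C_0$ and $w^{-1}C_0$ (the Coxeter length on $W$); $G=\{g\in\tilde W\mid\ell(g)=0\}=\{g_i\mid i\in I_P\}$, where $g_i$ is the element of $G$ sending $0$ to the type $i$ vertex of $\overline{C}_0$. For $i\in I_P$, $\sigma_i$ is the automorphism of $D$ with $g_is_jg_i^{-1}=s_{\sigma_i(j)}$ for $j\in I$; $\mathrm{Aut}_{\mathrm{tr}}(D)=\{\sigma_i\mid i\in I_P\}$. For $\lambda\in P$: $W_{0\lambda}=\{w\in W_0\mid w\lambda=\lambda\}$ and $\lambda^*=w_0(-\lambda)$, $w_0$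 the longest element of $W_0$ (so $\lambda^*\in P^+$ if $\lambda\in P^+$). For $\lambda\in P^+$ with $\tau(\lambda)=l$: $t_\lambda'$ is the unique element of $W$ with $t_\lambda=t'_\lambda g$ for some $g\in G$, and $w_\lambda$ is the unique minimal length element of the double coset $W_0t'_\lambda W_l$. Buildings. A building of type $W$ is a set $\mathcal{C}$ of chambers with equivalence relations $\sim_i$ ($i\in I$) such that every $\sim_i$-class has at least two elements, and with a $W$-distance $\delta:\mathcal{C}\times\mathcal{C}\to W$ such that for each reduced expression $w=s_{i_1}\cdots s_{i_m}$, $\delta(c,d)=w$ iff there are $c=c_0,\ldots,c_m=d$ with $c_{k-1}\sim_{i_k}c_k$, $c_{k-1}\neq c_k$. It is locally finite if all $\sim_i$-classes are finite and regular if $q_{s}=|\{b\mid\delta(a,b)=s\}|$ is independent of $a\in\mathcal{C}$ for each $s\in S$ ($q_i=q_{s_i}$). A locally finite regular affine building of type $R$ is a locally finite regular building of type $W=W(R)$, with the convention that $q_{\sigma(i)}=q_i$ for all $\sigma\in\mathrm{Aut}_{\mathrm{tr}}(D)$ (automatic except that it means $q_0=q_1$ if $R=A_1$ and $q_0=q_n$ if $R=C_n$; general regular buildings with the diagrams $\tilde A_1$, $\tilde C_n$ are regarded as having $R=BC_1$, $BC_n$). For $w=s_{i_1}\cdots s_{i_m}\in W$ reduced, $q_w=q_{i_1}\cdots q_{i_m}$; for finite $U\subseteq W$, $U(q)=\sum_{w\in U}q_w$. The building is also regarded, as usual, as a labelled simplicial complex with vertex set $V$, type map $\tau:V\to I$,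 and apartments (subcomplexes isomorphic to $\Sigma$). $V_P=\{x\in V\mid\tau(x)\in I_P\}$ (good vertices). An isomorphism $\psi:\mathcal{A}\to\Sigma$ from an apartment is type-rotating if $\psi=w\circ\psi_1$ with $\psi_1:\mathcal{A}\to\Sigma$ a type preserving isomorphism and $w\in\tilde W$. For $x\in V_P$, $\lambda\in P^+$, $V_\lambda(x)$ is the set of $y\in V_P$ for which there exist an apartment $\mathcal{A}$ containing $x$ and $y$ and a type-rotating isomorphism $\psi:\mathcal{A}\to\Sigma$ with $\psi(x)=0$, $\psi(y)=\lambda$. *)

theory Defs
  imports "HOL-Analysis.Analysis" "HOL-Algebra.Bij" "HOL-Algebra.Generated_Groups"
begin

(* Conventions.  The ambient space E is a type 'a of class euclidean_space, and n = DIM('a).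
   Thus I_0 is {1..DIM('a)} and I = I_0 Un {0} is {..DIM('a)}.  A base of R is a family
   \<alpha> :: nat => 'a, of which only the values on I_0 matter.  Elements of the (extended) affine
   Weyl group are maps of E, multiplied by composition. *)


section \<open>Root systems\<close>

definition coroot :: "'a::euclidean_space \<Rightarrow> 'a" where
  "coroot a = (2 / (a \<bullet> a)) *\<^sub>R a"

definition affine_refl :: "'a::euclidean_space \<Rightarrow> int \<Rightarrow> 'a \<Rightarrow> 'a" where
  "affine_refl a k x = x - (x \<bullet> a - of_int k) *\<^sub>R coroot a"

(* Crystallographic; a and 2 a may both be roots. *)
definition root_system :: "'a::euclidean_space set \<Rightarrow> bool" where
  "root_system R \<longleftrightarrow>
     finite R \<and> 0 \<notin> R \<and> span R = UNIV \<and>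
     (\<forall>a\<in>R. \<forall>b\<in>R. affine_refl a 0 b \<in> R) \<and>
     (\<forall>a\<in>R. \<forall>b\<in>R. b \<bullet> coroot a \<in> \<int>)"

definition irreducible_root_system :: "'a::euclidean_space set \<Rightarrow> bool" where
  "irreducible_root_system R \<longleftrightarrow>
     root_system R \<and>
     \<not> (\<exists>A B. A \<noteq> {} \<and> B \<noteq> {} \<and> A \<union> B = R \<and> (\<forall>a\<in>A. \<forall>b\<in>B. a \<bullet> b = 0))"

definition root_base :: "'a::euclidean_space set \<Rightarrow> (nat \<Rightarrow> 'a) \<Rightarrow> bool" where
  "root_base R \<alpha> \<longleftrightarrow>
     inj_on \<alpha> {1..DIM('a)} \<and> \<alpha> ` {1..DIM('a)} \<subseteq> R \<and> independent (\<alpha> ` {1..DIM('a)}) \<and>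
     (\<forall>b\<in>R. \<exists>c :: nat \<Rightarrow> nat.
        b = (\<Sum>i=1..DIM('a). of_nat (c i) *\<^sub>R \<alpha> i) \<or>
        b = - (\<Sum>i=1..DIM('a). of_nat (c i) *\<^sub>R \<alpha> i))"

definition root_coeff :: "(nat \<Rightarrow> 'a::euclidean_space) \<Rightarrow> 'a \<Rightarrow> nat \<Rightarrow> real" where
  "root_coeff \<alpha> b i = representation (\<alpha> ` {1..DIM('a)}) b (\<alpha> i)"

definition highest_root :: "'a::euclidean_space set \<Rightarrow> (nat \<Rightarrow> 'a) \<Rightarrow> 'a" where
  "highest_root R \<alpha> =
     (THE a. a \<in> R \<and> (\<forall>b\<in>R. \<forall>i\<in>{1..DIM('a)}. root_coeff \<alpha> b i \<le> root_coeff \<alpha> a i))"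

(* The integers m_i, with m_0 = 1. *)
definition mark :: "'a::euclidean_space set \<Rightarrow> (nat \<Rightarrow> 'a) \<Rightarrow> nat \<Rightarrow> real" where
  "mark R \<alpha> i = (if i = 0 then 1 else root_coeff \<alpha> (highest_root R \<alpha>) i)"

definition fund_coweight :: "(nat \<Rightarrow> 'a::euclidean_space) \<Rightarrow> nat \<Rightarrow> 'a" where
  "fund_coweight \<alpha> i = (THE v. \<forall>j\<in>{1..DIM('a)}. v \<bullet> \<alpha> j = (if i = j then 1 else 0))"

definition coweight_lattice :: "(nat \<Rightarrow> 'a::euclidean_space) \<Rightarrow> 'a set" where
  "coweight_lattice \<alpha> =
     {v. \<exists>a :: nat \<Rightarrow> int. v = (\<Sum>i=1..DIM('a). of_int (a i) *\<^sub>R fund_coweight \<alpha> i)}"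

definition dominant_coweights :: "(nat \<Rightarrow> 'a::euclidean_space) \<Rightarrow> 'a set" where
  "dominant_coweights \<alpha> =
     {v. \<exists>a :: nat \<Rightarrow> nat. v = (\<Sum>i=1..DIM('a). of_nat (a i) *\<^sub>R fund_coweight \<alpha> i)}"


section \<open>Affine Weyl groups\<close>

definition map_group :: "('a \<Rightarrow> 'a) set \<Rightarrow> ('a \<Rightarrow> 'a) set" where
  "map_group S = generate (BijGroup UNIV) S"

definition simple_refl ::
    "'a::euclidean_space set \<Rightarrow> (nat \<Rightarrow> 'a) \<Rightarrow> nat \<Rightarrow> 'a \<Rightarrow> 'a" where
  "simple_refl R \<alpha> i =
     (if i = 0 then affine_refl (highest_root R \<alpha>) 1 else affine_refl (\<alpha> i) 0)"

definition affine_weyl :: "'a::euclidean_space set \<Rightarrow> ('a \<Rightarrow> 'a) set" where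
  "affine_weyl R = map_group {affine_refl a k | a k. a \<in> R}"

(* maximal_parabolic R \<alpha> i is W_i; for i = 0 it is the finite Weyl group W_0. *)
definition maximal_parabolic ::
    "'a::euclidean_space set \<Rightarrow> (nat \<Rightarrow> 'a) \<Rightarrow> nat \<Rightarrow> ('a \<Rightarrow> 'a) set" where
  "maximal_parabolic R \<alpha> i = map_group (simple_refl R \<alpha> ` ({..DIM('a)} - {i}))"

abbreviation weyl :: "'a::euclidean_space set \<Rightarrow> (nat \<Rightarrow> 'a) \<Rightarrow> ('a \<Rightarrow> 'a) set" where
  "weyl R \<alpha> \<equiv> maximal_parabolic R \<alpha> 0"

definition transl :: "'a::euclidean_space \<Rightarrow> 'a \<Rightarrow> 'a" where
  "transl v x = x + v"

definition extended_affine_weyl ::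
    "'a::euclidean_space set \<Rightarrow> (nat \<Rightarrow> 'a) \<Rightarrow> ('a \<Rightarrow> 'a) set" where
  "extended_affine_weyl R \<alpha> = {transl v \<circ> w | v w. v \<in> coweight_lattice \<alpha> \<and> w \<in> weyl R \<alpha>}"

definition hyperplane :: "'a::euclidean_space \<Rightarrow> int \<Rightarrow> 'a set" where
  "hyperplane a k = {x. x \<bullet> a = of_int k}"

definition fund_alcove :: "'a::euclidean_space set \<Rightarrow> (nat \<Rightarrow> 'a) \<Rightarrow> 'a set" where
  "fund_alcove R \<alpha> =
     {x. (\<forall>i\<in>{1..DIM('a)}. x \<bullet> \<alpha> i > 0) \<and> x \<bullet> highest_root R \<alpha> < 1}"

(* Hyperplanes are counted as sets: if a and 2 a are both roots then
   hyperplane a k = hyperplane (2 *R a) (2 * k) is counted once. *)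
definition separating_hyperplanes ::
    "'a::euclidean_space set \<Rightarrow> 'a set \<Rightarrow> 'a set \<Rightarrow> 'a set set" where
  "separating_hyperplanes R A B =
     {hyperplane a k | a k. a \<in> R \<and>
        ((\<forall>x\<in>A. x \<bullet> a < of_int k) \<and> (\<forall>x\<in>B. x \<bullet> a > of_int k) \<or>
         (\<forall>x\<in>A. x \<bullet> a > of_int k) \<and> (\<forall>x\<in>B. x \<bullet> a < of_int k))}"

definition weyl_length ::
    "'a::euclidean_space set \<Rightarrow> (nat \<Rightarrow> 'a) \<Rightarrow> ('a \<Rightarrow> 'a) \<Rightarrow> nat" where
  "weyl_length R \<alpha> w =
     card (separating_hyperplanes R (fund_alcove R \<alpha>) (inv_into UNIV w ` fund_alcove R \<alpha>))"

definition length_zero_group ::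
    "'a::euclidean_space set \<Rightarrow> (nat \<Rightarrow> 'a) \<Rightarrow> ('a \<Rightarrow> 'a) set" where
  "length_zero_group R \<alpha> = {g \<in> extended_affine_weyl R \<alpha>. weyl_length R \<alpha> g = 0}"

definition word_prod ::
    "'a::euclidean_space set \<Rightarrow> (nat \<Rightarrow> 'a) \<Rightarrow> nat list \<Rightarrow> 'a \<Rightarrow> 'a" where
  "word_prod R \<alpha> is = foldr (\<lambda>i w. simple_refl R \<alpha> i \<circ> w) is id"

definition reduced_word ::
    "'a::euclidean_space set \<Rightarrow> (nat \<Rightarrow> 'a) \<Rightarrow> nat list \<Rightarrow> bool" where
  "reduced_word R \<alpha> is \<longleftrightarrow>
     set is \<subseteq> {..DIM('a)} \<and>
     (\<forall>js. set js \<subseteq> {..DIM('a)} \<and> word_prod R \<alpha> js = word_prod R \<alpha> is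
        \<longrightarrow> length is \<le> length js)"

definition longest_weyl :: "'a::euclidean_space set \<Rightarrow> (nat \<Rightarrow> 'a) \<Rightarrow> 'a \<Rightarrow> 'a" where
  "longest_weyl R \<alpha> = (THE w. is_arg_max (weyl_length R \<alpha>) (\<lambda>w. w \<in> weyl R \<alpha>) w)"

definition dual_coweight ::
    "'a::euclidean_space set \<Rightarrow> (nat \<Rightarrow> 'a) \<Rightarrow> 'a \<Rightarrow> 'a" where
  "dual_coweight R \<alpha> v = longest_weyl R \<alpha> (- v)"

definition weyl_stabilizer ::
    "'a::euclidean_space set \<Rightarrow> (nat \<Rightarrow> 'a) \<Rightarrow> 'a \<Rightarrow> ('a \<Rightarrow> 'a) set" where
  "weyl_stabilizer R \<alpha> v = {w \<in> weyl R \<alpha>. w v = v}"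


section \<open>The Coxeter complex, types and type-rotating automorphisms\<close>

(* The type i vertex of the closure of the fundamental alcove. *)
definition fund_vertex ::
    "'a::euclidean_space set \<Rightarrow> (nat \<Rightarrow> 'a) \<Rightarrow> nat \<Rightarrow> 'a" where
  "fund_vertex R \<alpha> i = (if i = 0 then 0 else fund_coweight \<alpha> i /\<^sub>R mark R \<alpha> i)"

definition vertex_type ::
    "'a::euclidean_space set \<Rightarrow> (nat \<Rightarrow> 'a) \<Rightarrow> 'a \<Rightarrow> nat" where
  "vertex_type R \<alpha> v =
     (THE i. i \<in> {..DIM('a)} \<and> (\<exists>w\<in>affine_weyl R. v = w (fund_vertex R \<alpha> i)))"

definition good_types :: "'a::euclidean_space set \<Rightarrow> (nat \<Rightarrow> 'a) \<Rightarrow> nat set" where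
  "good_types R \<alpha> = vertex_type R \<alpha> ` coweight_lattice \<alpha>"

definition rot_elem ::
    "'a::euclidean_space set \<Rightarrow> (nat \<Rightarrow> 'a) \<Rightarrow> nat \<Rightarrow> 'a \<Rightarrow> 'a" where
  "rot_elem R \<alpha> i = (THE g. g \<in> length_zero_group R \<alpha> \<and> g 0 = fund_vertex R \<alpha> i)"

(* Only the values on I are meaningful. *)
definition type_rotation ::
    "'a::euclidean_space set \<Rightarrow> (nat \<Rightarrow> 'a) \<Rightarrow> nat \<Rightarrow> nat \<Rightarrow> nat" where
  "type_rotation R \<alpha> i j =
     (THE k. k \<in> {..DIM('a)} \<and>
        rot_elem R \<alpha> i \<circ> simple_refl R \<alpha> j \<circ> inv_into UNIV (rot_elem R \<alpha> i) = simple_refl R \<alpha> k)"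

definition Aut_tr :: "'a::euclidean_space set \<Rightarrow> (nat \<Rightarrow> 'a) \<Rightarrow> (nat \<Rightarrow> nat) set" where
  "Aut_tr R \<alpha> = type_rotation R \<alpha> ` good_types R \<alpha>"

definition alcoves :: "'a::euclidean_space set \<Rightarrow> 'a set set" where
  "alcoves R = components (UNIV - (\<Union>a\<in>R. \<Union>k. hyperplane a k))"

(* An abstract simplicial complex is the set of its simplices (the empty one included); its vertex
   set is the union. *)
definition coxeter_complex :: "'a::euclidean_space set \<Rightarrow> 'a set set" where
  "coxeter_complex R = {s. \<exists>A\<in>alcoves R. s \<subseteq> {v. v extreme_point_of closure A}}"

definition simplicial_iso :: "('v \<Rightarrow> 'w) \<Rightarrow> 'v set set \<Rightarrow> 'w set set \<Rightarrow> bool" where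
  "simplicial_iso f K L \<longleftrightarrow> bij_betw f (\<Union>K) (\<Union>L) \<and> image f ` K = L"

definition subcomplex :: "'v set set \<Rightarrow> 'v set set \<Rightarrow> bool" where
  "subcomplex K L \<longleftrightarrow> K \<subseteq> L \<and> (\<forall>s\<in>K. \<forall>t. t \<subseteq> s \<longrightarrow> t \<in> K)"


section \<open>The elements t'_lambda and w_lambda\<close>

definition double_coset ::
    "('a \<Rightarrow> 'a) set \<Rightarrow> ('a \<Rightarrow> 'a) \<Rightarrow> ('a \<Rightarrow> 'a) set \<Rightarrow> ('a \<Rightarrow> 'a) set" where
  "double_coset U w V = {u \<circ> w \<circ> v | u v. u \<in> U \<and> v \<in> V}"

definition transl_affine_part ::
    "'a::euclidean_space set \<Rightarrow> (nat \<Rightarrow> 'a) \<Rightarrow> 'a \<Rightarrow> 'a \<Rightarrow> 'a" where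
  "transl_affine_part R \<alpha> v =
     (THE w. w \<in> affine_weyl R \<and> (\<exists>g\<in>length_zero_group R \<alpha>. transl v = w \<circ> g))"

definition min_coset_elem ::
    "'a::euclidean_space set \<Rightarrow> (nat \<Rightarrow> 'a) \<Rightarrow> 'a \<Rightarrow> 'a \<Rightarrow> 'a" where
  "min_coset_elem R \<alpha> v =
     (THE w. is_arg_min (weyl_length R \<alpha>)
        (\<lambda>w. w \<in> double_coset (weyl R \<alpha>) (transl_affine_part R \<alpha> v)
                   (maximal_parabolic R \<alpha> (vertex_type R \<alpha> v))) w)"


section \<open>Buildings\<close>

(* Galleries of type is from c to d in which consecutive chambers differ. *)
fun gallery :: "(nat \<Rightarrow> ('c \<times> 'c) set) \<Rightarrow> nat list \<Rightarrow> 'c \<Rightarrow> 'c \<Rightarrow> bool" where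
  "gallery adj [] c d \<longleftrightarrow> c = d"
| "gallery adj (i # is) c d \<longleftrightarrow> (\<exists>e. (c, e) \<in> adj i \<and> c \<noteq> e \<and> gallery adj is e d)"

definition affine_building ::
    "'a::euclidean_space set \<Rightarrow> (nat \<Rightarrow> 'a) \<Rightarrow> 'c set \<Rightarrow> (nat \<Rightarrow> ('c \<times> 'c) set)
      \<Rightarrow> ('c \<Rightarrow> 'c \<Rightarrow> 'a \<Rightarrow> 'a) \<Rightarrow> bool" where
  "affine_building R \<alpha> C adj \<delta> \<longleftrightarrow>
     (\<forall>i\<in>{..DIM('a)}. equiv C (adj i) \<and> (\<forall>c\<in>C. \<exists>d\<in>C. (c, d) \<in> adj i \<and> d \<noteq> c)) \<and>
     (\<forall>c\<in>C. \<forall>d\<in>C. \<delta> c d \<in> affine_weyl R) \<and>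
     (\<forall>is. reduced_word R \<alpha> is \<longrightarrow>
        (\<forall>c\<in>C. \<forall>d\<in>C. \<delta> c d = word_prod R \<alpha> is \<longleftrightarrow> gallery adj is c d))"

(* The parameters q of the building are part of the data.  The last clause is the convention tying
   the choice of R to the parameters. *)
definition locally_finite_regular_affine_building ::
    "'a::euclidean_space set \<Rightarrow> (nat \<Rightarrow> 'a) \<Rightarrow> 'c set \<Rightarrow> (nat \<Rightarrow> ('c \<times> 'c) set)
      \<Rightarrow> ('c \<Rightarrow> 'c \<Rightarrow> 'a \<Rightarrow> 'a) \<Rightarrow> (nat \<Rightarrow> nat) \<Rightarrow> bool" where
  "locally_finite_regular_affine_building R \<alpha> C adj \<delta> q \<longleftrightarrow>
     affine_building R \<alpha> C adj \<delta> \<and>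
     (\<forall>i\<in>{..DIM('a)}. \<forall>c\<in>C. finite (adj i `` {c})) \<and>
     (\<forall>i\<in>{..DIM('a)}. \<forall>a\<in>C. card {b \<in> C. \<delta> a b = simple_refl R \<alpha> i} = q i) \<and>
     (\<forall>\<sigma>\<in>Aut_tr R \<alpha>. \<forall>i\<in>{..DIM('a)}. q (\<sigma> i) = q i)"

(* Well defined when q comes from a regular building: the product is then the same for all reduced
   words of w. *)
definition q_elem ::
    "'a::euclidean_space set \<Rightarrow> (nat \<Rightarrow> 'a) \<Rightarrow> (nat \<Rightarrow> nat) \<Rightarrow> ('a \<Rightarrow> 'a) \<Rightarrow> nat" where
  "q_elem R \<alpha> q w =
     (THE k. \<exists>is. reduced_word R \<alpha> is \<and> word_prod R \<alpha> is = w \<and> k = prod_list (map q is))"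

definition q_sum ::
    "'a::euclidean_space set \<Rightarrow> (nat \<Rightarrow> 'a) \<Rightarrow> (nat \<Rightarrow> nat) \<Rightarrow> ('a \<Rightarrow> 'a) set \<Rightarrow> nat" where
  "q_sum R \<alpha> q U = (\<Sum>w\<in>U. q_elem R \<alpha> q w)"

definition residue :: "(nat \<Rightarrow> ('c \<times> 'c) set) \<Rightarrow> nat set \<Rightarrow> 'c \<Rightarrow> 'c set" where
  "residue adj J c = (\<Union>j\<in>J. adj j)\<^sup>* `` {c}"

(* The simplicial complex of a building with I = {..n}: a vertex of type i is a pair (i, X) with X a
   residue of type I - {i}, so the type map is fst; the maximal simplices are the sets of n + 1
   residues of this kind through a common chamber. *)
definition chamber_vertices ::
    "nat \<Rightarrow> (nat \<Rightarrow> ('c \<times> 'c) set) \<Rightarrow> 'c \<Rightarrow> (nat \<times> 'c set) set" where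
  "chamber_vertices n adj c = {(i, residue adj ({..n} - {i}) c) | i. i \<in> {..n}}"

definition building_complex ::
    "nat \<Rightarrow> 'c set \<Rightarrow> (nat \<Rightarrow> ('c \<times> 'c) set) \<Rightarrow> (nat \<times> 'c set) set set" where
  "building_complex n C adj = {s. \<exists>c\<in>C. s \<subseteq> chamber_vertices n adj c}"

definition good_vertices ::
    "'a::euclidean_space set \<Rightarrow> (nat \<Rightarrow> 'a) \<Rightarrow> 'c set \<Rightarrow> (nat \<Rightarrow> ('c \<times> 'c) set)
      \<Rightarrow> (nat \<times> 'c set) set" where
  "good_vertices R \<alpha> C adj =
     {x \<in> \<Union>(building_complex DIM('a) C adj). fst x \<in> good_types R \<alpha>}"

definition apartment ::
    "'a::euclidean_space set \<Rightarrow> 'c set \<Rightarrow> (nat \<Rightarrow> ('c \<times> 'c) set)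
      \<Rightarrow> (nat \<times> 'c set) set set \<Rightarrow> bool" where
  "apartment R C adj A \<longleftrightarrow>
     subcomplex A (building_complex DIM('a) C adj) \<and>
     (\<exists>\<psi>. simplicial_iso \<psi> A (coxeter_complex R))"

definition type_preserving_iso ::
    "'a::euclidean_space set \<Rightarrow> (nat \<Rightarrow> 'a) \<Rightarrow> (nat \<times> 'c set) set set
      \<Rightarrow> (nat \<times> 'c set \<Rightarrow> 'a) \<Rightarrow> bool" where
  "type_preserving_iso R \<alpha> A \<psi> \<longleftrightarrow>
     simplicial_iso \<psi> A (coxeter_complex R) \<and> (\<forall>v\<in>\<Union>A. vertex_type R \<alpha> (\<psi> v) = fst v)"

definition type_rotating_iso ::
    "'a::euclidean_space set \<Rightarrow> (nat \<Rightarrow> 'a) \<Rightarrow> (nat \<times> 'c set) set set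
      \<Rightarrow> (nat \<times> 'c set \<Rightarrow> 'a) \<Rightarrow> bool" where
  "type_rotating_iso R \<alpha> A \<psi> \<longleftrightarrow>
     simplicial_iso \<psi> A (coxeter_complex R) \<and>
     (\<exists>w\<in>extended_affine_weyl R \<alpha>. \<exists>\<psi>1. type_preserving_iso R \<alpha> A \<psi>1 \<and>
        (\<forall>v\<in>\<Union>A. \<psi> v = w (\<psi>1 v)))"

definition vertex_sphere ::
    "'a::euclidean_space set \<Rightarrow> (nat \<Rightarrow> 'a) \<Rightarrow> 'c set \<Rightarrow> (nat \<Rightarrow> ('c \<times> 'c) set)
      \<Rightarrow> 'a \<Rightarrow> nat \<times> 'c set \<Rightarrow> (nat \<times> 'c set) set" where
  "vertex_sphere R \<alpha> C adj v x =
     {y \<in> good_vertices R \<alpha> C adj.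
        \<exists>A \<psi>. apartment R C adj A \<and> x \<in> \<Union>A \<and> y \<in> \<Union>A \<and>
              type_rotating_iso R \<alpha> A \<psi> \<and> \<psi> x = 0 \<and> \<psi> y = v}"

end

theory Submission
  imports Defs
begin

text \<open>
  The length of an element \<open>w\<close> of the affine Weyl group is the number of hyperplanes separating the
  fundamental alcove from its image under \<open>w\<close>, so lengths add up in a product as soon as no
  hyperplane is crossed twice; this yields the exchange condition, the description of vertex
  stabilisers and all minimal coset representatives geometrically.

  Two chambers of the building at distance \<open>w\<close> lie in the image of an isometry from the affine Weyl
  group into the building, and these isometries are the same thing as apartments with a type
  preserving isomorphism. Hence \<open>y\<close> lies in \<open>V\<^sub>\<lambda>(x)\<close> iff the distance from a fixed chamber at \<open>x\<close> to
  some (equivalently, every) chamber at \<open>y\<close> maps the fundamental vertex of the type of \<open>y\<close> into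
  \<open>g(W\<^sub>0\<lambda>)\<close>, where \<open>g\<close> is the length zero element attached to the type of \<open>x\<close>. Counting these
  chambers by distance, and grouping them by the vertices \<open>y\<close>, gives the first equality, since
  conjugation by \<open>g\<close> preserves the parameters. The second is the length-additive factorisation
  \<open>u w\<^sub>\<lambda> v\<close> of the elements of the double coset. For the third, inversion followed by conjugation
  with a length zero element maps the double coset of \<open>\<lambda>\<close> onto that of \<open>\<lambda>\<^sup>*\<close>.
\<close>

section \<open>Root systems\<close>

text \<open>The affine Weyl group is given as a group of maps, types by description and apartments
  as bare subcomplexes, so Coxeter group theory has to be recovered from geometry. Its carrier is
  the set \<open>N w\<close> of separating hyperplanes rather than their number: the cocycle rule
  \<open>N_comp\<close> for these sets decides which lengths add and which reflections shorten.
  Hyperplanes are kept as sets because a root and its double may both occur and then share mirrors.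
  Irreducibility enters through the highest root, whose maximality confines positive roots to values
  in (0, 1) on the fundamental alcove and makes the affine reflection cross a single hyperplane. On
  the building side \<open>q_elem\<close> is shown to count chambers at a given distance, which
  makes it well defined without braid relations. The obstacle is to produce an apartment through two
  given chambers. Partial isometries are extended one chamber at a time, and Zorn's lemma gives a
  total one.\<close>

declare One_nat_def [simp del]

text \<open>The generators are involutions, so closing under inverses adds nothing and the generated
  group is the set of finite composites. The affine Weyl group and its parabolic subgroups are both
  unfolded into words this way.\<close>

lemma map_group_comp:
  assumes S: "\<And>f. f \<in> S \<Longrightarrow> f \<circ> f = id"
  shows "map_group S = {foldr (\<circ>) fs id | fs. set fs \<subseteq> S}"
proof
  let ?G = "BijGroup (UNIV :: 'a set)"
  interpret group ?G by (rule group_BijGroup)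
  have bij: "f \<in> Bij UNIV" if "f \<in> S" for f
    using S[OF that] by (auto simp: Bij_def intro: o_bij)
  have mult: "f \<otimes>\<^bsub>?G\<^esub> g = f \<circ> g" if "f \<in> Bij UNIV" "g \<in> Bij UNIV" for f g
    using that by (auto simp: BijGroup_def compose_def)
  have one: "\<one>\<^bsub>?G\<^esub> = id" by (auto simp: BijGroup_def)
  have fold_bij: "foldr (\<circ>) fs id \<in> Bij UNIV" if "set fs \<subseteq> S" for fs
    using that
  proof (induction fs)
    case (Cons f fs)
    then have f: "f \<in> Bij UNIV" "foldr (\<circ>) fs id \<in> Bij UNIV"
      using bij unfolding list.set insert_subset by blast+
    then have "bij (f \<circ> foldr (\<circ>) fs id)" unfolding Bij_def by (blast intro: bij_comp)
    then show ?case unfolding Bij_def foldr_Cons o_apply extensional_UNIV by blast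
  qed (auto simp: Bij_def)
  have inv: "inv\<^bsub>?G\<^esub> f = f" if "f \<in> S" for f
  proof (rule inv_equality)
    show "f \<otimes>\<^bsub>?G\<^esub> f = \<one>\<^bsub>?G\<^esub>" using mult[OF bij[OF that] bij[OF that]] S[OF that] one by argo
  qed (use bij[OF that] in \<open>auto simp: BijGroup_def\<close>)
  have append: "foldr (\<circ>) (f1 @ f2) id = foldr (\<circ>) f1 id \<circ> foldr (\<circ>) f2 id"
    for f1 f2 :: "('a \<Rightarrow> 'a) list"
    by (induction f1) (simp_all only: append.simps foldr.simps id_comp o_assoc o_apply id_apply)
  show "map_group S \<subseteq> {foldr (\<circ>) fs id | fs. set fs \<subseteq> S}"
  proof
    fix w assume "w \<in> map_group S"
    then have "w \<in> generate ?G S" by (simp add: map_group_def)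
    then have "\<exists>fs. w = foldr (\<circ>) fs id \<and> set fs \<subseteq> S"
    proof (induction rule: generate.induct)
      case one
      show ?case using \<open>\<one>\<^bsub>?G\<^esub> = id\<close> by (intro exI[of _ "[]"]) auto
    next
      case (incl h)
      then show ?case by (intro exI[of _ "[h]"]) auto
    next
      case (inv h)
      then show ?case using \<open>\<And>f. f \<in> S \<Longrightarrow> inv\<^bsub>?G\<^esub> f = f\<close> by (intro exI[of _ "[h]"]) auto
    next
      case (eng h1 h2)
      then obtain f1 f2 where f: "h1 = foldr (\<circ>) f1 id" "h2 = foldr (\<circ>) f2 id"
        "set f1 \<subseteq> S" "set f2 \<subseteq> S" by blast
      then have "h1 \<otimes>\<^bsub>?G\<^esub> h2 = h1 \<circ> h2" using fold_bij mult by blast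
      also have "\<dots> = foldr (\<circ>) (f1 @ f2) id" unfolding append f(1,2) ..
      finally have "h1 \<otimes>\<^bsub>?G\<^esub> h2 = foldr (\<circ>) (f1 @ f2) id \<and> set (f1 @ f2) \<subseteq> S" using f(3,4) by simp
      then show ?case by blast
    qed
    then show "w \<in> {foldr (\<circ>) fs id | fs. set fs \<subseteq> S}" by blast
  qed
  show "{foldr (\<circ>) fs id | fs. set fs \<subseteq> S} \<subseteq> map_group S"
  proof clarify
    fix fs assume "set fs \<subseteq> S"
    then show "foldr (\<circ>) fs id \<in> map_group S"
    proof (induction fs)
      case Nil
      have "foldr (\<circ>) [] id = (id :: 'a \<Rightarrow> 'a)" by simp
      then show ?case using generate.one[of ?G S] one by (metis map_group_def)
    next
      case (Cons f fs)
      then have "f \<in> generate ?G S" "foldr (\<circ>) fs id \<in> generate ?G S"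
        unfolding map_group_def list.set insert_subset by (blast intro: generate.incl)+
      then have "f \<otimes>\<^bsub>?G\<^esub> foldr (\<circ>) fs id \<in> generate ?G S" by (rule generate.eng)
      moreover have "f \<otimes>\<^bsub>?G\<^esub> foldr (\<circ>) fs id = f \<circ> foldr (\<circ>) fs id"

        using Cons.prems unfolding list.set insert_subset by (blast intro: mult bij fold_bij)
      ultimately show ?case unfolding map_group_def foldr_Cons o_apply by metis
    qed
  qed
qed

section \<open>Affine reflections and their mirrors\<close>

lemma coroot_inner [simp]: "b \<bullet> coroot a = 2 * (b \<bullet> a) / (a \<bullet> a)"
  by (simp add: coroot_def)

lemma affine_refl_eq: "affine_refl a k x = affine_refl a 0 x + of_int k *\<^sub>R coroot a"
  by (simp add: affine_refl_def algebra_simps)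

lemma affine_refl_linear: "affine_refl a 0 x = x - (2 * (x \<bullet> a) / (a \<bullet> a)) *\<^sub>R a"
  by (simp add: affine_refl_def coroot_def)

lemma affine_refl_inner: "a \<noteq> 0 \<Longrightarrow> affine_refl a k x \<bullet> a = 2 * of_int k - x \<bullet> a"
  by (simp add: affine_refl_def coroot_def inner_diff_left)

lemma affine_refl_involution: "a \<noteq> 0 \<Longrightarrow> affine_refl a k (affine_refl a k x) = x"
  unfolding affine_refl_def[of a k "affine_refl a k x"] affine_refl_inner
  by (simp add: affine_refl_def algebra_simps)

lemma affine_refl_comp_self: "a \<noteq> 0 \<Longrightarrow> affine_refl a k \<circ> affine_refl a k = id"
  by (auto simp: affine_refl_involution)

lemma affine_refl_fixed: "x \<in> hyperplane a k \<Longrightarrow> affine_refl a k x = x"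
  by (simp add: affine_refl_def hyperplane_def)

lemma affine_refl_fixed_iff: "a \<noteq> 0 \<Longrightarrow> affine_refl a k x = x \<longleftrightarrow> x \<in> hyperplane a k"
  by (auto simp: affine_refl_def hyperplane_def coroot_def)

lemma orthogonal_affine_refl: "a \<noteq> 0 \<Longrightarrow> orthogonal_transformation (affine_refl a 0)"
  unfolding orthogonal_transformation_def
proof (intro conjI allI)
  show "linear (affine_refl a 0)"
    by (rule linearI) (auto simp: affine_refl_def algebra_simps)
  fix v w assume "a \<noteq> 0"
  then show "affine_refl a 0 v \<bullet> affine_refl a 0 w = v \<bullet> w"
    by (simp add: affine_refl_linear inner_diff_left inner_diff_right inner_commute field_simps)
qed

lemma hyperplane_eqD:
  assumes "hyperplane a k = hyperplane b m" "a \<noteq> 0" "b \<noteq> 0"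
  obtains c where "c \<noteq> 0" "a = c *\<^sub>R b" "of_int k = c * of_int m"
proof -
  \<comment> \<open>\<open>p\<close> is the point of the first hyperplane nearest to the origin and
    \<open>v\<close> is the part of \<open>a\<close> orthogonal to \<open>b\<close>. Moving
    \<open>p\<close> along \<open>v\<close> stays in both hyperplanes, which forces
    \<open>v = 0\<close>.\<close>
  define p where "p = (of_int k / (a \<bullet> a)) *\<^sub>R a"
  have p: "p \<bullet> a = of_int k" using assms by (simp add: p_def)
  have pb: "p \<bullet> b = of_int m" using p assms(1) by (auto simp: hyperplane_def)
  define v where "v = a - ((a \<bullet> b) / (b \<bullet> b)) *\<^sub>R b"
  have vb: "v \<bullet> b = 0" using assms by (simp add: v_def inner_diff_left)
  have "p + v \<in> hyperplane b m" using pb vb by (simp add: hyperplane_def inner_add_left)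
  then have "(p + v) \<bullet> a = of_int k" using assms(1) by (auto simp: hyperplane_def)
  then have "v \<bullet> a = 0" using p by (simp add: inner_add_left)
  then have "v \<bullet> v = 0" using vb by (simp add: v_def inner_diff_right)
  then have av: "a = ((a \<bullet> b) / (b \<bullet> b)) *\<^sub>R b" by (simp add: v_def)
  define c where "c = (a \<bullet> b) / (b \<bullet> b)"
  have a: "a = c *\<^sub>R b" using av c_def by simp
  have "c \<noteq> 0" using a assms by auto
  moreover have "of_int k = c * of_int m" using p pb a by (metis inner_scaleR_right)
  ultimately show ?thesis using a that by blast
qed

text \<open>A reflection is determined by its mirror as a set. This permits reasoning with sets of
  hyperplanes although several roots may describe the same one.\<close>

lemma affine_refl_cong_hyperplane:
  assumes "hyperplane a k = hyperplane b m" "a \<noteq> 0" "b \<noteq> 0"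
  shows "affine_refl a k = affine_refl b m"
proof -
  obtain c where c: "c \<noteq> 0" "a = c *\<^sub>R b" "of_int k = c * of_int m"
    using hyperplane_eqD[OF assms] .
  have "affine_refl a k x = affine_refl b m x" for x
  proof -
    have "(x \<bullet> a - of_int k) * (2 / (a \<bullet> a)) * c = (x \<bullet> b - of_int m) * (2 / (b \<bullet> b))"
      using c assms(3) by (simp add: field_simps power2_eq_square)
    then have "(x \<bullet> a - of_int k) *\<^sub>R coroot a = (x \<bullet> b - of_int m) *\<^sub>R coroot b"
      by (metis (no_types, lifting) c(2) coroot_def scaleR_scaleR)
    then show ?thesis by (simp only: affine_refl_def)
  qed
  then show ?thesis by blast
qed

locale based_root_system =
  fixes R :: "'a::euclidean_space set" and \<alpha> :: "nat \<Rightarrow> 'a"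
  assumes irreducible: "irreducible_root_system R" and base: "root_base R \<alpha>"
begin

abbreviation "\<omega> \<equiv> fund_coweight \<alpha>"
abbreviation "\<theta> \<equiv> highest_root R \<alpha>"
abbreviation "s \<equiv> simple_refl R \<alpha>"
abbreviation "W \<equiv> affine_weyl R"
abbreviation "W0 \<equiv> weyl R \<alpha>"
abbreviation "Wi \<equiv> maximal_parabolic R \<alpha>"
abbreviation "WE \<equiv> extended_affine_weyl R \<alpha>"
abbreviation "P \<equiv> coweight_lattice \<alpha>"
abbreviation "C0 \<equiv> fund_alcove R \<alpha>"
abbreviation "wp \<equiv> word_prod R \<alpha>"

section \<open>Simple roots, fundamental coweights and signs of roots\<close>

lemma root_system: "root_system R"
  using irreducible by (simp add: irreducible_root_system_def)

lemma finite_roots: "finite R" and root_nonzero: "a \<in> R \<Longrightarrow> a \<noteq> 0"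
  and span_roots: "span R = UNIV"
  and root_refl: "a \<in> R \<Longrightarrow> b \<in> R \<Longrightarrow> affine_refl a 0 b \<in> R"
  and cartan_integer: "a \<in> R \<Longrightarrow> b \<in> R \<Longrightarrow> 2 * (b \<bullet> a) / (a \<bullet> a) \<in> \<int>"
  using root_system by (auto simp: root_system_def)

lemma root_uminus: "a \<in> R \<Longrightarrow> - a \<in> R"
  using root_refl[of a a] root_nonzero[of a] by (simp add: affine_refl_linear scaleR_2)

lemma simple_root: "i \<in> {1..DIM('a)} \<Longrightarrow> \<alpha> i \<in> R" and inj_simple: "inj_on \<alpha> {1..DIM('a)}"
  and independent_simple: "independent (\<alpha> ` {1..DIM('a)})"
  using base by (auto simp: root_base_def)

lemma span_simple: "span (\<alpha> ` {1..DIM('a)}) = UNIV"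
proof -
  have "card (\<alpha> ` {1..DIM('a)}) = dim (UNIV :: 'a set)" using card_image[OF inj_simple] by (simp add: dim_UNIV)
  then have "UNIV \<subseteq> span (\<alpha> ` {1..DIM('a)})"
    using card_eq_dim[of "\<alpha> ` {1..DIM('a)}" UNIV] independent_simple by auto
  then show ?thesis by blast
qed

lemma coweight_ex: "\<exists>v. \<forall>j\<in>{1..DIM('a)}. v \<bullet> \<alpha> j = (if i = j then 1 else 0)"
proof -
  \<comment> \<open>The coordinate functional of the \<open>i\<close>-th simple root, set to 0 for
    an index out of range; \<open>v\<close> below represents it through the inner product.\<close>
  let ?f = "\<lambda>x. if i \<in> {1..DIM('a)} then representation (\<alpha> ` {1..DIM('a)}) x (\<alpha> i) else 0"
  have lin: "linear ?f"
    by (rule linearI) (simp_all add: representation_add[OF independent_simple]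
        representation_scale[OF independent_simple] span_simple)
  define v where "v = (\<Sum>b\<in>Basis. ?f b *\<^sub>R b)"
  have v: "v \<bullet> x = ?f x" for x
  proof -
    have "?f x = ?f (\<Sum>b\<in>Basis. (x \<bullet> b) *\<^sub>R b)" by (simp add: euclidean_representation)
    also have "\<dots> = (\<Sum>b\<in>Basis. (x \<bullet> b) *\<^sub>R ?f b)"
      by (simp only: linear_sum[OF lin] linear_cmul[OF lin])
    also have "\<dots> = v \<bullet> x"
      unfolding v_def inner_sum_left by (rule sum.cong) (auto simp: inner_commute)
    finally show ?thesis by simp
  qed
  have "?f (\<alpha> j) = (if i = j then 1 else 0)" if "j \<in> {1..DIM('a)}" for j
    using that representation_basis[OF independent_simple imageI[OF that]] inj_on_eq_iff[OF inj_simple, of i j]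
    by simp
  then show ?thesis using v by (intro exI[of _ v]) auto
qed

lemma inner_simple_eqI:
  assumes "\<And>j. j \<in> {1..DIM('a)} \<Longrightarrow> v \<bullet> \<alpha> j = w \<bullet> \<alpha> j"
  shows "v = w"
proof -
  have "(v - w) \<bullet> x = 0" if "x \<in> span (\<alpha> ` {1..DIM('a)})" for x
    using that
    by (induction x rule: span_induct_alt) (use assms in \<open>auto simp: inner_diff_left inner_add_right\<close>)
  then have "(v - w) \<bullet> (v - w) = 0" by (simp add: span_simple)
  then show ?thesis by simp
qed

lemma fund_coweight_inner: "j \<in> {1..DIM('a)} \<Longrightarrow> \<omega> i \<bullet> \<alpha> j = (if i = j then 1 else 0)"
proof -
  have "\<exists>!v. \<forall>j\<in>{1..DIM('a)}. v \<bullet> \<alpha> j = (if i = j then 1 else 0)"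
    by (intro ex_ex1I coweight_ex inner_simple_eqI) auto
  from theI'[OF this] show "j \<in> {1..DIM('a)} \<Longrightarrow> \<omega> i \<bullet> \<alpha> j = (if i = j then 1 else 0)"
    unfolding fund_coweight_def by blast
qed

lemma coweight_expansion: "x = (\<Sum>i\<in>{1..DIM('a)}. (x \<bullet> \<alpha> i) *\<^sub>R \<omega> i)"
proof (rule inner_simple_eqI)
  fix j assume j: "j \<in> {1..DIM('a)}"
  have "(\<Sum>i\<in>{1..DIM('a)}. (x \<bullet> \<alpha> i) *\<^sub>R \<omega> i) \<bullet> \<alpha> j = (\<Sum>i\<in>{1..DIM('a)}. if i = j then x \<bullet> \<alpha> i else 0)"
    unfolding inner_sum_left by (rule sum.cong) (use j in \<open>auto simp: fund_coweight_inner\<close>)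
  then show "x \<bullet> \<alpha> j = (\<Sum>i\<in>{1..DIM('a)}. (x \<bullet> \<alpha> i) *\<^sub>R \<omega> i) \<bullet> \<alpha> j" using j by simp
qed

lemma simple_expansion: "x = (\<Sum>i\<in>{1..DIM('a)}. (x \<bullet> \<omega> i) *\<^sub>R \<alpha> i)"
proof -
  have "y \<bullet> x = y \<bullet> (\<Sum>i\<in>{1..DIM('a)}. (x \<bullet> \<omega> i) *\<^sub>R \<alpha> i)" for y
  proof -
    have "y \<bullet> x = (\<Sum>i\<in>{1..DIM('a)}. (y \<bullet> \<alpha> i) *\<^sub>R \<omega> i) \<bullet> x" by (subst coweight_expansion[of y]) (rule refl)
    also have "\<dots> = y \<bullet> (\<Sum>i\<in>{1..DIM('a)}. (x \<bullet> \<omega> i) *\<^sub>R \<alpha> i)"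
      by (simp add: inner_sum_left inner_sum_right inner_commute mult.commute)
    finally show ?thesis .
  qed
  then have "(x - (\<Sum>i\<in>{1..DIM('a)}. (x \<bullet> \<omega> i) *\<^sub>R \<alpha> i)) \<bullet> (x - (\<Sum>i\<in>{1..DIM('a)}. (x \<bullet> \<omega> i) *\<^sub>R \<alpha> i)) = 0"
    by (subst inner_diff_right) simp
  then show ?thesis by (simp only: inner_eq_zero_iff right_minus_eq)
qed

lemma inner_expansion: "x \<bullet> b = (\<Sum>i\<in>{1..DIM('a)}. (b \<bullet> \<omega> i) * (x \<bullet> \<alpha> i))"
  by (subst simple_expansion[of b]) (simp add: inner_sum_right)

lemma coeff_simple: "j \<in> {1..DIM('a)} \<Longrightarrow> \<alpha> j \<bullet> \<omega> i = (if i = j then 1 else 0)"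
  using fund_coweight_inner by (simp add: inner_commute)

lemma root_coeff_eq: "i \<in> {1..DIM('a)} \<Longrightarrow> root_coeff \<alpha> b i = b \<bullet> \<omega> i"
proof -
  assume i: "i \<in> {1..DIM('a)}"
  have "representation (\<alpha> ` {1..DIM('a)}) b (\<alpha> i) =
      representation (\<alpha> ` {1..DIM('a)}) (\<Sum>j\<in>{1..DIM('a)}. (b \<bullet> \<omega> j) *\<^sub>R \<alpha> j) (\<alpha> i)"
    by (subst simple_expansion[of b]) (rule refl)
  also have "\<dots> = (\<Sum>j\<in>{1..DIM('a)}. (b \<bullet> \<omega> j) * representation (\<alpha> ` {1..DIM('a)}) (\<alpha> j) (\<alpha> i))"
    by (simp add: representation_sum[OF independent_simple] representation_scale[OF independent_simple]
        span_simple)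
  also have "\<dots> = (\<Sum>j\<in>{1..DIM('a)}. if j = i then b \<bullet> \<omega> j else 0)"
    by (rule sum.cong) (use i inj_on_eq_iff[OF inj_simple _ i] in \<open>simp_all add: representation_basis[OF independent_simple] eq_commute[of "\<alpha> i"]\<close>)
  finally show "root_coeff \<alpha> b i = b \<bullet> \<omega> i" using i by (simp add: root_coeff_def)
qed

text \<open>The coordinates of \<open>b\<close> in the simple roots are its products with the
  fundamental coweights, so for roots this is positivity. The zero vector qualifies too, and
  differences of roots are tested with the same predicate.\<close>

definition pos :: "'a \<Rightarrow> bool" where
  "pos b \<longleftrightarrow> (\<forall>i\<in>{1..DIM('a)}. b \<bullet> \<omega> i \<ge> 0)"

lemma root_coeffs:
  assumes "b \<in> R"
  shows "(\<forall>i\<in>{1..DIM('a)}. b \<bullet> \<omega> i \<in> \<int>) \<and> (pos b \<or> pos (- b))"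
proof -
  obtain c :: "nat \<Rightarrow> nat" where c: "b = (\<Sum>i=1..DIM('a). of_nat (c i) *\<^sub>R \<alpha> i) \<or>
        b = - (\<Sum>i=1..DIM('a). of_nat (c i) *\<^sub>R \<alpha> i)"
    using base assms unfolding root_base_def by blast
  have *: "(\<Sum>i\<in>{1..DIM('a)}. of_nat (c i) *\<^sub>R \<alpha> i) \<bullet> \<omega> j = of_nat (c j)" if "j \<in> {1..DIM('a)}" for j
  proof -
    have "(\<Sum>i\<in>{1..DIM('a)}. of_nat (c i) *\<^sub>R \<alpha> i) \<bullet> \<omega> j = (\<Sum>i\<in>{1..DIM('a)}. if i = j then of_nat (c i) else 0)"
      unfolding inner_sum_left by (rule sum.cong) (auto simp: coeff_simple)
    then show ?thesis using that by simp
  qed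
  show ?thesis using c by (elim disjE) (simp_all add: pos_def *)
qed

lemma root_coeff_int: "b \<in> R \<Longrightarrow> i \<in> {1..DIM('a)} \<Longrightarrow> b \<bullet> \<omega> i \<in> \<int>"
  and root_sign: "b \<in> R \<Longrightarrow> pos b \<or> pos (- b)"
  using root_coeffs by auto

text \<open>Roots never mix signs, so one positive coordinate decides.\<close>

lemma root_pos_coeff: "b \<in> R \<Longrightarrow> i \<in> {1..DIM('a)} \<Longrightarrow> b \<bullet> \<omega> i > 0 \<Longrightarrow> pos b"
proof -
  assume b: "b \<in> R" "i \<in> {1..DIM('a)}" "b \<bullet> \<omega> i > 0"
  then have "\<not> pos (- b)" unfolding pos_def inner_minus_left neg_0_le_iff_le not_le[symmetric] by blast
  then show "pos b" using root_sign[OF b(1)] by blast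
qed

lemma pos_sum_coeffs: "pos b \<Longrightarrow> b \<noteq> 0 \<Longrightarrow> (\<Sum>i\<in>{1..DIM('a)}. b \<bullet> \<omega> i) > 0"
proof -
  assume b: "pos b" "b \<noteq> 0"
  have "\<exists>i\<in>{1..DIM('a)}. b \<bullet> \<omega> i \<noteq> 0"
  proof (rule ccontr)
    assume "\<not> ?thesis"
    then have "(\<Sum>i\<in>{1..DIM('a)}. (b \<bullet> \<omega> i) *\<^sub>R \<alpha> i) = 0" by (intro sum.neutral) auto
    then have "b = 0" using simple_expansion[of b] by (rule trans[rotated])
    then show False using b by simp
  qed
  then obtain i where "i \<in> {1..DIM('a)}" "b \<bullet> \<omega> i \<noteq> 0" by blast
  moreover have "\<forall>i\<in>{1..DIM('a)}. 0 \<le> b \<bullet> \<omega> i" using b by (simp add: pos_def)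
  ultimately show "(\<Sum>i\<in>{1..DIM('a)}. b \<bullet> \<omega> i) > 0" by (intro sum_pos2[of "{1..DIM('a)}" i]) (auto simp: order.order_iff_strict)
qed

text \<open>If one of the two Cartan integers is -1, a reflection produces the sum. Otherwise both
  are at most -2, which makes the squared norm of \<open>a + b\<close> nonpositive.\<close>

lemma root_add:
  assumes a: "a \<in> R" and b: "b \<in> R" and neg: "a \<bullet> b < 0"
  shows "a + b \<in> R \<or> a + b = 0"
proof -
  have pa: "a \<bullet> a > 0" and pb: "b \<bullet> b > 0" using root_nonzero a b by auto
  obtain p where p: "2 * (a \<bullet> b) / (b \<bullet> b) = of_int p"
    using cartan_integer[OF b a] by (auto elim: Ints_cases)
  obtain q where q: "2 * (a \<bullet> b) / (a \<bullet> a) = of_int q"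
    using cartan_integer[OF a b] by (auto simp: inner_commute elim: Ints_cases)
  have "real_of_int p < 0" "real_of_int q < 0"
    using neg pa pb by (auto simp flip: p q simp: divide_neg_pos)
  then have pn: "p \<le> -1" and qn: "q \<le> -1" by auto
  consider "p = -1" | "q = -1" | "p \<le> -2" "q \<le> -2" using pn qn by linarith
  then show ?thesis
  proof cases
    case 1
    then have "affine_refl b 0 a = a + b" using p by (simp add: affine_refl_linear)
    then show ?thesis using root_refl[OF b a] by simp
  next
    case 2
    then have "affine_refl a 0 b = a + b" using q by (simp add: affine_refl_linear inner_commute)
    then show ?thesis using root_refl[OF a b] by simp
  next
    case 3
    have "2 * (a \<bullet> b) = p * (b \<bullet> b)" "2 * (a \<bullet> b) = q * (a \<bullet> a)"
      using p q pa pb by (auto simp: field_simps)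
    moreover have "p * (b \<bullet> b) \<le> -2 * (b \<bullet> b)" "q * (a \<bullet> a) \<le> -2 * (a \<bullet> a)"
      using 3 pa pb by (intro mult_right_mono; simp)+
    ultimately have "(a + b) \<bullet> (a + b) \<le> 0"
      by (simp add: inner_add_left inner_add_right inner_commute)
    then have "a + b = 0" using inner_ge_zero[of "a + b"] by (simp add: order_antisym)
    then show ?thesis by simp
  qed
qed

text \<open>Otherwise \<open>root_add\<close> would make the difference of the two simple roots a
  root with coordinates of both signs.\<close>

lemma simple_obtuse: "i \<in> {1..DIM('a)} \<Longrightarrow> j \<in> {1..DIM('a)} \<Longrightarrow> i \<noteq> j \<Longrightarrow> \<alpha> i \<bullet> \<alpha> j \<le> 0"
proof (rule ccontr)
  assume ij: "i \<in> {1..DIM('a)}" "j \<in> {1..DIM('a)}" "i \<noteq> j" and "\<not> \<alpha> i \<bullet> \<alpha> j \<le> 0"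
  then have "\<alpha> i + - \<alpha> j \<in> R \<or> \<alpha> i + - \<alpha> j = 0"
    using root_add[OF simple_root root_uminus[OF simple_root], of i j] by simp
  moreover have "\<alpha> i \<noteq> \<alpha> j" using ij inj_on_eq_iff[OF inj_simple] by simp
  ultimately have "\<alpha> i - \<alpha> j \<in> R" by simp
  moreover have "(\<alpha> i - \<alpha> j) \<bullet> \<omega> i = 1" "(\<alpha> i - \<alpha> j) \<bullet> \<omega> j = -1"
    using ij by (auto simp: inner_diff_left coeff_simple)
  ultimately have "\<not> pos (\<alpha> i - \<alpha> j)" "\<not> pos (- (\<alpha> i - \<alpha> j))" "\<alpha> i - \<alpha> j \<in> R"
    using ij(1,2) unfolding pos_def inner_minus_left by (metis neg_0_le_iff_le not_one_le_zero)+
  then show False using root_sign by blast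
qed

lemma roots_nonempty: "R \<noteq> {}"
  using simple_root[of 1] DIM_positive[where 'a='a] by (metis Suc_leI One_nat_def atLeastAtMost_iff empty_iff le_refl)

lemma height_add_simple: "j \<in> {1..DIM('a)} \<Longrightarrow>
    (\<Sum>i\<in>{1..DIM('a)}. (b + \<alpha> j) \<bullet> \<omega> i) = (\<Sum>i\<in>{1..DIM('a)}. b \<bullet> \<omega> i) + 1"
proof -
  assume j: "j \<in> {1..DIM('a)}"
  then have "(\<Sum>i\<in>{1..DIM('a)}. \<alpha> j \<bullet> \<omega> i) = (\<Sum>i\<in>{1..DIM('a)}. if i = j then 1 else 0)"
    by (intro sum.cong) (auto simp: coeff_simple)
  then show ?thesis using j by (simp add: inner_add_left sum.distrib)
qed

text \<open>The positive number \<open>b \<bullet> b\<close> is the sum of the products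
  \<open>(b \<bullet> \<omega> i) * (b \<bullet> \<alpha> i)\<close>, so one of them is
  positive.\<close>

lemma pos_root_simple:
  assumes b: "b \<in> R" "pos b"
  obtains i where "i \<in> {1..DIM('a)}" "b \<bullet> \<alpha> i > 0" "b \<bullet> \<omega> i > 0"
proof -
  have "0 < (\<Sum>i\<in>{1..DIM('a)}. (b \<bullet> \<omega> i) * (b \<bullet> \<alpha> i))"
    unfolding inner_expansion[of b b, symmetric] using root_nonzero[OF b(1)] by simp
  then have "\<exists>i\<in>{1..DIM('a)}. (b \<bullet> \<omega> i) * (b \<bullet> \<alpha> i) > 0"
    by (meson linorder_not_le sum_nonpos)
  then obtain i where "i \<in> {1..DIM('a)}" "(b \<bullet> \<omega> i) * (b \<bullet> \<alpha> i) > 0" by blast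
  moreover from this b have "b \<bullet> \<omega> i \<ge> 0" by (simp add: pos_def)
  ultimately show ?thesis using that[of i] by (simp add: zero_less_mult_iff)
qed

text \<open>A root of minimal height whose support meets both parts would, after subtraction of a simple
  root, have to be reflected to a root of mixed sign.\<close>

lemma orthogonal_split_roots:
  assumes JK: "J \<union> K = {1..DIM('a)}" "J \<inter> K = {}" and orth: "\<And>j k. j \<in> J \<Longrightarrow> k \<in> K \<Longrightarrow> \<alpha> j \<bullet> \<alpha> k = 0"
    and b: "b \<in> R" "pos b"
  shows "(\<forall>j\<in>J. b \<bullet> \<omega> j = 0) \<or> (\<forall>k\<in>K. b \<bullet> \<omega> k = 0)"
proof -
  define mixed where "mixed b \<longleftrightarrow> (\<exists>j\<in>J. b \<bullet> \<omega> j > 0) \<and> (\<exists>k\<in>K. b \<bullet> \<omega> k > 0)" for b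
  have "\<not> mixed b" if "b \<in> R" "pos b" "(\<Sum>i\<in>{1..DIM('a)}. b \<bullet> \<omega> i) = of_nat n" for n b
    using that
  proof (induction n arbitrary: b rule: less_induct)
    case (less n b)
    show ?case
    proof
      assume m: "mixed b"
      obtain i where i: "i \<in> {1..DIM('a)}" "b \<bullet> \<alpha> i > 0" "b \<bullet> \<omega> i > 0" using pos_root_simple less.prems(1,2) .
      define c where "c = b - \<alpha> i"
      have ht: "(\<Sum>i\<in>{1..DIM('a)}. b \<bullet> \<omega> i) = (\<Sum>i\<in>{1..DIM('a)}. c \<bullet> \<omega> i) + 1"
        using height_add_simple[OF i(1), of c] by (simp add: c_def)
      have cc: "c \<bullet> \<omega> j = (if j = i then b \<bullet> \<omega> i - 1 else b \<bullet> \<omega> j)" for j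
        using i(1) by (simp add: c_def inner_diff_left coeff_simple)
      obtain j1 j2 where "j1 \<in> J" "b \<bullet> \<omega> j1 > 0" "j2 \<in> K" "b \<bullet> \<omega> j2 > 0"
        using m unfolding mixed_def by blast
      then have "\<exists>j\<in>{1..DIM('a)}. j \<noteq> i \<and> b \<bullet> \<omega> j > 0" using JK by (cases "j1 = i") auto
      then obtain j where j: "j \<in> {1..DIM('a)}" "j \<noteq> i" "b \<bullet> \<omega> j > 0" by blast
      then have cj: "c \<bullet> \<omega> j > 0" using cc by simp
      then have "c \<noteq> 0" by auto
      then have cR: "c \<in> R"
        using root_add[of b "- \<alpha> i"] less.prems i simple_root root_uminus by (auto simp: c_def)
      have cpos: "pos c" using root_pos_coeff[OF cR j(1) cj] .
      have "0 < (\<Sum>i\<in>{1..DIM('a)}. c \<bullet> \<omega> i)" using pos_sum_coeffs cpos \<open>c \<noteq> 0\<close> by blast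
      then have "(\<Sum>i\<in>{1..DIM('a)}. c \<bullet> \<omega> i) = of_nat (n - 1)" "n - 1 < n" using ht less.prems(3) by (auto simp: of_nat_diff)
      then have nm: "\<not> mixed c" using less.IH cR cpos by blast

      \<comment> \<open>By the induction hypothesis \<open>c\<close> is not mixed, so subtracting
        \<open>\<alpha> i\<close> has emptied the support of \<open>b\<close> on the side of
        \<open>i\<close>: the coordinate at \<open>i\<close> is 1 and, by \<open>alone\<close>, no
        other coordinate on that side survives.\<close>
      have bi: "b \<bullet> \<omega> i = 1"
      proof -
        have "b \<bullet> \<omega> i \<in> \<int>" using root_coeff_int less.prems i by blast
        moreover have "\<not> b \<bullet> \<omega> i > 1"
        proof
          assume "b \<bullet> \<omega> i > 1"
          then have "b \<bullet> \<omega> j > 0 \<Longrightarrow> c \<bullet> \<omega> j > 0" for j using cc[of j] by (cases "j = i") auto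
          then show False using nm m unfolding mixed_def by blast
        qed
        ultimately obtain z where "b \<bullet> \<omega> i = of_int z" "\<not> real_of_int z > 1" by (auto elim: Ints_cases)
        then show ?thesis using i(3) by simp
      qed
      have alone: "b \<bullet> \<omega> k = 0" if k: "k \<in> {1..DIM('a)}" "k \<noteq> i" "(i \<in> J \<longleftrightarrow> k \<in> J)" for k
      proof (rule ccontr)
        assume "b \<bullet> \<omega> k \<noteq> 0"
        then have bk: "b \<bullet> \<omega> k > 0" using less.prems(2) k by (auto simp: pos_def order.order_iff_strict)
        then have ck: "c \<bullet> \<omega> k > 0" using cc k by simp
        show False
        proof (cases "i \<in> J")
          case True
          obtain k' where k': "k' \<in> K" "b \<bullet> \<omega> k' > 0" using m mixed_def by auto
          then have "k' \<noteq> i" using True JK by blast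
          then have "c \<bullet> \<omega> k' > 0" using cc[of k'] k' by simp
          then show False using nm ck True k k' unfolding mixed_def by blast
        next
          case False
          obtain k' where k': "k' \<in> J" "b \<bullet> \<omega> k' > 0" using m mixed_def by auto
          then have "k' \<noteq> i" using False by blast
          then have "c \<bullet> \<omega> k' > 0" using cc[of k'] k' by simp
          then show False using nm ck False k k' JK unfolding mixed_def by blast
        qed
      qed
      have aa: "\<alpha> i \<bullet> \<alpha> i > 0" using root_nonzero simple_root i by auto
      have "\<alpha> i \<bullet> b = (\<Sum>k\<in>{1..DIM('a)}. if k = i then \<alpha> i \<bullet> \<alpha> i else 0)"
        unfolding inner_expansion[of "\<alpha> i" b]
      proof (rule sum.cong)
        fix k assume k: "k \<in> {1..DIM('a)}"
        show "(b \<bullet> \<omega> k) * (\<alpha> i \<bullet> \<alpha> k) = (if k = i then \<alpha> i \<bullet> \<alpha> i else 0)"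
        proof (cases "i \<in> J \<longleftrightarrow> k \<in> J")
          case True
          then show ?thesis using alone[OF k] bi by auto
        next
          case False
          moreover from this have "\<alpha> i \<bullet> \<alpha> k = 0"
            using orth[of i k] orth[of k i] JK k i(1) by (auto simp: inner_commute)
          ultimately show ?thesis by auto
        qed
      qed simp
      then have "b \<bullet> \<alpha> i = \<alpha> i \<bullet> \<alpha> i" using i by (simp add: inner_commute)
      \<comment> \<open>Orthogonality to the other side leaves only the term of \<open>i\<close>, so
        the reflection turns the coordinate 1 into -1 while the coordinate at \<open>j\<close> stays
        positive.\<close>
      then have "affine_refl (\<alpha> i) 0 b = b - 2 *\<^sub>R \<alpha> i" using aa by (simp add: affine_refl_linear)
      then have "b - 2 *\<^sub>R \<alpha> i \<in> R" using root_refl simple_root i less.prems by metis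
      moreover have "(b - 2 *\<^sub>R \<alpha> i) \<bullet> \<omega> i = -1" "(b - 2 *\<^sub>R \<alpha> i) \<bullet> \<omega> j > 0"
        using bi i j by (auto simp: inner_diff_left coeff_simple)
      ultimately show False using root_sign i(1) j(1) by (force simp: pos_def)
    qed
  qed
  moreover have "\<exists>n::nat. (\<Sum>i\<in>{1..DIM('a)}. b \<bullet> \<omega> i) = of_nat n"
  proof -
    have "(\<Sum>i\<in>{1..DIM('a)}. b \<bullet> \<omega> i) \<in> \<int>" using b root_coeff_int by (intro Ints_sum) auto
    moreover have "(\<Sum>i\<in>{1..DIM('a)}. b \<bullet> \<omega> i) \<ge> 0" using b by (intro sum_nonneg) (auto simp: pos_def)
    ultimately show ?thesis by (metis Ints_cases of_int_0_le_iff of_int_of_nat_eq zero_le_imp_eq_int)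
  qed
  ultimately have "\<not> mixed b" using b by blast
  moreover have "0 \<le> b \<bullet> \<omega> i" if "i \<in> J \<union> K" for i using b JK that unfolding pos_def by blast
  ultimately show ?thesis unfolding mixed_def by (metis UnI1 UnI2 order.order_iff_strict)
qed

section \<open>The highest root\<close>

lemma dominant_max_height:
  assumes b: "b \<in> R" "pos b" and i: "i \<in> {1..DIM('a)}" and max: "b + \<alpha> i \<notin> R"
  shows "b \<bullet> \<alpha> i \<ge> 0"
proof (rule ccontr)
  assume "\<not> b \<bullet> \<alpha> i \<ge> 0"
  then have "b + \<alpha> i = 0" using root_add[OF b(1) simple_root[OF i]] max by auto
  then have "(b + \<alpha> i) \<bullet> \<omega> i = 0" by simp
  moreover have "(b + \<alpha> i) \<bullet> \<omega> i \<ge> 1" using b i by (simp add: inner_add_left coeff_simple pos_def)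
  ultimately show False by simp
qed

text \<open>Let \<open>t\<close> have maximal height. Being dominant, it makes the simple roots
  inside and outside its support orthogonal, so irreducibility forces full support. Then
  \<open>t\<close> has positive product with every dominant positive root \<open>c\<close>, hence
  \<open>t - c\<close> is a root or zero, and maximality of the height excludes a negative
  one.\<close>

lemma highest_root_ex:
  "\<exists>a\<in>R. (\<forall>i\<in>{1..DIM('a)}. a \<bullet> \<omega> i > 0) \<and> (\<forall>b\<in>R. \<forall>i\<in>{1..DIM('a)}. b \<bullet> \<omega> i \<le> a \<bullet> \<omega> i)"
proof -
  define ht where "ht b = (\<Sum>i\<in>{1..DIM('a)}. b \<bullet> \<omega> i)" for b
  have ht_add: "ht (b + \<alpha> i) = ht b + 1" if "i \<in> {1..DIM('a)}" for b i
    using height_add_simple[OF that] by (simp add: ht_def)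
  have ht_sum: "ht (b - c) = ht b - ht c" "ht (- b) = - ht b" for b c
    by (simp_all add: ht_def inner_diff_left sum_subtractf sum_negf)
  have ht_pos: "ht b > 0" if "pos b" "b \<noteq> 0" for b using pos_sum_coeffs[OF that] by (simp add: ht_def)
  obtain t where t: "t \<in> R" "\<And>b. b \<in> R \<Longrightarrow> ht b \<le> ht t"
    using arg_min_if_finite[OF finite_roots roots_nonempty, of "\<lambda>b. - ht b"] by (meson neg_less_iff_less not_le)
  have one: "1 \<in> {1..DIM('a)}" using DIM_positive[where 'a='a] by (simp add: Suc_leI One_nat_def)
  have tpos: "pos t"
  proof (rule ccontr)
    assume "\<not> pos t"
    then have "ht (- t) > 0" using root_sign[OF t(1)] root_nonzero[OF t(1)] ht_pos by simp
    moreover have "ht (- t) \<le> ht t" using t root_uminus by blast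
    ultimately show False by (simp add: ht_sum)
  qed
  have tdom: "t \<bullet> \<alpha> i \<ge> 0" if "i \<in> {1..DIM('a)}" for i
    using dominant_max_height[OF t(1) tpos that] t(2)[of "t + \<alpha> i"] ht_add[OF that] by auto
  define J where "J = {i \<in> {1..DIM('a)}. t \<bullet> \<omega> i > 0}"
  define K where "K = {1..DIM('a)} - J"
  have K: "t \<bullet> \<omega> k = 0" if "k \<in> K" for k
    using that tpos by (auto simp: K_def J_def pos_def order.order_iff_strict)
  have JK: "J \<union> K = {1..DIM('a)}" "J \<inter> K = {}" by (auto simp: J_def K_def)
  have orth: "\<alpha> j \<bullet> \<alpha> k = 0" if "j \<in> J" "k \<in> K" for j k
  proof -
    have "(\<Sum>i\<in>J. (t \<bullet> \<omega> i) * (\<alpha> k \<bullet> \<alpha> i)) = (\<Sum>i\<in>{1..DIM('a)}. (t \<bullet> \<omega> i) * (\<alpha> k \<bullet> \<alpha> i))"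
      using K by (intro sum.mono_neutral_left) (auto simp: J_def K_def)
    also have "\<dots> = \<alpha> k \<bullet> t" by (rule inner_expansion[symmetric])
    also have "\<dots> \<ge> 0" using tdom[of k] that(2) by (simp add: K_def inner_commute)
    finally have ge: "(\<Sum>i\<in>J. - ((t \<bullet> \<omega> i) * (\<alpha> k \<bullet> \<alpha> i))) \<le> 0" by (simp add: sum_negf)
    have nonneg: "- ((t \<bullet> \<omega> i) * (\<alpha> k \<bullet> \<alpha> i)) \<ge> 0" if i: "i \<in> J" for i
    proof -
      have "k \<in> {1..DIM('a)}" "i \<in> {1..DIM('a)}" "k \<noteq> i" using i \<open>k \<in> K\<close> JK by blast+
      then have "\<alpha> k \<bullet> \<alpha> i \<le> 0" by (rule simple_obtuse)
      moreover have "t \<bullet> \<omega> i > 0" using i by (simp add: J_def)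
      ultimately show ?thesis by (simp add: mult_nonneg_nonpos)
    qed
    have "(\<Sum>i\<in>J. - ((t \<bullet> \<omega> i) * (\<alpha> k \<bullet> \<alpha> i))) = 0"
      using ge sum_nonneg[of J "\<lambda>i. - ((t \<bullet> \<omega> i) * (\<alpha> k \<bullet> \<alpha> i))"] nonneg by (meson order_antisym)
    moreover have "finite J" by (simp add: J_def)
    ultimately have "(t \<bullet> \<omega> j) * (\<alpha> k \<bullet> \<alpha> j) = 0"
      using sum_nonneg_eq_0_iff[of J "\<lambda>i. - ((t \<bullet> \<omega> i) * (\<alpha> k \<bullet> \<alpha> i))"] nonneg that(1) by auto
    then show ?thesis using that by (auto simp: J_def inner_commute)
  qed
  have "K = {}"
  proof (rule ccontr)
    assume "K \<noteq> {}"
    then obtain k where k: "k \<in> K" by blast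
    define A where "A = {b \<in> R. \<forall>k\<in>K. b \<bullet> \<omega> k = 0}"
    define B where "B = {b \<in> R. \<forall>j\<in>J. b \<bullet> \<omega> j = 0}"
    have "t \<in> A" using t K by (simp add: A_def)
    moreover have "\<alpha> k \<in> B"
      using k simple_root[of k] unfolding B_def K_def by (auto simp: coeff_simple J_def)
    moreover have "b \<in> A \<union> B" if b: "b \<in> R" for b
    proof (cases "pos b")
      case True
      then show ?thesis using orthogonal_split_roots[OF JK orth b] b by (auto simp: A_def B_def)
    next
      case False
      then have "pos (- b)" using root_sign[OF b] by blast
      then show ?thesis using orthogonal_split_roots[OF JK orth root_uminus[OF b]] b by (auto simp: A_def B_def)
    qed
    moreover have "a \<bullet> b = 0" if "a \<in> A" "b \<in> B" for a b
    proof -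
      have "\<alpha> i \<bullet> a = 0" if i: "i \<in> K" for i
        unfolding inner_expansion[of "\<alpha> i" a]
      proof (rule sum.neutral, rule ballI)
        fix j assume "j \<in> {1..DIM('a)}"
        then show "a \<bullet> \<omega> j * (\<alpha> i \<bullet> \<alpha> j) = 0"
          using \<open>a \<in> A\<close> orth[of j i] i by (cases "j \<in> J") (auto simp: A_def K_def inner_commute)
      qed
      then show ?thesis unfolding inner_expansion[of a b]
        using \<open>b \<in> B\<close> by (intro sum.neutral ballI, case_tac "x \<in> J") (auto simp: B_def K_def inner_commute)
    qed
    moreover have "A \<union> B \<subseteq> R" by (auto simp: A_def B_def)
    ultimately have "A \<noteq> {} \<and> B \<noteq> {} \<and> A \<union> B = R \<and> (\<forall>a\<in>A. \<forall>b\<in>B. a \<bullet> b = 0)" by blast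
    then show False using irreducible unfolding irreducible_root_system_def by blast
  qed
  then have tJ: "t \<bullet> \<omega> i > 0" if "i \<in> {1..DIM('a)}" for i using that by (auto simp: J_def K_def)
  have "b \<bullet> \<omega> i \<le> t \<bullet> \<omega> i" if b: "b \<in> R" "pos b" and i: "i \<in> {1..DIM('a)}" for b i
  proof -
    \<comment> \<open>A root \<open>c\<close> of maximal height among those above \<open>b\<close>
      in all coordinates is dominant. Passing from \<open>b\<close> to \<open>c\<close> is what
      makes the product with \<open>t\<close> positive.\<close>
    define U where "U = {c \<in> R. \<forall>i\<in>{1..DIM('a)}. b \<bullet> \<omega> i \<le> c \<bullet> \<omega> i}"
    have "finite U" "U \<noteq> {}" using finite_roots b by (auto simp: U_def)
    then obtain c where c: "c \<in> U" "\<And>d. d \<in> U \<Longrightarrow> ht d \<le> ht c"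
      using arg_min_if_finite[of U "\<lambda>b. - ht b"] by (meson neg_less_iff_less not_le)
    have cR: "c \<in> R" and cb: "\<And>i. i \<in> {1..DIM('a)} \<Longrightarrow> b \<bullet> \<omega> i \<le> c \<bullet> \<omega> i" using c by (auto simp: U_def)
    have cpos: "pos c" using cb b(2) unfolding pos_def by (meson order_trans)
    have "c + \<alpha> i \<notin> R" if i: "i \<in> {1..DIM('a)}" for i
    proof
      assume "c + \<alpha> i \<in> R"
      then have "c + \<alpha> i \<in> U" using cb i by (force simp: U_def inner_add_left coeff_simple)
      then show False using c(2) ht_add[OF i] by force
    qed
    then have cdom: "c \<bullet> \<alpha> i \<ge> 0" if "i \<in> {1..DIM('a)}" for i using dominant_max_height cR cpos that by blast
    obtain k where k: "k \<in> {1..DIM('a)}" "c \<bullet> \<alpha> k > 0" using pos_root_simple[OF cR cpos] by blast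
    have "0 < (\<Sum>i\<in>{1..DIM('a)}. (t \<bullet> \<omega> i) * (c \<bullet> \<alpha> i))"
      using k tJ cdom by (intro sum_pos2[of "{1..DIM('a)}" k]) (auto simp: less_imp_le)
    then have ct: "c \<bullet> t > 0" using inner_expansion[of c t] by simp
    then have "t + - c \<in> R \<or> t + - c = 0"
      using root_add[OF t(1) root_uminus[OF cR]] by (simp add: inner_commute)
    then have "pos (t - c)"
    proof
      assume r: "t + - c \<in> R"
      show ?thesis
      proof (rule ccontr)
        assume "\<not> pos (t - c)"
        then have "pos (- (t - c))" using root_sign[OF r] by simp
        then have "ht (- (t + - c)) > 0" using ht_pos root_nonzero[OF r] by simp
        then show False using t(2)[OF cR] by (simp add: ht_sum)
      qed
    qed (simp add: pos_def)
    then show ?thesis using cb[OF i] i by (force simp: pos_def inner_diff_left)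
  qed
  moreover have "b \<bullet> \<omega> i \<le> t \<bullet> \<omega> i" if "b \<in> R" "\<not> pos b" "i \<in> {1..DIM('a)}" for b i
  proof -
    have "pos (- b)" using root_sign that by blast
    then have "b \<bullet> \<omega> i \<le> 0" using that by (auto simp: pos_def)
    then show ?thesis using tJ[OF that(3)] by linarith
  qed
  ultimately show ?thesis using t tJ by (intro bexI[of _ t]) blast+
qed

lemma highest_root: "\<theta> \<in> R" and highest_root_coeff_pos: "i \<in> {1..DIM('a)} \<Longrightarrow> \<theta> \<bullet> \<omega> i > 0"
  and highest_root_max: "b \<in> R \<Longrightarrow> i \<in> {1..DIM('a)} \<Longrightarrow> b \<bullet> \<omega> i \<le> \<theta> \<bullet> \<omega> i"
proof -
  obtain a where a: "a \<in> R" "\<forall>i\<in>{1..DIM('a)}. a \<bullet> \<omega> i > 0" "\<forall>b\<in>R. \<forall>i\<in>{1..DIM('a)}. b \<bullet> \<omega> i \<le> a \<bullet> \<omega> i"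
    using highest_root_ex by blast
  have "\<theta> = a" unfolding highest_root_def
  proof (rule the_equality)
    show "a \<in> R \<and> (\<forall>b\<in>R. \<forall>i\<in>{1..DIM('a)}. root_coeff \<alpha> b i \<le> root_coeff \<alpha> a i)"
      using a by (simp add: root_coeff_eq)
    fix c assume c: "c \<in> R \<and> (\<forall>b\<in>R. \<forall>i\<in>{1..DIM('a)}. root_coeff \<alpha> b i \<le> root_coeff \<alpha> c i)"
    then have "c \<bullet> \<omega> i = a \<bullet> \<omega> i" if "i \<in> {1..DIM('a)}" for i
      using a(1,3) that by (auto simp: root_coeff_eq intro!: order_antisym)
    then have "(\<Sum>i\<in>{1..DIM('a)}. (c \<bullet> \<omega> i) *\<^sub>R \<alpha> i) = (\<Sum>i\<in>{1..DIM('a)}. (a \<bullet> \<omega> i) *\<^sub>R \<alpha> i)"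
      by (intro sum.cong) auto
    then show "c = a" using simple_expansion[of c] simple_expansion[of a] by (metis (no_types, lifting))
  qed
  then show "\<theta> \<in> R" "i \<in> {1..DIM('a)} \<Longrightarrow> \<theta> \<bullet> \<omega> i > 0" "b \<in> R \<Longrightarrow> i \<in> {1..DIM('a)} \<Longrightarrow> b \<bullet> \<omega> i \<le> \<theta> \<bullet> \<omega> i"
    using a by auto
qed

end

section \<open>Hyperplanes and the fundamental alcove\<close>

text \<open>\<open>inv\<close> is the group inverse of HOL-Algebra here.\<close>

abbreviation iv :: "('b \<Rightarrow> 'b) \<Rightarrow> 'b \<Rightarrow> 'b" where
  "iv \<equiv> inv_into UNIV"

lemma same_side_int:
  fixes A B :: real
  assumes "0 < A" "A < 1" "0 < B" "B < 1"
  shows "(A - of_int k) * (B - of_int k) > 0"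
proof (cases "k \<le> 0")
  case True
  then have "of_int k \<le> (0::real)" by simp
  then show ?thesis using assms by (intro mult_pos_pos) auto
next
  case False
  then have "of_int k \<ge> (1::real)" by simp
  then show ?thesis using assms by (intro mult_neg_neg) auto
qed

context based_root_system
begin

text \<open>A common framework for the affine Weyl group and its extension: affine isometries whose
  linear part permutes the roots and whose translation part is a coweight. These permute the
  hyperplanes, so sets of separating hyperplanes can be transported along them.\<close>

definition aff :: "('a \<Rightarrow> 'a) \<Rightarrow> bool" where
  "aff f \<longleftrightarrow> (\<exists>L v. orthogonal_transformation L \<and> L ` R = R \<and> (\<forall>a\<in>R. v \<bullet> a \<in> \<int>) \<and> f = (\<lambda>x. L x + v))"

text \<open>The signed level is preserved and not only its zero set, so that sides of hyperplanes
  are transported as well.\<close>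

lemma aff_level:
  assumes "aff f" "a \<in> R"
  obtains b m where "b \<in> R" "\<And>x. f x \<bullet> b - of_int m = x \<bullet> a - of_int k"
proof -
  obtain L v where L: "orthogonal_transformation L" "L ` R = R" "\<forall>a\<in>R. v \<bullet> a \<in> \<int>" "f = (\<lambda>x. L x + v)"
    using assms(1) by (auto simp: aff_def)
  have b: "L a \<in> R" using L assms by blast
  then obtain z where z: "v \<bullet> L a = of_int z" using L(3) by (meson Ints_cases)
  have "f x \<bullet> L a - of_int (k + z) = x \<bullet> a - of_int k" for x
    using L(1) z by (simp add: L(4) inner_add_left orthogonal_transformation_def)
  with b show ?thesis using that by blast
qed

lemma aff_bij: "aff f \<Longrightarrow> bij f"
proof -
  assume "aff f"
  then obtain L v where L: "orthogonal_transformation L" "f = (\<lambda>x. L x + v)" by (auto simp: aff_def)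
  have "bij (\<lambda>x. x + v)" by (rule o_bij[of "\<lambda>x. x - v"]) auto
  then have "bij ((\<lambda>x. x + v) \<circ> L)"
    using orthogonal_transformation_bij[OF L(1)] by (rule bij_comp[rotated])
  then show ?thesis by (simp add: L(2) o_def)
qed

lemma aff_inj: "aff f \<Longrightarrow> f x = f y \<longleftrightarrow> x = y"
  using aff_bij by (metis bij_is_inj injD)

lemma aff_id: "aff id"
  unfolding aff_def by (intro exI[of _ id] exI[of _ 0]) (auto simp: orthogonal_transformation_def linear_id)

lemma aff_comp:
  assumes "aff f" "aff g"
  shows "aff (f \<circ> g)"
proof -
  obtain L v where L: "orthogonal_transformation L" "L ` R = R" "\<forall>a\<in>R. v \<bullet> a \<in> \<int>" "f = (\<lambda>x. L x + v)"
    using assms(1) by (auto simp: aff_def)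
  obtain M u where M: "orthogonal_transformation M" "M ` R = R" "\<forall>a\<in>R. u \<bullet> a \<in> \<int>" "g = (\<lambda>x. M x + u)"
    using assms(2) by (auto simp: aff_def)
  have "(L u + v) \<bullet> a \<in> \<int>" if "a \<in> R" for a
  proof -
    have "a \<in> L ` R" by (subst L(2)) (rule that)
    then obtain b where b: "b \<in> R" "a = L b" by blast
    then have "L u \<bullet> a = u \<bullet> b" using L(1) by (simp add: orthogonal_transformation_def)
    then show ?thesis using M(3) L(3) b(1) that by (simp add: inner_add_left)
  qed
  moreover have "(L \<circ> M) ` R = R" using L(2) M(2) by (metis image_comp)
  moreover have "f \<circ> g = (\<lambda>x. (L \<circ> M) x + (L u + v))"
    using L(1) by (auto simp: L(4) M(4) orthogonal_transformation_def linear_add)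
  ultimately show ?thesis
    unfolding aff_def using orthogonal_transformation_compose[OF L(1) M(1)] by blast
qed

lemma aff_inv:
  assumes "aff f"
  shows "aff (iv f)"
proof -
  obtain L v where L: "orthogonal_transformation L" "L ` R = R" "\<forall>a\<in>R. v \<bullet> a \<in> \<int>" "f = (\<lambda>x. L x + v)"
    using assms by (auto simp: aff_def)
  have bL: "bij L" using L(1) by (rule orthogonal_transformation_bij)
  have LL: "L (iv L x) = x" "iv L (L x) = x" for x
    using bL by (auto simp: bij_is_surj surj_f_inv_f bij_is_inj)
  have oL: "orthogonal_transformation (iv L)" using orthogonal_transformation_inv[OF L(1)] .
  have "(- iv L v) \<bullet> a \<in> \<int>" if "a \<in> R" for a
  proof -
    have "iv L v \<bullet> a = v \<bullet> L a"
      using L(1) LL(1)[of v] unfolding orthogonal_transformation_def by metis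
    then show ?thesis using L(2,3) that by auto
  qed
  moreover have "iv L ` R = R" using L(2) image_inv_f_f[OF bij_is_inj[OF bL], of R] by simp
  moreover have "iv f = (\<lambda>x. iv L x + - iv L v)"
  proof (rule inv_unique_comp)
    show "f \<circ> (\<lambda>x. iv L x + - iv L v) = id"
      using L(1) LL by (auto simp: L(4) orthogonal_transformation_def linear_diff)
    show "(\<lambda>x. iv L x + - iv L v) \<circ> f = id"
      using oL LL by (auto simp: L(4) orthogonal_transformation_def linear_add)
  qed
  ultimately show ?thesis using oL unfolding aff_def by blast
qed

lemma aff_affine_refl: "a \<in> R \<Longrightarrow> aff (affine_refl a k)"
proof -
  assume a: "a \<in> R"
  have "affine_refl a 0 ` R = R"
  proof
    show "affine_refl a 0 ` R \<subseteq> R" using root_refl[OF a] by blast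
    show "R \<subseteq> affine_refl a 0 ` R"
      using root_refl[OF a] affine_refl_involution[OF root_nonzero[OF a]] by (metis image_eqI subsetI)
  qed
  moreover have "(of_int k *\<^sub>R coroot a) \<bullet> b \<in> \<int>" if "b \<in> R" for b
    using Ints_mult[OF Ints_of_int cartan_integer[OF a that]] by (simp add: inner_commute[of _ b])
  moreover have "affine_refl a k = (\<lambda>x. affine_refl a 0 x + of_int k *\<^sub>R coroot a)"
    using affine_refl_eq by blast
  ultimately show ?thesis
    unfolding aff_def using orthogonal_affine_refl[OF root_nonzero[OF a]] by blast
qed

lemma aff_transl: "(\<And>a. a \<in> R \<Longrightarrow> v \<bullet> a \<in> \<int>) \<Longrightarrow> aff (transl v)"
  unfolding aff_def transl_def
  by (intro exI[of _ id] exI[of _ v]) (auto simp: orthogonal_transformation_def linear_id transl_def)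

lemma aff_affine_combination:
  assumes "aff f" shows "f ((1 - u) *\<^sub>R x + u *\<^sub>R y) = (1 - u) *\<^sub>R f x + u *\<^sub>R f y"
proof -
  obtain L v where L: "linear L" "f = (\<lambda>x. L x + v)"
    using assms by (auto simp: aff_def orthogonal_transformation_def)
  show ?thesis by (simp add: L(2) linear_add[OF L(1)] linear_cmul[OF L(1)])
     (simp add: scaleR_left_diff_distrib scaleR_add_right)
qed

section \<open>Separating hyperplanes\<close>

definition hyps :: "'a set set" where
  "hyps = {hyperplane a k | a k. a \<in> R}"

definition gen :: "'a \<Rightarrow> bool" where
  "gen p \<longleftrightarrow> (\<forall>h\<in>hyps. p \<notin> h)"

text \<open>Phrased with the segment, so that it depends on the hyperplane as a set and on no root
  describing it; \<open>sep_iff\<close> is the equivalent sign test for any such root.\<close>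

definition sep :: "'a \<Rightarrow> 'a \<Rightarrow> 'a set set" where
  "sep p q = {h \<in> hyps. p \<notin> h \<and> q \<notin> h \<and> closed_segment p q \<inter> h \<noteq> {}}"

lemma hyperplane_in_hyps: "a \<in> R \<Longrightarrow> hyperplane a k \<in> hyps"
  by (auto simp: hyps_def)

lemma hyps_cases:
  assumes "h \<in> hyps" obtains a k where "a \<in> R" "h = hyperplane a k"
  using assms by (auto simp: hyps_def)

lemma gen_iff: "gen p \<longleftrightarrow> (\<forall>a\<in>R. \<forall>k. p \<bullet> a - of_int k \<noteq> 0)"
  by (auto simp: gen_def hyps_def hyperplane_def)

lemma sep_iff:
  assumes "a \<in> R"
  shows "hyperplane a k \<in> sep p q \<longleftrightarrow> (p \<bullet> a - of_int k) * (q \<bullet> a - of_int k) < 0"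
proof -
  define A where "A = p \<bullet> a - of_int k"
  define B where "B = q \<bullet> a - of_int k"
  have lev: "((1 - u) *\<^sub>R p + u *\<^sub>R q) \<bullet> a - of_int k = (1 - u) * A + u * B" for u
    by (simp add: A_def B_def inner_add_left algebra_simps)
  have "hyperplane a k \<in> sep p q \<longleftrightarrow> A \<noteq> 0 \<and> B \<noteq> 0 \<and> (\<exists>u. 0 \<le> u \<and> u \<le> 1 \<and> (1 - u) * A + u * B = 0)"
    (is "_ \<longleftrightarrow> ?r")
  proof -
    have "closed_segment p q \<inter> hyperplane a k \<noteq> {} \<longleftrightarrow>
        (\<exists>u. 0 \<le> u \<and> u \<le> 1 \<and> ((1 - u) *\<^sub>R p + u *\<^sub>R q) \<bullet> a - of_int k = 0)"
      by (auto simp: closed_segment_def hyperplane_def)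
    then show ?thesis unfolding lev using hyperplane_in_hyps[OF assms]
      by (simp add: sep_def) (simp add: hyperplane_def A_def B_def)
  qed
  also have "\<dots> \<longleftrightarrow> A * B < 0"
  proof
    assume ?r
    then obtain u where u: "A \<noteq> 0" "B \<noteq> 0" "0 \<le> u" "u \<le> 1" "(1 - u) * A + u * B = 0" by blast
    show "A * B < 0"
    proof (rule ccontr)
      assume "\<not> A * B < 0"
      then consider "A > 0" "B > 0" | "A < 0" "B < 0" using u by (auto simp: mult_less_0_iff not_less linorder_neq_iff)
      then show False
      proof cases
        case 1
        then have "(1 - u) * A \<ge> 0" "u * B \<ge> 0" using u by auto
        then have "(1 - u) * A = 0" "u * B = 0" using u(5) by linarith+
        then show False using u by auto
      next
        case 2
        then have "(1 - u) * A \<le> 0" "u * B \<le> 0" using u by (auto simp: mult_le_0_iff)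
        then have "(1 - u) * A = 0" "u * B = 0" using u(5) by linarith+
        then show False using u by auto
      qed
    qed
  next
    assume AB: "A * B < 0"
    \<comment> \<open>The level varies affinely from \<open>A\<close> to \<open>B\<close> along the
      segment; this is the parameter at which it vanishes.\<close>
    define u where "u = A / (A - B)"
    have "A \<noteq> B" using AB by (auto simp: mult_less_0_iff)
    then have "(1 - u) * A + u * B = 0" by (simp add: u_def field_simps)
    moreover have "0 \<le> u" "u \<le> 1" using AB by (auto simp: u_def mult_less_0_iff divide_simps)
    ultimately show ?r using AB by auto
  qed
  finally show ?thesis by (simp add: A_def B_def)
qed

lemma sep_subset_hyps: "h \<in> sep p q \<Longrightarrow> h \<in> hyps"
  by (simp add: sep_def)

lemma sep_sym: "sep p q = sep q p"
  by (auto simp: sep_def closed_segment_commute)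

lemma sep_self: "sep p p = {}"
  by (auto simp: sep_def)

lemma aff_hyperplane:
  assumes "aff f" "\<And>x. f x \<bullet> b - of_int m = x \<bullet> a - of_int k"
  shows "f ` hyperplane a k = hyperplane b m"
proof
  show "f ` hyperplane a k \<subseteq> hyperplane b m"
  proof clarify
    fix x assume "x \<in> hyperplane a k"
    then show "f x \<in> hyperplane b m" using assms(2)[of x] by (simp add: hyperplane_def)
  qed
  show "hyperplane b m \<subseteq> f ` hyperplane a k"
  proof
    fix y assume "y \<in> hyperplane b m"
    moreover obtain x where "y = f x" using aff_bij[OF assms(1)] by (metis bij_pointE)
    ultimately show "y \<in> f ` hyperplane a k" using assms(2)[of x] by (auto simp: hyperplane_def)
  qed
qed

lemma aff_hyps: "aff f \<Longrightarrow> h \<in> hyps \<Longrightarrow> f ` h \<in> hyps"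
  by (elim hyps_cases) (metis aff_hyperplane aff_level hyperplane_in_hyps)

lemma inv_image_aff: "aff f \<Longrightarrow> iv f ` f ` h = h" "aff f \<Longrightarrow> f ` iv f ` h = h"
  using aff_bij by (auto simp: bij_is_inj bij_is_surj image_f_inv_f)

lemma aff_inv_app: "aff f \<Longrightarrow> iv f (f x) = x" "aff f \<Longrightarrow> f (iv f x) = x"
  using aff_bij by (auto simp: bij_is_inj bij_is_surj surj_f_inv_f)

lemma aff_inv_comp: "aff f \<Longrightarrow> iv f \<circ> f = id" "aff f \<Longrightarrow> f \<circ> iv f = id"
  by (auto simp: aff_inv_app)

lemma gen_aff: "aff f \<Longrightarrow> gen p \<Longrightarrow> gen (f p)"
  unfolding gen_def by (metis aff_hyps aff_inv aff_inv_app(1) imageI)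

lemma aff_image_sep:
  assumes f: "aff f" and h: "h \<in> sep p q"
  shows "f ` h \<in> sep (f p) (f q)"
proof -
  obtain a k where a: "a \<in> R" "h = hyperplane a k" using h sep_subset_hyps hyps_cases by metis
  obtain b m where b: "b \<in> R" "\<And>x. f x \<bullet> b - of_int m = x \<bullet> a - of_int k"
    using aff_level[OF f a(1)] by metis
  show ?thesis using h unfolding a(2) aff_hyperplane[OF f b(2)] sep_iff[OF a(1)] sep_iff[OF b(1)] b(2) .
qed

lemma sep_image: "aff f \<Longrightarrow> sep (f p) (f q) = image f ` sep p q"
proof
  assume f: "aff f"
  show "image f ` sep p q \<subseteq> sep (f p) (f q)" using aff_image_sep[OF f] by blast
  show "sep (f p) (f q) \<subseteq> image f ` sep p q"
  proof
    fix h assume "h \<in> sep (f p) (f q)"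
    then have "iv f ` h \<in> sep p q" using aff_image_sep[OF aff_inv[OF f]] aff_inv_app[OF f] by metis
    then show "h \<in> image f ` sep p q" using inv_image_aff(2)[OF f] by (metis imageI)
  qed
qed

lemma image_mem_sep: "aff f \<Longrightarrow> f ` h \<in> sep (f p) (f q) \<longleftrightarrow> h \<in> sep p q"
  by (metis aff_image_sep aff_inv aff_inv_app(1) inv_image_aff(1))

lemma card_sep_aff: "aff f \<Longrightarrow> card (sep (f p) (f q)) = card (sep p q)"
  unfolding sep_image by (rule card_image) (metis inj_onI inv_image_aff(1))

text \<open>For points off all hyperplanes every hyperplane has exactly two sides, so crossings
  count modulo 2. The additivity and exchange arguments all rest on this rule.\<close>

lemma sep_triangle:
  assumes "gen p" "gen q" "gen r"
  shows "h \<in> sep p r \<longleftrightarrow> (h \<in> sep p q) \<noteq> (h \<in> sep q r)"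
proof (cases "h \<in> hyps")
  case True
  then obtain a k where a: "a \<in> R" "h = hyperplane a k" using hyps_cases by metis
  show ?thesis using assms a(1) unfolding gen_iff a(2) sep_iff[OF a(1)] mult_less_0_iff
    by (metis less_asym linorder_neqE_linordered_idom)
qed (use sep_subset_hyps in blast)

text \<open>The level of a separating hyperplane lies between the values of its root at the two
  points, hence in a bounded range for each of the finitely many roots.\<close>

lemma finite_sep: "finite (sep p q)"
proof -
  have "sep p q \<subseteq> (\<Union>a\<in>R. hyperplane a ` {- \<lceil>\<bar>p \<bullet> a\<bar> + \<bar>q \<bullet> a\<bar>\<rceil> .. \<lceil>\<bar>p \<bullet> a\<bar> + \<bar>q \<bullet> a\<bar>\<rceil>})"
  proof
    fix h assume h: "h \<in> sep p q"
    then obtain a k where a: "a \<in> R" "h = hyperplane a k" using sep_subset_hyps hyps_cases by metis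
    then have "(p \<bullet> a - of_int k) * (q \<bullet> a - of_int k) < 0" using h sep_iff by blast
    then have "\<bar>real_of_int k\<bar> \<le> \<bar>p \<bullet> a\<bar> + \<bar>q \<bullet> a\<bar>" unfolding mult_less_0_iff by linarith
    then have "k \<in> {- \<lceil>\<bar>p \<bullet> a\<bar> + \<bar>q \<bullet> a\<bar>\<rceil> .. \<lceil>\<bar>p \<bullet> a\<bar> + \<bar>q \<bullet> a\<bar>\<rceil>}" by (auto simp: abs_le_iff) linarith+
    then show "h \<in> (\<Union>a\<in>R. hyperplane a ` {- \<lceil>\<bar>p \<bullet> a\<bar> + \<bar>q \<bullet> a\<bar>\<rceil> .. \<lceil>\<bar>p \<bullet> a\<bar> + \<bar>q \<bullet> a\<bar>\<rceil>})"
      using a by blast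
  qed
  then show ?thesis by (rule finite_subset) (intro finite_UN_I finite_roots finite_imageI finite_atLeastAtMost_int)
qed

section \<open>The fundamental alcove and its walls\<close>

lemma fund_alcove_nonempty: "C0 \<noteq> {}"
proof -
  define S where "S = (\<Sum>i\<in>{1..DIM('a)}. \<theta> \<bullet> \<omega> i)"
  have one: "1 \<in> {1..DIM('a)}" using DIM_positive[where 'a='a] by (simp add: Suc_leI One_nat_def)
  have S: "S > 0" unfolding S_def using highest_root_coeff_pos one
    by (intro sum_pos2[of "{1..DIM('a)}" 1]) (auto simp: less_imp_le)
  \<comment> \<open>Scaled so that every simple root takes the value \<open>1 / (2 * S)\<close> and
    the highest root, whose height is \<open>S\<close>, the value 1/2.\<close>
  define x where "x = (1 / (2 * S)) *\<^sub>R (\<Sum>i\<in>{1..DIM('a)}. \<omega> i)"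
  have xa: "x \<bullet> \<alpha> j = 1 / (2 * S)" if "j \<in> {1..DIM('a)}" for j
  proof -
    have "(\<Sum>i\<in>{1..DIM('a)}. \<omega> i \<bullet> \<alpha> j) = (\<Sum>i\<in>{1..DIM('a)}. if i = j then 1 else 0)"
      by (rule sum.cong) (use that in \<open>auto simp: fund_coweight_inner\<close>)
    then show ?thesis using that by (simp add: x_def inner_sum_left)
  qed
  have "x \<bullet> \<theta> = (\<Sum>i\<in>{1..DIM('a)}. (\<theta> \<bullet> \<omega> i) * (1 / (2 * S)))"
    unfolding inner_expansion[of x \<theta>] by (rule sum.cong) (simp_all add: xa)
  also have "\<dots> = S * (1 / (2 * S))" by (simp only: S_def sum_distrib_right)
  finally have "x \<in> C0" using S xa by (simp add: fund_alcove_def)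
  then show ?thesis by blast
qed

definition x0 :: 'a where "x0 = (SOME x. x \<in> C0)"

lemma x0: "x0 \<in> C0"
  using fund_alcove_nonempty unfolding x0_def by (simp add: some_in_eq)

text \<open>The closed alcove given by inequalities; \<open>closure_alcove\<close> identifies it
  with the topological closure once topology is needed.\<close>

definition cl :: "'a set" where
  "cl = {x. (\<forall>i\<in>{1..DIM('a)}. x \<bullet> \<alpha> i \<ge> 0) \<and> x \<bullet> \<theta> \<le> 1}"

lemma alcove_subset_cl: "x \<in> C0 \<Longrightarrow> x \<in> cl"
  by (auto simp: cl_def fund_alcove_def less_imp_le)

lemma pos_le_highest:
  assumes "\<And>i. i \<in> {1..DIM('a)} \<Longrightarrow> x \<bullet> \<alpha> i \<ge> 0" "b \<in> R" "pos b"
  shows "0 \<le> x \<bullet> b" "x \<bullet> b \<le> x \<bullet> \<theta>"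
  unfolding inner_expansion[of x b] inner_expansion[of x \<theta>]
  using assms highest_root_max by (auto intro!: sum_nonneg sum_mono mult_right_mono simp: pos_def)

lemma pos_strict:
  assumes "\<And>i. i \<in> {1..DIM('a)} \<Longrightarrow> x \<bullet> \<alpha> i > 0" "b \<in> R" "pos b"
  shows "0 < x \<bullet> b"
proof -
  obtain i where "i \<in> {1..DIM('a)}" "b \<bullet> \<omega> i > 0" using pos_root_simple assms(2,3) by metis
  then show ?thesis unfolding inner_expansion[of x b]
    using assms by (intro sum_pos2[of "{1..DIM('a)}" i]) (auto simp: pos_def less_imp_le)
qed

lemma pos_less_highest:
  assumes "\<And>i. i \<in> {1..DIM('a)} \<Longrightarrow> x \<bullet> \<alpha> i > 0" "b \<in> R" "b \<noteq> \<theta>"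
  shows "x \<bullet> b < x \<bullet> \<theta>"
proof -
  have "pos (\<theta> - b)" using highest_root_max[OF assms(2)] by (simp add: pos_def inner_diff_left)
  moreover have "(\<Sum>i\<in>{1..DIM('a)}. ((\<theta> - b) \<bullet> \<omega> i) *\<^sub>R \<alpha> i) \<noteq> 0"
    using assms(3) simple_expansion[of "\<theta> - b"] by (metis right_minus_eq)
  then have "\<exists>i\<in>{1..DIM('a)}. (\<theta> - b) \<bullet> \<omega> i \<noteq> 0" by (metis (no_types, lifting) scaleR_eq_0_iff sum.neutral)
  ultimately obtain i where "i \<in> {1..DIM('a)}" "(\<theta> - b) \<bullet> \<omega> i > 0" "\<forall>i\<in>{1..DIM('a)}. (\<theta> - b) \<bullet> \<omega> i \<ge> 0"
    unfolding pos_def by (metis order.order_iff_strict)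
  then have "0 < x \<bullet> (\<theta> - b)" unfolding inner_expansion[of x "\<theta> - b"]
    using assms(1) by (intro sum_pos2[of "{1..DIM('a)}" i]) (auto simp: less_imp_le)
  then show ?thesis by (simp add: inner_diff_right)
qed

lemma alcove_pos: "x \<in> C0 \<Longrightarrow> b \<in> R \<Longrightarrow> pos b \<Longrightarrow> 0 < x \<bullet> b \<and> x \<bullet> b < 1"
  using pos_strict[of x b] pos_le_highest(2)[of x b] by (force simp: fund_alcove_def less_imp_le)

lemma alcove_sep: "x \<in> C0 \<Longrightarrow> y \<in> C0 \<Longrightarrow> a \<in> R \<Longrightarrow> (x \<bullet> a - of_int k) * (y \<bullet> a - of_int k) > 0"
proof (cases "pos a")
  case True
  assume "x \<in> C0" "y \<in> C0" "a \<in> R"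
  then show ?thesis using alcove_pos[OF _ _ True] same_side_int by blast
next
  case False
  assume *: "x \<in> C0" "y \<in> C0" "a \<in> R"
  then have "pos (- a)" using False root_sign by blast
  then have "(x \<bullet> (- a) - of_int (- k)) * (y \<bullet> (- a) - of_int (- k)) > 0"
    using * alcove_pos root_uminus same_side_int by blast
  then show ?thesis by (simp add: algebra_simps)
qed

lemma gen_alcove: "x \<in> C0 \<Longrightarrow> gen x"
  unfolding gen_iff using alcove_sep[of x x] by (metis less_irrefl mult_zero_left)

lemma gen_x0: "gen x0"
  using gen_alcove x0 by blast

lemma sep_alcove: "x \<in> C0 \<Longrightarrow> y \<in> C0 \<Longrightarrow> sep x y = {}"
  using alcove_sep by (metis equals0I hyps_cases less_asym sep_iff sep_subset_hyps)

definition wall :: "nat \<Rightarrow> 'a set" where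
  "wall i = (if i = 0 then hyperplane \<theta> 1 else hyperplane (\<alpha> i) 0)"

lemma simple_cases:
  assumes "i \<in> {..DIM('a)}"
  obtains a k where "a \<in> R" "s i = affine_refl a k" "wall i = hyperplane a k"
proof (cases "i = 0")
  case True
  then show ?thesis using that[OF highest_root, of 1] by (simp add: simple_refl_def wall_def)
next
  case False
  then show ?thesis using assms that[OF simple_root, of i 0] by (simp add: simple_refl_def wall_def Suc_leI One_nat_def)
qed

lemma aff_simple: "i \<in> {..DIM('a)} \<Longrightarrow> aff (s i)"
  using simple_cases aff_affine_refl by metis

lemma simple_involution: "i \<in> {..DIM('a)} \<Longrightarrow> s i (s i x) = x"
  using simple_cases affine_refl_involution root_nonzero by metis

lemma simple_comp_self: "i \<in> {..DIM('a)} \<Longrightarrow> s i \<circ> s i = id"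
  using simple_involution by auto

text \<open>A point outside the open alcove violates one of its defining inequalities, and strictly
  so when it lies on no hyperplane. This starts every descent towards the alcove.\<close>

lemma wall_separates:
  assumes "gen y" "y \<notin> C0"
  obtains i where "i \<in> {..DIM('a)}" "wall i \<in> sep x0 y"
proof (cases "\<forall>i\<in>{1..DIM('a)}. y \<bullet> \<alpha> i > 0")
  case True
  then have "\<not> y \<bullet> \<theta> < 1" using assms(2) by (auto simp: fund_alcove_def)
  moreover have "y \<bullet> \<theta> - of_int 1 \<noteq> 0" using assms(1) highest_root unfolding gen_iff by blast
  moreover have "x0 \<bullet> \<theta> < 1" using x0 by (simp add: fund_alcove_def)
  ultimately have "wall 0 \<in> sep x0 y" by (simp add: wall_def sep_iff[OF highest_root] mult_less_0_iff)
  then show ?thesis using that[of 0] by simp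
next
  case False
  then obtain i where i: "i \<in> {1..DIM('a)}" "\<not> y \<bullet> \<alpha> i > 0" by blast
  moreover have "y \<bullet> \<alpha> i - of_int 0 \<noteq> 0" using assms(1) simple_root[OF i(1)] unfolding gen_iff by blast
  moreover have "x0 \<bullet> \<alpha> i > 0" using x0 i by (simp add: fund_alcove_def)
  ultimately have "wall i \<in> sep x0 y" by (auto simp: wall_def sep_iff[OF simple_root] mult_less_0_iff)
  then show ?thesis using that[of i] i by simp
qed

lemma alcove_if_not_sep: "gen y \<Longrightarrow> sep x0 y = {} \<Longrightarrow> y \<in> C0"
  using wall_separates by (metis empty_iff)

lemma hyps_pos_cases:
  assumes "h \<in> hyps" obtains a k where "a \<in> R" "pos a" "h = hyperplane a k"
proof -
  obtain a k where a: "a \<in> R" "h = hyperplane a k" using assms hyps_cases by metis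
  show ?thesis
  proof (cases "pos a")
    case False
    then have "pos (- a)" using root_sign a by blast
    moreover have "h = hyperplane (- a) (- k)" using a by (auto simp: hyperplane_def)
    ultimately show ?thesis using that root_uminus a by blast
  qed (use a that in blast)
qed

text \<open>The reflection changes only the \<open>i\<close>-th coordinate, and a positive root not
  proportional to \<open>\<alpha> i\<close> has another positive coordinate.\<close>

lemma simple_refl_pos:
  assumes i: "i \<in> {1..DIM('a)}" and b: "b \<in> R" "pos b" and np: "\<nexists>c. b = c *\<^sub>R \<alpha> i"
  shows "pos (affine_refl (\<alpha> i) 0 b)"
proof -
  have "\<exists>j\<in>{1..DIM('a)}. j \<noteq> i \<and> b \<bullet> \<omega> j \<noteq> 0"
  proof (rule ccontr)
    assume *: "\<not> ?thesis"
    have "b = (\<Sum>j\<in>{1..DIM('a)}. (b \<bullet> \<omega> j) *\<^sub>R \<alpha> j)" by (rule simple_expansion)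
    also have "\<dots> = (\<Sum>j\<in>{1..DIM('a)}. if j = i then (b \<bullet> \<omega> i) *\<^sub>R \<alpha> i else 0)"
      by (rule sum.cong) (use * in auto)
    also have "\<dots> = (b \<bullet> \<omega> i) *\<^sub>R \<alpha> i" using i by simp
    finally show False using np by blast
  qed
  then obtain j where j: "j \<in> {1..DIM('a)}" "j \<noteq> i" "b \<bullet> \<omega> j > 0"
    using b(2) unfolding pos_def by (metis order.order_iff_strict)
  then have "affine_refl (\<alpha> i) 0 b \<bullet> \<omega> j > 0"
    using i by (simp add: affine_refl_linear inner_diff_left coeff_simple)
  then show ?thesis using root_pos_coeff root_refl[OF simple_root[OF i] b(1)] j(1) by blast
qed

lemma highest_root_dominant: "i \<in> {1..DIM('a)} \<Longrightarrow> \<theta> \<bullet> \<alpha> i \<ge> 0"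
proof (rule dominant_max_height)
  assume i: "i \<in> {1..DIM('a)}"
  show "pos \<theta>" using highest_root_coeff_pos by (auto simp: pos_def less_imp_le)
  show "\<theta> + \<alpha> i \<notin> R"
    using highest_root_max[of "\<theta> + \<alpha> i" i] i by (auto simp: inner_add_left coeff_simple)
qed (auto simp: highest_root)

text \<open>With a Cartan integer of at least 2, the negative of the reflected root would exceed
  \<open>\<theta>\<close> in some coordinate unless \<open>b = \<theta>\<close>.\<close>

lemma highest_root_cartan:
  assumes b: "b \<in> R" "pos b" "b \<noteq> \<theta>"
  shows "2 * (b \<bullet> \<theta>) / (\<theta> \<bullet> \<theta>) = 0 \<or> 2 * (b \<bullet> \<theta>) / (\<theta> \<bullet> \<theta>) = 1"
proof -
  obtain z where z: "2 * (b \<bullet> \<theta>) / (\<theta> \<bullet> \<theta>) = of_int z"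
    using cartan_integer[OF highest_root b(1)] by (auto elim: Ints_cases)
  have "\<theta> \<bullet> b \<ge> 0" using pos_le_highest(1)[OF highest_root_dominant b(1,2)] .
  then have "of_int z \<ge> (0::real)" unfolding z[symmetric] by (simp add: inner_commute)
  then have z0: "z \<ge> 0" by simp
  have "z \<le> 1"
  proof (rule ccontr)
    assume "\<not> z \<le> 1"
    then have z2: "real_of_int z \<ge> 2" by linarith
    have "affine_refl \<theta> 0 b = b - of_int z *\<^sub>R \<theta>" using z by (simp add: affine_refl_linear)
    then have r: "b - of_int z *\<^sub>R \<theta> \<in> R" using root_refl[OF highest_root b(1)] by simp
    have "b \<bullet> \<omega> i = \<theta> \<bullet> \<omega> i" if i: "i \<in> {1..DIM('a)}" for i
    proof -
      have "- (b - of_int z *\<^sub>R \<theta>) \<bullet> \<omega> i \<le> \<theta> \<bullet> \<omega> i" using highest_root_max[OF root_uminus[OF r] i] .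
      then have "of_int z * (\<theta> \<bullet> \<omega> i) \<le> \<theta> \<bullet> \<omega> i + b \<bullet> \<omega> i" by (simp add: inner_diff_left)
      moreover have "2 * (\<theta> \<bullet> \<omega> i) \<le> of_int z * (\<theta> \<bullet> \<omega> i)"
        using z2 highest_root_coeff_pos[OF i] by (intro mult_right_mono) auto
      moreover have "b \<bullet> \<omega> i \<le> \<theta> \<bullet> \<omega> i" using highest_root_max[OF b(1) i] .
      ultimately show ?thesis by linarith
    qed
    then have "(\<Sum>i\<in>{1..DIM('a)}. (b \<bullet> \<omega> i) *\<^sub>R \<alpha> i) = (\<Sum>i\<in>{1..DIM('a)}. (\<theta> \<bullet> \<omega> i) *\<^sub>R \<alpha> i)" by (intro sum.cong) auto
    then have "b = \<theta>" using simple_expansion[of b] simple_expansion[of \<theta>] by (metis (no_types, lifting))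
    then show False using b by simp
  qed
  then have "z = 0 \<or> z = 1" using z0 by linarith
  then show ?thesis using z by auto
qed

text \<open>Simple reflections have length one. On a positive root not belonging to the wall,
  \<open>s i x0\<close> still takes a value in (0, 1), so no integer level is crossed. On a root of
  the wall the values of \<open>x0\<close> and its image are symmetric about the level of the wall,
  and only that level lies between them.\<close>

lemma sep_simple:
  assumes i: "i \<in> {..DIM('a)}"
  shows "sep x0 (s i x0) = {wall i}"
proof
  obtain a k where a: "a \<in> R" "s i = affine_refl a k" "wall i = hyperplane a k" using simple_cases i by metis
  have "x0 \<bullet> a - of_int k \<noteq> 0" using gen_x0 a(1) unfolding gen_iff by blast
  moreover have "s i x0 \<bullet> a - of_int k = - (x0 \<bullet> a - of_int k)"
    unfolding a(2) affine_refl_inner[OF root_nonzero[OF a(1)]] by simp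
  ultimately have "wall i \<in> sep x0 (s i x0)"
    unfolding a(3) sep_iff[OF a(1)] by (metis mult_minus_right neg_less_0_iff_less not_real_square_gt_zero)
  then show "{wall i} \<subseteq> sep x0 (s i x0)" by simp
  show "sep x0 (s i x0) \<subseteq> {wall i}"
  proof
    fix h assume h: "h \<in> sep x0 (s i x0)"
    then obtain b m where b: "b \<in> R" "pos b" "h = hyperplane b m" using hyps_pos_cases sep_subset_hyps by metis
    have neg: "(x0 \<bullet> b - of_int m) * (s i x0 \<bullet> b - of_int m) < 0" using h sep_iff b by blast
    have xb: "0 < x0 \<bullet> b" "x0 \<bullet> b < 1" using alcove_pos[OF x0 b(1,2)] by auto
    show "h \<in> {wall i}"
    proof (cases "i = 0")
      case False
      then have iI: "i \<in> {1..DIM('a)}" using i by (simp add: Suc_leI One_nat_def)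
      have si: "s i x0 \<bullet> b = x0 \<bullet> affine_refl (\<alpha> i) 0 b"
        using False by (simp add: simple_refl_def affine_refl_linear inner_diff_left inner_diff_right inner_commute)
      show ?thesis
      proof (cases "\<exists>c. b = c *\<^sub>R \<alpha> i")
        case False
        then have "pos (affine_refl (\<alpha> i) 0 b)" using simple_refl_pos[OF iI b(1,2)] by blast
        then have "0 < s i x0 \<bullet> b" "s i x0 \<bullet> b < 1"
          unfolding si using alcove_pos[OF x0 root_refl[OF simple_root[OF iI] b(1)]] by auto
        then show ?thesis using same_side_int[OF xb, of "s i x0 \<bullet> b" m] neg by linarith
      next
        case True
        then obtain c where c: "b = c *\<^sub>R \<alpha> i" by blast
        have c0: "c \<noteq> 0" using c root_nonzero[OF b(1)] by auto
        have "affine_refl (\<alpha> i) 0 b = - b"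

          using root_nonzero[OF simple_root[OF iI]] by (simp add: c affine_refl_linear algebra_simps)
            (metis mult_2_right scaleR_left_distrib)
        then have "s i x0 \<bullet> b = - (x0 \<bullet> b)" using si by simp
        then have "(x0 \<bullet> b - of_int m) * (x0 \<bullet> b + of_int m) > 0"
          using neg by (simp add: algebra_simps)
        then have "m = 0" using xb
        proof -
          assume *: "(x0 \<bullet> b - of_int m) * (x0 \<bullet> b + of_int m) > 0"
          show "m = 0"
          proof (rule ccontr)
            assume "m \<noteq> 0"
            then have "real_of_int m \<ge> 1 \<or> real_of_int m \<le> -1" by linarith
            then show False using * xb unfolding zero_less_mult_iff by linarith
          qed
        qed
        then have "h = hyperplane (\<alpha> i) 0" using b(3) c c0 by (auto simp: hyperplane_def)
        then show ?thesis using False by (simp add: wall_def)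
      qed
    next
      case True
      define z where "z = 2 * (b \<bullet> \<theta>) / (\<theta> \<bullet> \<theta>)"
      have s0: "s i x0 \<bullet> b = x0 \<bullet> b + (1 - x0 \<bullet> \<theta>) * z"
        using True by (simp add: simple_refl_def affine_refl_def z_def inner_diff_left inner_commute algebra_simps)
          (simp flip: add_divide_distrib)
      have xt: "x0 \<bullet> \<theta> < 1" using x0 by (simp add: fund_alcove_def)
      show ?thesis
      proof (cases "b = \<theta>")
        case False
        \<comment> \<open>The value of \<open>b\<close> grows by 0 or by
          \<open>1 - x0 \<bullet> \<theta>\<close>; this inequality keeps it below 1.\<close>
        have "x0 \<bullet> b < x0 \<bullet> \<theta>" using x0 by (intro pos_less_highest b False) (auto simp: fund_alcove_def)
        then have "0 < s i x0 \<bullet> b \<and> s i x0 \<bullet> b < 1"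
          using highest_root_cartan[OF b(1,2) False] xb xt unfolding s0 z_def[symmetric] by auto
        then show ?thesis using same_side_int[OF xb, of "s i x0 \<bullet> b" m] neg by linarith
      next
        case t: True
        have "z = 2" using root_nonzero[OF highest_root] by (simp add: z_def t)
        then have "s i x0 \<bullet> b = 2 - x0 \<bullet> b" using s0 t by simp
        then have "m = 1" using neg xb
        proof -
          assume *: "s i x0 \<bullet> b = 2 - x0 \<bullet> b"
          show "m = 1"
          proof (rule ccontr)
            assume "m \<noteq> 1"
            then have "real_of_int m \<ge> 2 \<or> real_of_int m \<le> 0" by linarith
            then show False using neg xb unfolding * mult_less_0_iff by linarith
          qed
        qed
        then show ?thesis using b(3) t True by (simp add: wall_def)
      qed
    qed
  qed
qed

end

section \<open>Words, lengths and the exchange condition\<close>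

context based_root_system
begin

text \<open>Applied to the alcove and to its image under \<open>w\<close>, the weak inequality shows
  that a point common to both closures lies weakly on both sides of every hyperplane separating
  them, hence on it.\<close>

lemma cl_side:
  assumes "z \<in> cl" "a \<in> R"
  shows "(x0 \<bullet> a - of_int k) * (z \<bullet> a - of_int k) \<ge> 0"
proof -
  have *: "(x0 \<bullet> a - of_int k) * (z \<bullet> a - of_int k) \<ge> 0" if a: "a \<in> R" "pos a" for a k
  proof -
    have x: "0 < x0 \<bullet> a" "x0 \<bullet> a < 1" using alcove_pos[OF x0 a] by auto
    have z: "0 \<le> z \<bullet> a" "z \<bullet> a \<le> 1"
      using pos_le_highest[OF _ a, of z] assms(1) by (auto simp: cl_def)
    show ?thesis
    proof (cases "k \<le> 0")
      case True
      then have "real_of_int k \<le> 0" by simp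
      then show ?thesis using x z unfolding zero_le_mult_iff by linarith
    next
      case False
      then have "real_of_int k \<ge> 1" by simp
      then show ?thesis using x z unfolding zero_le_mult_iff by linarith
    qed
  qed
  show ?thesis
  proof (cases "pos a")
    case False
    then have "pos (- a)" using root_sign assms(2) by blast
    then have "(x0 \<bullet> (- a) - of_int (- k)) * (z \<bullet> (- a) - of_int (- k)) \<ge> 0"
      using * root_uminus assms(2) by blast
    then show ?thesis by (simp add: algebra_simps)
  qed (use * assms in blast)
qed

lemma aff_level_inv:
  assumes "aff f" "b \<in> R"
  obtains a k where "a \<in> R" "\<And>x. x \<bullet> a - of_int k = f x \<bullet> b - of_int m"
  using aff_level[OF aff_inv[OF assms(1)] assms(2), of m] aff_inv_app(1)[OF assms(1)] by metis

lemma aff_cl_side: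
  assumes "aff f" "z \<in> cl" "b \<in> R"
  shows "(f x0 \<bullet> b - of_int m) * (f z \<bullet> b - of_int m) \<ge> 0"
proof -
  obtain a k where a: "a \<in> R" "\<And>x. x \<bullet> a - of_int k = f x \<bullet> b - of_int m"
    using aff_level_inv[OF assms(1,3)] by metis
  show ?thesis using cl_side[OF assms(2) a(1), of k] unfolding a(2) .
qed

text \<open>The image mirror is known only as a set and may be described by a root other than the
  image of \<open>b\<close>; \<open>affine_refl_cong_hyperplane\<close> bridges the gap.\<close>

lemma refl_conj:
  assumes f: "aff f" and ab: "a \<in> R" "b \<in> R" and h: "f ` hyperplane b m = hyperplane a k"
  shows "f \<circ> affine_refl b m = affine_refl a k \<circ> f"
proof -
  obtain L v where L: "orthogonal_transformation L" "L ` R = R" "\<forall>a\<in>R. v \<bullet> a \<in> \<int>" "f = (\<lambda>x. L x + v)"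
    using f by (auto simp: aff_def)
  have lin: "linear L" using L(1) by (simp add: orthogonal_transformation_def)
  have Lb: "L b \<in> R" using L(2) ab(2) by blast
  then obtain z where z: "v \<bullet> L b = of_int z" using L(3) by (meson Ints_cases)
  have inner: "L x \<bullet> L y = x \<bullet> y" for x y using L(1) by (simp add: orthogonal_transformation_def)
  have lev: "f x \<bullet> L b - of_int (m + z) = x \<bullet> b - of_int m" for x
    using z by (simp add: L(4) inner_add_left inner)
  have "hyperplane (L b) (m + z) = hyperplane a k"
    using aff_hyperplane[OF f lev] h by simp
  then have "affine_refl (L b) (m + z) = affine_refl a k"
    by (rule affine_refl_cong_hyperplane) (use root_nonzero Lb ab in auto)
  moreover have "affine_refl (L b) (m + z) (f x) = f (affine_refl b m x)" for x
    unfolding affine_refl_def[of "L b"] lev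
    by (simp add: affine_refl_def coroot_def inner L(4) linear_diff[OF lin] linear_cmul[OF lin])
  ultimately show ?thesis by (intro ext) simp
qed

text \<open>The inversion set, taken at \<open>f x0\<close>. \<open>weyl_length\<close> is defined
  with the inverse of \<open>f\<close> instead, which changes the set but not its cardinality
  (\<open>weyl_length_eq\<close>).\<close>

definition N :: "('a \<Rightarrow> 'a) \<Rightarrow> 'a set set" where "N f = sep x0 (f x0)"

definition len :: "('a \<Rightarrow> 'a) \<Rightarrow> nat" where "len f = card (N f)"

lemma finite_N: "finite (N f)"
  by (simp add: N_def finite_sep)

lemma len_eq_0: "len f = 0 \<longleftrightarrow> N f = {}"
  by (simp add: len_def finite_N)

lemma N_hyps: "h \<in> N f \<Longrightarrow> h \<in> hyps"
  using sep_subset_hyps by (auto simp: N_def)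

lemma N_id: "N id = {}"
  by (simp add: N_def sep_self)

text \<open>The cocycle identity of inversion sets: \<open>sep_triangle\<close> for
  \<open>x0\<close>, \<open>f x0\<close> and \<open>f (g x0)\<close>, with the last pair pulled back
  along \<open>f\<close>.\<close>

lemma N_comp:
  assumes "aff f" "aff g"
  shows "h \<in> N (f \<circ> g) \<longleftrightarrow> (h \<in> N f) \<noteq> (iv f ` h \<in> N g)"
proof -
  have "iv f ` h \<in> N g \<longleftrightarrow> h \<in> sep (f x0) (f (g x0))"
    unfolding N_def by (metis assms(1) image_mem_sep inv_image_aff(2))
  then show ?thesis
    using sep_triangle[OF gen_x0 gen_aff[OF assms(1) gen_x0] gen_aff[OF aff_comp[OF assms] gen_x0], of h]
    by (simp add: N_def)
qed

lemma N_inv: "aff f \<Longrightarrow> h \<in> N (iv f) \<longleftrightarrow> f ` h \<in> N f"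
  unfolding N_def by (metis aff_inv_app(2) image_mem_sep sep_sym)

lemma len_inv: "aff f \<Longrightarrow> len (iv f) = len f"
  unfolding len_def N_def using card_sep_aff[of f x0 "iv f x0"] by (simp add: aff_inv_app sep_sym)

lemma N_image_eq: "aff f \<Longrightarrow> {h. iv f ` h \<in> N g} = image f ` N g"
proof (intro equalityI subsetI)
  fix h assume f: "aff f" and "h \<in> {h. iv f ` h \<in> N g}"
  then show "h \<in> image f ` N g" using inv_image_aff(2)[OF f, of h] by (metis imageI mem_Collect_eq)
next
  fix h assume f: "aff f" and "h \<in> image f ` N g"
  then obtain k where "k \<in> N g" "h = f ` k" by blast
  then show "h \<in> {h. iv f ` h \<in> N g}" using inv_image_aff(1)[OF f, of k] by simp
qed

lemma len_comp_disjoint: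
  assumes "aff f" "aff g" "\<And>h. h \<in> N f \<Longrightarrow> iv f ` h \<notin> N g"
  shows "len (f \<circ> g) = len f + len g"
proof -
  have "N (f \<circ> g) = N f \<union> image f ` N g"
    using N_comp[OF assms(1,2)] assms(3) N_image_eq[OF assms(1), of g] by blast
  moreover have "card (image f ` N g) = card (N g)"
    by (rule card_image) (metis inj_onI inv_image_aff(1)[OF assms(1)])
  moreover have "N f \<inter> image f ` N g = {}"
    using assms(3) unfolding N_image_eq[OF assms(1), symmetric] by blast
  ultimately show ?thesis by (simp add: len_def card_Un_disjoint finite_N)
qed

lemma len_comp_le:
  assumes "aff f" "aff g"
  shows "len (f \<circ> g) \<le> len f + len g"
proof -
  have "N (f \<circ> g) \<subseteq> N f \<union> image f ` N g"
    using N_comp[OF assms(1,2)] N_image_eq[OF assms(1), of g] by blast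
  then have "card (N (f \<circ> g)) \<le> card (N f \<union> image f ` N g)"
    by (intro card_mono) (auto simp: finite_N)
  also have "\<dots> \<le> card (N f) + card (image f ` N g)" by (rule card_Un_le)
  also have "\<dots> \<le> card (N f) + card (N g)" by (simp add: card_image_le finite_N)
  finally show ?thesis by (simp add: len_def)
qed

lemma N_comp_empty_left: "aff f \<Longrightarrow> aff g \<Longrightarrow> N f = {} \<Longrightarrow> N (f \<circ> g) = image f ` N g"
  using N_comp N_image_eq by blast

lemma len_eq_0_alcove: "aff f \<Longrightarrow> len f = 0 \<longleftrightarrow> f x0 \<in> C0"
  unfolding len_eq_0 N_def
  using alcove_if_not_sep[OF gen_aff[OF _ gen_x0]] sep_alcove[OF x0] by blast

lemma inv_simple: "i \<in> {..DIM('a)} \<Longrightarrow> iv (s i) = s i"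
  by (rule inv_unique_comp) (auto simp: simple_comp_self simple_involution)

lemma N_simple: "i \<in> {..DIM('a)} \<Longrightarrow> N (s i) = {wall i}"
  by (simp add: N_def sep_simple)

lemma simple_image_wall: "i \<in> {..DIM('a)} \<Longrightarrow> s i ` wall i = wall i"
  using N_inv[of "s i" "wall i"] by (auto simp: inv_simple N_simple aff_simple)

lemma N_simple_comp:
  assumes "i \<in> {..DIM('a)}" "aff w"
  shows "h \<in> N (s i \<circ> w) \<longleftrightarrow> (h = wall i) \<noteq> (s i ` h \<in> N w)"
  using N_comp[OF aff_simple assms(2), of i h] assms(1) by (simp add: N_simple inv_simple)

lemma wall_N_simple_comp: "i \<in> {..DIM('a)} \<Longrightarrow> aff w \<Longrightarrow> wall i \<in> N (s i \<circ> w) \<longleftrightarrow> wall i \<notin> N w"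
  using N_simple_comp[of i w "wall i"] by (simp add: simple_image_wall)

lemma len_simple_comp_up:
  assumes "i \<in> {..DIM('a)}" "aff w" "wall i \<notin> N w"
  shows "len (s i \<circ> w) = len w + 1"
proof -
  have "len (s i \<circ> w) = len (s i) + len w"
    by (rule len_comp_disjoint)
       (use assms in \<open>auto simp: aff_simple N_simple inv_simple simple_image_wall\<close>)
  then show ?thesis using assms(1) by (simp add: len_def[of "s i"] N_simple)
qed

lemma simple_comp_cancel: "i \<in> {..DIM('a)} \<Longrightarrow> s i \<circ> (s i \<circ> w) = w"
  by (auto simp: simple_involution)

lemma comp_simple_cancel: "i \<in> {..DIM('a)} \<Longrightarrow> (w \<circ> s i) \<circ> s i = w"
  by (auto simp: simple_involution)

lemma len_simple_comp_down:
  assumes "i \<in> {..DIM('a)}" "aff w" "wall i \<in> N w"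
  shows "len w = len (s i \<circ> w) + 1"
  using len_simple_comp_up[OF assms(1) aff_comp[OF aff_simple assms(2)], of i] assms
  by (simp add: wall_N_simple_comp simple_comp_cancel)

lemma inv_comp_aff: "aff f \<Longrightarrow> aff g \<Longrightarrow> iv (f \<circ> g) = iv g \<circ> iv f"
  using aff_bij by (simp add: o_inv_distrib)

lemma inv_inv_aff: "aff f \<Longrightarrow> iv (iv f) = f"
  using aff_bij by (simp add: inv_inv_eq)

lemma len_comp_simple:
  assumes "i \<in> {..DIM('a)}" "aff w"
  shows "len (w \<circ> s i) = len (s i \<circ> iv w)"
  using len_inv[OF aff_comp[OF assms(2) aff_simple[OF assms(1)]]] assms
  by (simp add: inv_comp_aff aff_simple inv_simple)

section \<open>Words in the simple reflections\<close>

lemma wp_Nil [simp]: "wp [] = id" and wp_Cons [simp]: "wp (i # is) = s i \<circ> wp is"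
  by (simp_all add: word_prod_def)

lemma wp_append: "wp (is @ js) = wp is \<circ> wp js"
  by (induction "is") (simp_all add: o_assoc)

lemma aff_wp: "set is \<subseteq> {..DIM('a)} \<Longrightarrow> aff (wp is)"
  by (induction "is") (auto intro: aff_id aff_comp aff_simple simp del: comp_apply)

lemma inv_wp: "set is \<subseteq> {..DIM('a)} \<Longrightarrow> iv (wp is) = wp (rev is)"
proof (induction "is")
  case (Cons i "is")
  then show ?case by (simp add: inv_comp_aff aff_simple aff_wp wp_append inv_simple del: comp_apply)
qed simp

text \<open>Closed under inverses because the letters are involutions, so this is the parabolic
  subgroup of type \<open>J\<close> (\<open>map_group_simple\<close>).\<close>

definition words :: "nat set \<Rightarrow> ('a \<Rightarrow> 'a) set" where
  "words J = {wp is | is. set is \<subseteq> J}"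

lemma words_comp: "u \<in> words J \<Longrightarrow> v \<in> words J \<Longrightarrow> u \<circ> v \<in> words J"
  unfolding words_def
proof clarify
  fix "is" js assume "set is \<subseteq> J" "set js \<subseteq> J"
  then show "\<exists>ks. wp is \<circ> wp js = wp ks \<and> set ks \<subseteq> J"
    by (intro exI[of _ "is @ js"]) (simp add: wp_append)
qed

lemma words_inv: "J \<subseteq> {..DIM('a)} \<Longrightarrow> u \<in> words J \<Longrightarrow> iv u \<in> words J"
  unfolding words_def
proof clarify
  fix "is" assume "J \<subseteq> {..DIM('a)}" "set is \<subseteq> J"
  then show "\<exists>ks. iv (wp is) = wp ks \<and> set ks \<subseteq> J"
    by (intro exI[of _ "rev is"]) (auto intro!: inv_wp)
qed

lemma words_id: "id \<in> words J"
  unfolding words_def by (intro CollectI exI[of _ "[]"]) simp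

lemma words_simple: "i \<in> J \<Longrightarrow> s i \<in> words J"
  unfolding words_def by (intro CollectI exI[of _ "[i]"]) simp

lemma map_group_simple: "J \<subseteq> {..DIM('a)} \<Longrightarrow> map_group (s ` J) = words J"
proof -
  assume J: "J \<subseteq> {..DIM('a)}"
  have "map_group (s ` J) = {foldr (\<circ>) fs id | fs. set fs \<subseteq> s ` J}"
    by (rule map_group_comp) (use J simple_comp_self in blast)
  also have "\<dots> = words J"
  proof -
    have "foldr (\<circ>) (map s is) id = wp is" for "is"
      by (induction "is") (simp_all only: wp_Nil wp_Cons list.map foldr.simps o_apply id_apply)
    note map_word = this
    have "\<exists>is. set is \<subseteq> J \<and> fs = map s is" if "set fs \<subseteq> s ` J" for fs
    proof -
      have "fs \<in> lists (s ` J)" using that by (simp add: in_lists_conv_set subset_iff)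
      then have "fs \<in> map s ` lists J" by (simp add: lists_image)
      then show ?thesis by (auto simp: in_lists_conv_set)
    qed
    then have "{foldr (\<circ>) fs id | fs. set fs \<subseteq> s ` J} \<subseteq> words J"
      unfolding words_def using map_word by blast
    moreover have "wp is \<in> {foldr (\<circ>) fs id | fs. set fs \<subseteq> s ` J}" if "set is \<subseteq> J" for "is"
    proof -
      have "wp is = foldr (\<circ>) (map s is) id \<and> set (map s is) \<subseteq> s ` J"
        unfolding map_word using that by (simp add: image_mono)
      then show ?thesis by blast
    qed
    then have "words J \<subseteq> {foldr (\<circ>) fs id | fs. set fs \<subseteq> s ` J}" unfolding words_def by blast
    ultimately show ?thesis by blast
  qed
  finally show ?thesis .
qed

lemma parabolic_words: "Wi i = words ({..DIM('a)} - {i})"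
  unfolding maximal_parabolic_def by (rule map_group_simple) auto

lemma len_wp_le: "set is \<subseteq> {..DIM('a)} \<Longrightarrow> len (wp is) \<le> length is"
proof (induction "is")
  case Nil
  have "len id \<le> length ([] :: nat list)" by (simp add: len_def N_id)
  then show ?case unfolding wp_Nil .
next
  case (Cons i "is")
  then have "len (s i \<circ> wp is) \<le> len (s i) + len (wp is)" by (intro len_comp_le aff_simple aff_wp) auto
  moreover have "len (s i) = 1" using Cons.prems by (simp add: len_def N_simple)
  moreover have "len (wp is) \<le> length is" using Cons by auto
  ultimately have "len (s i \<circ> wp is) \<le> length (i # is)" by (simp del: comp_apply)
  then show ?case unfolding wp_Cons .
qed

text \<open>Reflecting in a separating wall lowers the number of separating hyperplanes by one, so
  repeated folding ends in the alcove. Transitivity on alcoves and the splitting of the extended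
  group both come from this.\<close>

lemma gallery_to_alcove:
  assumes "gen p" shows "\<exists>is. set is \<subseteq> {..DIM('a)} \<and> wp is p \<in> C0"
  using assms
proof (induction "card (sep x0 p)" arbitrary: p rule: less_induct)
  case less
  show ?case
  proof (cases "p \<in> C0")
    case True
    then show ?thesis by (intro exI[of _ "[]"]) simp
  next
    case False
    obtain i where i: "i \<in> {..DIM('a)}" "wall i \<in> sep x0 p" using wall_separates[OF less.prems False] .
    have "card (sep x0 (s i p)) = card (sep (s i x0) p)"
      using card_sep_aff[OF aff_simple[OF i(1)], of x0 "s i p"] by (simp add: simple_involution[OF i(1)])
    also have "sep (s i x0) p = sep x0 p - {wall i}"
      using sep_triangle[OF gen_aff[OF aff_simple[OF i(1)] gen_x0] gen_x0 less.prems] i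
      by (auto simp: sep_sym[of "s i x0"] sep_simple)
    also have "card \<dots> < card (sep x0 p)" using i(2) finite_sep by (intro psubset_card_mono) auto
    finally obtain "is" where "set is \<subseteq> {..DIM('a)}" "wp is (s i p) \<in> C0"
      using less.hyps gen_aff[OF aff_simple[OF i(1)] less.prems] by blast
    then show ?thesis using i(1) by (intro exI[of _ "is @ [i]"]) (simp add: wp_append)
  qed
qed

text \<open>The linear part of the reflection sends \<open>b\<close> to \<open>b\<close> or to
  \<open>- b\<close>. In the first case the mirror is orthogonal to the hyperplane, so the level of
  \<open>x0\<close> does not change and nothing is separated. In the second \<open>b\<close> is a
  multiple of \<open>a\<close>, and the levels match.\<close>

lemma refl_fixes_wall:
  assumes a: "a \<in> R" and b: "b \<in> R" and h: "affine_refl a k ` hyperplane b m = hyperplane b m"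
    and sep: "hyperplane b m \<in> N (affine_refl a k)"
  shows "hyperplane a k = hyperplane b m"
proof -
  have a0: "a \<noteq> 0" and b0: "b \<noteq> 0" using a b root_nonzero by auto
  define d where "d = affine_refl a 0 b"
  define z where "z = 2 * (b \<bullet> a) / (a \<bullet> a)"
  obtain z' where z': "z = of_int z'" using cartan_integer[OF a b] unfolding z_def by (auto elim: Ints_cases)
  have db: "d = b - z *\<^sub>R a" by (simp add: d_def z_def affine_refl_linear)
  have dR: "d \<in> R" using root_refl[OF a b] by (simp add: d_def)
  have lev: "affine_refl a k x \<bullet> d - of_int (m - z' * k) = x \<bullet> b - of_int m" for x
  proof -
    have o: "affine_refl a 0 x \<bullet> d = x \<bullet> b"
      using orthogonal_affine_refl[OF a0] by (simp add: d_def orthogonal_transformation_def)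
    have "coroot a \<bullet> d = - z" using a0 unfolding db inner_diff_right
      by (simp add: coroot_def z_def inner_commute)
    then show ?thesis unfolding affine_refl_eq[of a k x] inner_add_left o
      by (simp add: z' algebra_simps)
  qed
  have "hyperplane d (m - z' * k) = hyperplane b m"
    using aff_hyperplane[OF aff_affine_refl[OF a] lev] h by simp
  then obtain c where c: "c \<noteq> 0" "d = c *\<^sub>R b" "real_of_int (m - z' * k) = c * of_int m"
    using hyperplane_eqD root_nonzero[OF dR] b0 by metis
  have "d \<bullet> d = b \<bullet> b"
    using orthogonal_affine_refl[OF a0] by (simp add: d_def orthogonal_transformation_def)
  then have "c * c = 1" using c(2) b0 by simp
  then consider "c = 1" | "c = -1" using square_eq_1_iff by blast
  then show ?thesis
  proof cases
    case 1
    then have "z = 0" using db c(2) a0 by simp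
    then have "b \<bullet> a = 0" using a0 by (simp add: z_def)
    then have "coroot a \<bullet> b = 0" by (simp add: coroot_def inner_commute[of a b])
    then have "affine_refl a k x0 \<bullet> b = x0 \<bullet> b" by (simp add: affine_refl_def inner_diff_left)
    then show ?thesis using sep unfolding N_def sep_iff[OF b] by (simp add: mult_less_0_iff)
  next
    case 2
    have za: "z *\<^sub>R a = 2 *\<^sub>R b" using db c(2) 2 by (simp add: scaleR_2 algebra_simps)
    have z0: "z \<noteq> 0" using za b0 by auto
    have "z * of_int k = 2 * of_int m" using c(3) 2 z' by simp
    moreover have "x \<bullet> (z *\<^sub>R a) = x \<bullet> (2 *\<^sub>R b)" for x using za by simp
    ultimately have "x \<bullet> a = of_int k \<longleftrightarrow> x \<bullet> b = of_int m" for x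
      using z0 by (metis inner_scaleR_right mult_cancel_left zero_neq_numeral)
    then show ?thesis by (auto simp: hyperplane_def)
  qed
qed

text \<open>Conjugating a reflection by a simple reflection whose wall it crosses lowers its length by
  two.\<close>

lemma refl_in_words:
  assumes "a \<in> R" shows "affine_refl a k \<in> words {..DIM('a)}"
  using assms
proof (induction "len (affine_refl a k)" arbitrary: a k rule: less_induct)
  case less
  let ?r = "affine_refl a k"
  have r: "aff ?r" using aff_affine_refl less.prems by blast
  have rr: "?r \<circ> ?r = id" using affine_refl_comp_self root_nonzero less.prems by blast
  have ir: "iv ?r = ?r" by (rule inv_unique_comp) (rule rr)+
  have "hyperplane a k \<in> N ?r"
    unfolding N_def sep_iff[OF less.prems] affine_refl_inner[OF root_nonzero[OF less.prems]]
    using gen_x0[unfolded gen_iff, rule_format, OF less.prems, of k] by (auto simp: mult_less_0_iff)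
  then have "?r x0 \<notin> C0" using len_eq_0_alcove[OF r] len_eq_0 by auto
  then obtain i where i: "i \<in> {..DIM('a)}" "wall i \<in> N ?r"
    using wall_separates[OF gen_aff[OF r gen_x0]] unfolding N_def by blast
  obtain b m where b: "b \<in> R" "s i = affine_refl b m" "wall i = hyperplane b m" using simple_cases i(1) by metis
  show ?case
  proof (cases "?r ` wall i = wall i")
    case True
    then have "hyperplane a k = wall i" using refl_fixes_wall[OF less.prems b(1)] i(2) b(3) by metis
    then have "?r = s i" unfolding b(2,3)
      using affine_refl_cong_hyperplane root_nonzero b(1) less.prems by blast
    then show ?thesis using words_simple[OF i(1)] by simp
  next
    case False
    have "s i ` hyperplane a k \<in> hyps"
      using aff_hyps[OF aff_simple[OF i(1)] hyperplane_in_hyps[OF less.prems]] .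
    then obtain c n where c: "c \<in> R" "s i ` hyperplane a k = hyperplane c n" using hyps_cases by metis
    have conj: "s i \<circ> ?r = affine_refl c n \<circ> s i"
      by (rule refl_conj[OF aff_simple[OF i(1)] c(1) less.prems c(2)])
    then have q: "affine_refl c n = s i \<circ> (?r \<circ> s i)"
      using comp_simple_cancel[OF i(1)] by (metis comp_assoc)
    \<comment> \<open>\<open>?r\<close> moves the wall, so the wall stays in the inversion set after
      multiplication by \<open>s i\<close> on the right, and a second descent on the left is
      available.\<close>
    have "wall i \<in> N (?r \<circ> s i)"
      using N_comp[OF r aff_simple[OF i(1)], of "wall i"] i(2) False by (simp add: ir N_simple[OF i(1)])
    then have 1: "len (?r \<circ> s i) = len (s i \<circ> (?r \<circ> s i)) + 1"
      using len_simple_comp_down i(1) r aff_comp aff_simple by blast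
    have "len (?r \<circ> s i) = len (s i \<circ> ?r)" using len_comp_simple[OF i(1) r] by (simp add: ir)
    then have "len (affine_refl c n) < len ?r"
      using 1 len_simple_comp_down[OF i(1) r i(2)] q by simp
    then have "affine_refl c n \<in> words {..DIM('a)}" using less.hyps c(1) by blast
    then have "s i \<circ> affine_refl c n \<circ> s i \<in> words {..DIM('a)}" by (intro words_comp words_simple i(1))
    moreover have "s i \<circ> affine_refl c n \<circ> s i = ?r"
      unfolding q by (simp only: comp_assoc simple_comp_self[OF i(1)] simple_comp_cancel[OF i(1)] comp_id)
    ultimately show ?thesis by simp
  qed
qed

lemma affine_weyl_words: "W = words {..DIM('a)}"
proof
  let ?S = "{affine_refl a k | a k. a \<in> R}"
  have W: "W = {foldr (\<circ>) fs id | fs. set fs \<subseteq> ?S}"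
    unfolding affine_weyl_def
    by (rule map_group_comp) (use affine_refl_comp_self root_nonzero in blast)
  have "foldr (\<circ>) fs id \<in> words {..DIM('a)}" if "set fs \<subseteq> ?S" for fs
    using that
  proof (induction fs)
    case Nil
    have "foldr (\<circ>) [] id = (id :: 'a \<Rightarrow> 'a)" by simp
    then show ?case using words_id by metis
  next
    case (Cons f fs)
    then have "f \<in> words {..DIM('a)}" using refl_in_words by auto
    moreover have "foldr (\<circ>) fs id \<in> words {..DIM('a)}" using Cons unfolding list.set insert_subset by blast
    ultimately have "f \<circ> foldr (\<circ>) fs id \<in> words {..DIM('a)}" by (rule words_comp)
    moreover have "foldr (\<circ>) (f # fs) id = f \<circ> foldr (\<circ>) fs id" by simp
    ultimately show ?case by metis
  qed
  then show "W \<subseteq> words {..DIM('a)}" unfolding W by blast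
  have "wp is \<in> map_group ?S" if "set is \<subseteq> {..DIM('a)}" for "is"
    using that
  proof (induction "is")
    case Nil
    have "foldr (\<circ>) [] id = (id :: 'a \<Rightarrow> 'a)" by simp
    then show ?case using W unfolding affine_weyl_def wp_Nil by (metis (mono_tags, lifting) empty_subsetI empty_set mem_Collect_eq)
  next
    case (Cons i "is")
    then obtain fs where fs: "wp is = foldr (\<circ>) fs id" "set fs \<subseteq> ?S"
      using W unfolding affine_weyl_def list.set insert_subset by blast
    have "s i \<in> ?S" using simple_cases[of i] Cons.prems by (auto, metis)
    then have "foldr (\<circ>) (s i # fs) id \<in> map_group ?S"
      using W fs(2) unfolding affine_weyl_def by (metis (mono_tags, lifting) insert_subset list.set(2) mem_Collect_eq)
    then show ?case unfolding foldr.simps o_apply wp_Cons fs(1) .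
  qed
  then show "words {..DIM('a)} \<subseteq> W" unfolding words_def affine_weyl_def by blast
qed

section \<open>Exchange condition, reduced words and stabilisers\<close>

lemma W_comp: "u \<in> W \<Longrightarrow> v \<in> W \<Longrightarrow> u \<circ> v \<in> W"
  and W_inv: "u \<in> W \<Longrightarrow> iv u \<in> W"
  and W_id: "id \<in> W"
  and W_simple: "i \<in> {..DIM('a)} \<Longrightarrow> s i \<in> W"
  and W_refl: "a \<in> R \<Longrightarrow> affine_refl a k \<in> W"
  unfolding affine_weyl_words
  by (simp_all only: words_comp words_inv[OF order_refl] words_id words_simple refl_in_words)

lemma W_cases:
  assumes "w \<in> W" obtains "is" where "set is \<subseteq> {..DIM('a)}" "w = wp is"
  using assms by (auto simp: affine_weyl_words words_def)

lemma wp_in_W: "set is \<subseteq> {..DIM('a)} \<Longrightarrow> wp is \<in> W"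
  by (auto simp: affine_weyl_words words_def)

lemma aff_W: "w \<in> W \<Longrightarrow> aff w"
  by (metis W_cases aff_wp)

lemma words_subset: "J \<subseteq> {..DIM('a)} \<Longrightarrow> words J \<subseteq> W"
  unfolding affine_weyl_words words_def by blast

text \<open>Follow the hyperplane along the gallery of the word. If it is the first wall, deleting
  the first letter performs the reflection; otherwise pull it back by that letter and continue with
  the rest.\<close>

lemma strong_exchange:
  assumes "set is \<subseteq> {..DIM('a)}" "a \<in> R" "hyperplane a k \<in> N (wp is)"
  shows "\<exists>js. set js \<subseteq> set is \<and> Suc (length js) = length is \<and> wp js = affine_refl a k \<circ> wp is"
  using assms
proof (induction "is" arbitrary: a k)
  case Nil
  have "N (wp []) = {}" by (simp add: N_id)
  then show ?case using Nil.prems by blast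
next
  case (Cons i "is")
  have i: "i \<in> {..DIM('a)}" and is_sub: "set is \<subseteq> {..DIM('a)}" using Cons.prems by auto
  show ?case
  proof (cases "hyperplane a k = wall i")
    case True
    obtain b m where b: "b \<in> R" "s i = affine_refl b m" "wall i = hyperplane b m" using simple_cases i by metis
    have "affine_refl a k = s i" unfolding b(2)
      using affine_refl_cong_hyperplane root_nonzero b(1,3) Cons.prems(2) True by metis
    then have "wp is = affine_refl a k \<circ> wp (i # is)" by (simp only: wp_Cons simple_comp_cancel[OF i])
    then show ?thesis by (metis length_Cons set_subset_Cons)
  next
    case False
    then have "s i ` hyperplane a k \<in> N (wp is)"
      using N_simple_comp[OF i aff_wp[OF is_sub]] Cons.prems(3) by (simp del: comp_apply)
    moreover obtain b m where b: "b \<in> R" "s i ` hyperplane a k = hyperplane b m"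
      using aff_hyps[OF aff_simple[OF i] hyperplane_in_hyps[OF Cons.prems(2)]] hyps_cases by metis
    ultimately obtain js where js: "set js \<subseteq> set is" "Suc (length js) = length is"
        "wp js = affine_refl b m \<circ> wp is"
      using Cons.IH[OF is_sub b(1)] by metis
    have "s i \<circ> affine_refl a k = affine_refl b m \<circ> s i"
      by (rule refl_conj[OF aff_simple[OF i] b(1) Cons.prems(2) b(2)])
    then have "s i \<circ> affine_refl b m = affine_refl a k \<circ> s i"
      using simple_comp_cancel[OF i] comp_simple_cancel[OF i] by (metis comp_assoc)
    then have "wp (i # js) = affine_refl a k \<circ> wp (i # is)"
      unfolding wp_Cons js(3) by (simp only: comp_assoc[symmetric])
    then show ?thesis using js by (intro exI[of _ "i # js"]) (auto simp del: comp_apply)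
  qed
qed

text \<open>Prepending a letter either raises the length or is absorbed by
  \<open>strong_exchange\<close>. The inclusion of the letters is recorded so that elements of a
  parabolic subgroup get reduced words inside it.\<close>

lemma word_reduce:
  assumes "set is \<subseteq> {..DIM('a)}"
  shows "\<exists>js. set js \<subseteq> set is \<and> length js = len (wp is) \<and> wp js = wp is"
  using assms
proof (induction "is")
  case Nil
  have "length [] = len (wp [])" by (simp add: len_def N_id)
  then show ?case by blast
next
  case (Cons i "is")
  have i: "i \<in> {..DIM('a)}" and is_sub: "set is \<subseteq> {..DIM('a)}" using Cons.prems by auto
  obtain js where js: "set js \<subseteq> set is" "length js = len (wp is)" "wp js = wp is"
    using Cons by auto
  show ?case
  proof (cases "wall i \<in> N (wp is)")
    case False
    then show ?thesis
      using js len_simple_comp_up[OF i aff_wp[OF is_sub]] by (intro exI[of _ "i # js"]) (auto simp del: comp_apply)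
  next
    case True
    obtain b m where b: "b \<in> R" "s i = affine_refl b m" "wall i = hyperplane b m" using simple_cases i by metis
    obtain ks where "set ks \<subseteq> set js" "Suc (length ks) = length js" "wp ks = s i \<circ> wp js"
      using strong_exchange[of js b m] js is_sub True b by auto
    then show ?thesis using js len_simple_comp_down[OF i aff_wp[OF is_sub] True]
      by (intro exI[of _ ks]) (auto simp del: comp_apply)
  qed
qed

lemma words_reduced:
  assumes "w \<in> words J" "J \<subseteq> {..DIM('a)}"
  obtains "is" where "set is \<subseteq> J" "length is = len w" "wp is = w"
proof -
  obtain js where js: "set js \<subseteq> J" "w = wp js" using assms(1) by (auto simp: words_def)
  then obtain "is" where "set is \<subseteq> set js" "length is = len w" "wp is = w"
    using word_reduce assms(2) by (metis subset_trans)
  then show ?thesis using that js by blast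
qed

text \<open>Each letter adds at most one separating hyperplane, and \<open>word_reduce\<close>
  attains this bound, so minimal word length is the geometric length.\<close>

lemma reduced_word_iff: "reduced_word R \<alpha> is \<longleftrightarrow> set is \<subseteq> {..DIM('a)} \<and> length is = len (wp is)"
proof
  assume r: "reduced_word R \<alpha> is"
  then have sub: "set is \<subseteq> {..DIM('a)}" by (simp add: reduced_word_def)
  obtain js where "set js \<subseteq> set is" "length js = len (wp is)" "wp js = wp is" using word_reduce[OF sub] by blast
  then have "length is \<le> len (wp is)" using r sub unfolding reduced_word_def by (metis subset_trans)
  then show "set is \<subseteq> {..DIM('a)} \<and> length is = len (wp is)" using sub len_wp_le[OF sub] by simp
next
  assume *: "set is \<subseteq> {..DIM('a)} \<and> length is = len (wp is)"
  then show "reduced_word R \<alpha> is"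
    unfolding reduced_word_def using len_wp_le by (metis (no_types, lifting))
qed

lemma W_reduced:
  assumes "w \<in> W" obtains "is" where "reduced_word R \<alpha> is" "wp is = w"
  using words_reduced[of w "{..DIM('a)}"] assms unfolding affine_weyl_words reduced_word_iff by (metis order_refl)

lemma N_empty_id: "w \<in> W \<Longrightarrow> N w = {} \<Longrightarrow> w = id"
  by (metis W_reduced len_eq_0 length_0_conv reduced_word_iff wp_Nil)

lemma reduced_Cons:
  assumes "reduced_word R \<alpha> (i # is)"
  shows "i \<in> {..DIM('a)}" "reduced_word R \<alpha> is" "wall i \<notin> N (wp is)" "wall i \<in> N (wp (i # is))"
proof -
  show i: "i \<in> {..DIM('a)}" using assms by (simp add: reduced_word_iff)
  have sub: "set is \<subseteq> {..DIM('a)}" using assms by (simp add: reduced_word_iff)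
  have l: "len (s i \<circ> wp is) = length is + 1" using assms by (simp add: reduced_word_iff del: comp_apply)
  show "wall i \<notin> N (wp is)"
    using l len_wp_le[OF sub] len_simple_comp_down[OF i aff_wp[OF sub]] by auto
  then show "reduced_word R \<alpha> is" "wall i \<in> N (wp (i # is))"
    using l sub i len_simple_comp_up[OF i aff_wp[OF sub]] wall_N_simple_comp[OF i aff_wp[OF sub]]
    by (auto simp: reduced_word_iff simp del: comp_apply)
qed

lemma reduced_ConsI:
  assumes "i \<in> {..DIM('a)}" "reduced_word R \<alpha> is" "wall i \<notin> N (wp is)"
  shows "reduced_word R \<alpha> (i # is)"
  using assms len_simple_comp_up[of i "wp is"] aff_wp by (auto simp: reduced_word_iff simp del: comp_apply)

text \<open>The wall of the first letter separates the alcove from its image, and the image of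
  \<open>z\<close> lies in the closures of both, hence on that wall. So the first letter fixes it
  and can be peeled off. This gives at once that an orbit meets the closed alcove in one point and
  that stabilisers are parabolic.\<close>

lemma stabilizer_word:
  assumes "reduced_word R \<alpha> is" "z \<in> cl" "wp is z \<in> cl"
  shows "wp is z = z \<and> set is \<subseteq> {j \<in> {..DIM('a)}. s j z = z}"
  using assms
proof (induction "is")
  case (Cons j "is")
  note r = reduced_Cons[OF Cons.prems(1)]
  have sub: "set is \<subseteq> {..DIM('a)}" using r(2) by (simp add: reduced_word_iff)
  obtain a k where a: "a \<in> R" "s j = affine_refl a k" "wall j = hyperplane a k" using simple_cases r(1) by metis
  let ?w = "wp (j # is)"
  have aw: "aff ?w" by (rule aff_wp) (use sub r(1) in auto)
  have opp: "(x0 \<bullet> a - of_int k) * (?w x0 \<bullet> a - of_int k) < 0"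
    using r(4) unfolding N_def a(3) sep_iff[OF a(1)] .
  have "(x0 \<bullet> a - of_int k) * (?w z \<bullet> a - of_int k) \<ge> 0" using cl_side[OF Cons.prems(3) a(1)] .
  moreover have "(?w x0 \<bullet> a - of_int k) * (?w z \<bullet> a - of_int k) \<ge> 0" using aff_cl_side[OF aw Cons.prems(2) a(1)] .
  ultimately have "?w z \<bullet> a - of_int k = 0"
    using opp unfolding mult_less_0_iff zero_le_mult_iff by linarith
  then have fix1: "s j (?w z) = ?w z" unfolding a(2) by (intro affine_refl_fixed) (simp add: hyperplane_def)
  then have eq: "wp is z = ?w z" using simple_involution[OF r(1), of "wp is z"] by simp
  have fz: "wp is z = z" and sz: "set is \<subseteq> {j \<in> {..DIM('a)}. s j z = z}"
    using Cons.IH r(2) Cons.prems(2,3) unfolding eq by blast+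
  have wz: "?w z = z" using eq fz by metis
  then have "s j z = z" using fix1 by metis
  then have "set (j # is) \<subseteq> {j \<in> {..DIM('a)}. s j z = z}" using sz r(1) by simp
  then show ?case using wz by blast
qed simp

lemma W_cl_eq: "w \<in> W \<Longrightarrow> z \<in> cl \<Longrightarrow> w z \<in> cl \<Longrightarrow> w z = z"
  by (metis W_reduced stabilizer_word)

lemma stabilizer_eq: "z \<in> cl \<Longrightarrow> {w \<in> W. w z = z} = words {j \<in> {..DIM('a)}. s j z = z}"
proof
  assume z: "z \<in> cl"
  show "{w \<in> W. w z = z} \<subseteq> words {j \<in> {..DIM('a)}. s j z = z}"
  proof clarify
    fix w assume w: "w \<in> W" "w z = z"
    obtain "is" where "is": "reduced_word R \<alpha> is" "wp is = w" using W_reduced w(1) by metis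
    then have "wp is z \<in> cl" using z w(2) by simp
    then have "set is \<subseteq> {j \<in> {..DIM('a)}. s j z = z}" using stabilizer_word[OF "is"(1) z] by blast
    then show "w \<in> words {j \<in> {..DIM('a)}. s j z = z}" using "is"(2) unfolding words_def by blast
  qed
  have "wp is z = z" if "set is \<subseteq> {j. s j z = z}" for "is"
    using that by (induction "is") auto
  then have "w z = z" if "w \<in> words {j \<in> {..DIM('a)}. s j z = z}" for w
    using that unfolding words_def by blast
  moreover have "words {j \<in> {..DIM('a)}. s j z = z} \<subseteq> W" by (rule words_subset) auto
  ultimately show "words {j \<in> {..DIM('a)}. s j z = z} \<subseteq> {w \<in> W. w z = z}" by blast
qed

end

section \<open>The Coxeter complex and the extended affine Weyl group\<close>

context based_root_system
begin

abbreviation "fv \<equiv> fund_vertex R \<alpha>"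

section \<open>Vertices of the fundamental alcove and their types\<close>

lemma mark_pos: "i \<in> {1..DIM('a)} \<Longrightarrow> mark R \<alpha> i = \<theta> \<bullet> \<omega> i \<and> mark R \<alpha> i > 0"
  using highest_root_coeff_pos[of i] by (simp add: mark_def root_coeff_eq)

lemma fv_0 [simp]: "fv 0 = 0"
  by (simp add: fund_vertex_def)

lemma fv_simple:
  assumes "i \<in> {..DIM('a)}" "j \<in> {1..DIM('a)}"
  shows "fv i \<bullet> \<alpha> j = (if i = j then 1 / mark R \<alpha> j else 0)"
  using assms(2) fund_coweight_inner[OF assms(2), of i] by (cases "i = j") (auto simp: fund_vertex_def divide_inverse)

lemma fv_highest: "i \<in> {1..DIM('a)} \<Longrightarrow> fv i \<bullet> \<theta> = 1"
  using mark_pos[of i] by (simp add: fund_vertex_def inner_commute)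

lemma I_cases: "i \<in> {..DIM('a)} \<Longrightarrow> i = 0 \<or> i \<in> {1..DIM('a)}"
  by auto

lemma fv_cl: "i \<in> {..DIM('a)} \<Longrightarrow> fv i \<in> cl"
proof -
  assume i: "i \<in> {..DIM('a)}"
  have "0 \<le> fv i \<bullet> \<alpha> j" if "j \<in> {1..DIM('a)}" for j
    using mark_pos[OF that] unfolding fv_simple[OF i that] by simp
  moreover have "fv i \<bullet> \<theta> \<le> 1" using I_cases[OF i] fv_highest by auto
  ultimately show "fv i \<in> cl" by (simp add: cl_def)
qed

lemma simple_fixes_iff: "j \<in> {..DIM('a)} \<Longrightarrow> s j x = x \<longleftrightarrow> x \<in> wall j"
  by (metis affine_refl_fixed_iff root_nonzero simple_cases)

lemma fv_wall: "i \<in> {..DIM('a)} \<Longrightarrow> j \<in> {..DIM('a)} \<Longrightarrow> fv i \<in> wall j \<longleftrightarrow> i \<noteq> j"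
  using I_cases[of j] I_cases[of i] mark_pos[of j] fv_highest[of i]
  by (auto simp: wall_def hyperplane_def fv_simple)

lemma simple_fixes_fv: "i \<in> {..DIM('a)} \<Longrightarrow> j \<in> {..DIM('a)} \<Longrightarrow> s j (fv i) = fv i \<longleftrightarrow> i \<noteq> j"
  by (simp only: simple_fixes_iff fv_wall)

lemma fv_unique:
  assumes i: "i \<in> {..DIM('a)}" and x: "\<And>j. j \<in> {..DIM('a)} \<Longrightarrow> j \<noteq> i \<Longrightarrow> x \<in> wall j"
  shows "x = fv i"
proof -
  have a: "x \<bullet> \<alpha> j = 0" if "j \<in> {1..DIM('a)}" "j \<noteq> i" for j
    using x[of j] that by (auto simp: wall_def hyperplane_def)
  show ?thesis
  proof (cases "i = 0")
    case True
    then have "x = 0" by (intro inner_simple_eqI) (use a in auto)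
    then show ?thesis using True by simp
  next
    case False
    then have i0: "i \<in> {1..DIM('a)}" using i by auto
    have "x \<bullet> \<theta> = 1" using x[of 0] False by (auto simp: wall_def hyperplane_def)
    moreover have "x \<bullet> \<theta> = (\<Sum>j\<in>{1..DIM('a)}. if j = i then (\<theta> \<bullet> \<omega> i) * (x \<bullet> \<alpha> i) else 0)"
      unfolding inner_expansion[of x \<theta>] by (rule sum.cong) (use a in auto)
    ultimately have "(\<theta> \<bullet> \<omega> i) * (x \<bullet> \<alpha> i) = 1" using i0 by simp
    then have "x \<bullet> \<alpha> i = 1 / mark R \<alpha> i" using mark_pos[OF i0] by (simp add: field_simps)
    then show ?thesis by (intro inner_simple_eqI) (use a fv_simple[OF i] in auto)
  qed
qed

lemma parabolic_stabilizer: "i \<in> {..DIM('a)} \<Longrightarrow> Wi i = {w \<in> W. w (fv i) = fv i}"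
proof -
  assume i: "i \<in> {..DIM('a)}"
  have "{j \<in> {..DIM('a)}. s j (fv i) = fv i} = {..DIM('a)} - {i}" using simple_fixes_fv[OF i] by blast
  then show ?thesis using stabilizer_eq[OF fv_cl[OF i]] parabolic_words[of i] by simp
qed

lemma fv_orbit: "w \<in> W \<Longrightarrow> i \<in> {..DIM('a)} \<Longrightarrow> j \<in> {..DIM('a)} \<Longrightarrow> w (fv i) = fv j \<Longrightarrow> i = j"
  using W_cl_eq[of w "fv i"] fv_cl by (metis fv_wall)

lemma fv_orbit2: "w \<in> W \<Longrightarrow> w' \<in> W \<Longrightarrow> i \<in> {..DIM('a)} \<Longrightarrow> j \<in> {..DIM('a)} \<Longrightarrow> w (fv i) = w' (fv j) \<Longrightarrow> i = j"
  using fv_orbit[of "iv w' \<circ> w" i j] W_comp W_inv aff_inv_app(1)[OF aff_W] by (metis comp_apply)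

lemma vertex_type_eq: "w \<in> W \<Longrightarrow> i \<in> {..DIM('a)} \<Longrightarrow> vertex_type R \<alpha> (w (fv i)) = i"
  unfolding vertex_type_def by (rule the_equality) (use fv_orbit2 in blast)+

text \<open>A letter \<open>k\<close> other than \<open>i\<close> in a reduced word of
  \<open>w\<close> would have to fix \<open>fv k\<close>, which it does not. So all letters are
  \<open>i\<close>, and a reduced word cannot repeat \<open>i\<close> twice in a row. This
  recognises adjacent chambers from shared vertices.\<close>

lemma fixes_face:
  assumes "w \<in> W" "i \<in> {..DIM('a)}" "\<And>j. j \<in> {..DIM('a)} \<Longrightarrow> j \<noteq> i \<Longrightarrow> w (fv j) = fv j"
  shows "w = id \<or> w = s i"
proof -
  obtain "is" where r: "reduced_word R \<alpha> is" "wp is = w" using W_reduced assms(1) by metis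
  have sub: "set is \<subseteq> {i}"
  proof
    fix k assume k: "k \<in> set is"
    show "k \<in> {i}"
    proof (rule ccontr)
      assume "k \<notin> {i}"
      moreover have kI: "k \<in> {..DIM('a)}" using k r(1) by (auto simp: reduced_word_iff)
      ultimately have "wp is (fv k) = fv k" using assms(3) r(2) by simp
      then have "set is \<subseteq> {j \<in> {..DIM('a)}. s j (fv k) = fv k}" using stabilizer_word[OF r(1) fv_cl[OF kI]] fv_cl[OF kI] by simp
      then show False using k simple_fixes_fv[OF kI kI] by blast
    qed
  qed
  show ?thesis
  proof (cases "is")
    case Nil
    then show ?thesis using r(2) by simp
  next
    case (Cons j js)
    then have j: "j = i" using sub by simp
    show ?thesis
    proof (cases js)
      case Nil
      then show ?thesis using r(2) Cons j by simp
    next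
      case (Cons k ks)
      then have "is = i # i # ks" using \<open>is = j # js\<close> j sub by simp
      then have "wall i \<notin> N (wp (i # ks))" "wall i \<in> N (wp (i # ks))"
        using reduced_Cons r(1) by metis+
      then show ?thesis by simp
    qed
  qed
qed

lemma inj_simple_refl: "i \<in> {..DIM('a)} \<Longrightarrow> j \<in> {..DIM('a)} \<Longrightarrow> s i = s j \<Longrightarrow> i = j"
  by (metis simple_fixes_fv)

section \<open>Alcoves as components, their closures and the Coxeter complex\<close>

lemma aff_linear:
  assumes "aff f" obtains L v where "linear L" "f = (\<lambda>x. L x + v)"
  using assms by (auto simp: aff_def orthogonal_transformation_def)

lemma aff_continuous: "aff f \<Longrightarrow> continuous_on S f"
proof -
  assume "aff f"
  then obtain L v where "linear L" "f = (\<lambda>x. L x + v)" using aff_linear by metis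
  then show ?thesis
    using linear_continuous_on[of L S] by (auto intro!: continuous_on_add simp: linear_conv_bounded_linear)
qed

lemma convex_alcove: "convex C0"
proof -
  have "C0 = (\<Inter>i\<in>{1..DIM('a)}. {x. x \<bullet> \<alpha> i > 0}) \<inter> {x. x \<bullet> \<theta> < 1}" by (auto simp: fund_alcove_def)
  moreover have "convex {x. x \<bullet> a > 0}" for a :: 'a
    using convex_halfspace_gt[of 0 a] by (simp add: inner_commute)
  moreover have "convex {x. x \<bullet> \<theta> < 1}"
    using convex_halfspace_lt[of \<theta> 1] by (simp add: inner_commute)
  ultimately show ?thesis by (simp add: convex_INT convex_Int)
qed

lemma gen_set: "UNIV - (\<Union>a\<in>R. \<Union>k. hyperplane a k) = {p. gen p}"
  by (auto simp: gen_def hyps_def)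

text \<open>By the intermediate value property, a connected set avoiding all hyperplanes stays on
  one side of each, and points separated by no hyperplane lie in the same translate of the
  alcove.\<close>

lemma component_alcove:
  assumes w: "w \<in> W" and p: "p \<in> w ` C0"
  shows "connected_component_set {p. gen p} p = w ` C0"
proof
  have aw: "aff w" using aff_W w by blast
  have G: "w ` C0 \<subseteq> {p. gen p}" using gen_aff[OF aw] gen_alcove by blast
  have "connected (w ` C0)"
    using connected_continuous_image[OF aff_continuous[OF aw] convex_connected[OF convex_alcove]] .
  then show "w ` C0 \<subseteq> connected_component_set {p. gen p} p"
    using connected_component_maximal[OF p _ G] by blast
  show "connected_component_set {p. gen p} p \<subseteq> w ` C0"
  proof
    fix q assume "q \<in> connected_component_set {p. gen p} p"
    then obtain T where T: "connected T" "T \<subseteq> {p. gen p}" "p \<in> T" "q \<in> T"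
      by (auto simp: connected_component_def)
    obtain x where x: "x \<in> C0" "p = w x" using p by blast
    have gq: "gen q" using T by blast
    then have gq': "gen (iv w q)" using gen_aff[OF aff_inv[OF aw]] by blast
    have "sep p q = {}"
    proof (rule ccontr)
      assume "sep p q \<noteq> {}"
      then obtain a k where a: "a \<in> R" "hyperplane a k \<in> sep p q" using sep_subset_hyps hyps_cases by (metis ex_in_conv)
      then have "(p \<bullet> a - of_int k) * (q \<bullet> a - of_int k) < 0" using sep_iff by blast
      then have "(a \<bullet> p \<le> of_int k \<and> of_int k \<le> a \<bullet> q) \<or> (a \<bullet> q \<le> of_int k \<and> of_int k \<le> a \<bullet> p)"
        by (auto simp: mult_less_0_iff inner_commute)
      then obtain z where "z \<in> T" "a \<bullet> z = of_int k"
        using connected_ivt_hyperplane[OF T(1)] T(3,4) by metis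
      then show False using T(2) a(1) by (auto simp: gen_iff inner_commute)
    qed
    then have "sep x (iv w q) = {}" using sep_image[OF aff_inv[OF aw], of p q] by (simp add: x(2) aff_inv_app[OF aw])
    then have "sep x0 (iv w q) = {}"
      using sep_triangle[OF gen_x0 gen_alcove[OF x(1)] gq'] sep_alcove[OF x0 x(1)] by blast
    then have "iv w q \<in> C0" using alcove_if_not_sep gq' by blast
    then show "q \<in> w ` C0" using aff_inv_app(2)[OF aw] by (metis imageI)
  qed
qed

lemma alcoves_eq: "alcoves R = {w ` C0 | w. w \<in> W}"
proof
  show "alcoves R \<subseteq> {w ` C0 | w. w \<in> W}"
  proof
    fix A assume "A \<in> alcoves R"
    then obtain p where p: "gen p" "A = connected_component_set {p. gen p} p"
      unfolding alcoves_def gen_set components_def by auto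
    obtain "is" where "is": "set is \<subseteq> {..DIM('a)}" "wp is p \<in> C0" using gallery_to_alcove p(1) by blast
    have "p = iv (wp is) (wp is p)" using aff_inv_app(1)[OF aff_wp[OF "is"(1)]] by simp
    then have "p \<in> iv (wp is) ` C0" using "is"(2) by (metis imageI)
    moreover have "iv (wp is) \<in> W" using W_inv wp_in_W "is"(1) by blast
    ultimately show "A \<in> {w ` C0 | w. w \<in> W}" using component_alcove p(2) by blast
  qed
  show "{w ` C0 | w. w \<in> W} \<subseteq> alcoves R"
  proof clarify
    fix w assume w: "w \<in> W"
    have p: "w x0 \<in> w ` C0" using x0 by blast
    have "gen (w x0)" using gen_aff aff_W w gen_x0 by blast
    then show "w ` C0 \<in> alcoves R"
      unfolding alcoves_def gen_set components_def using component_alcove[OF w p] by blast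
  qed
qed

lemma closure_alcove: "closure C0 = cl"
proof
  have "cl = (\<Inter>i\<in>{1..DIM('a)}. {x. x \<bullet> \<alpha> i \<ge> 0}) \<inter> {x. x \<bullet> \<theta> \<le> 1}" by (auto simp: cl_def)
  moreover have "closed {x. x \<bullet> a \<ge> 0}" for a :: 'a
    using closed_halfspace_ge[of 0 a] by (simp add: inner_commute)
  moreover have "closed {x. x \<bullet> \<theta> \<le> 1}"
    using closed_halfspace_le[of \<theta> 1] by (simp add: inner_commute)
  ultimately have "closed cl" by (simp add: closed_INT closed_Int)
  then show "closure C0 \<subseteq> cl" using alcove_subset_cl by (intro closure_minimal) auto
  show "cl \<subseteq> closure C0"
  proof
    fix z assume z: "z \<in> cl"
    \<comment> \<open>Points on the segment from \<open>z\<close> to the interior point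
      \<open>x0\<close>, tending to \<open>z\<close>; the positive share of \<open>x0\<close> makes
      the inequalities strict.\<close>
    define f where "f m = (1 - 1 / real (Suc m)) *\<^sub>R z + (1 / real (Suc m)) *\<^sub>R x0" for m
    have "f m \<in> C0" for m
    proof -
      define u where "u = 1 / real (Suc m)"
      have u: "0 < u" "u \<le> 1" by (auto simp: u_def)
      have f: "f m \<bullet> a = (1 - u) * (z \<bullet> a) + u * (x0 \<bullet> a)" for a
        by (simp add: f_def u_def inner_add_left)
      have "f m \<bullet> \<alpha> i > 0" if "i \<in> {1..DIM('a)}" for i
        unfolding f using u z x0 that by (intro add_nonneg_pos) (auto simp: cl_def fund_alcove_def)
      moreover have "(1 - u) * (z \<bullet> \<theta>) \<le> (1 - u) * 1"
        by (rule mult_left_mono) (use u z in \<open>auto simp: cl_def\<close>)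
      moreover have "u * (x0 \<bullet> \<theta>) < u * 1" using u x0 by (auto simp: fund_alcove_def)
      ultimately have "f m \<bullet> \<theta> < 1" unfolding f by simp
      with \<open>\<And>i. i \<in> {1..DIM('a)} \<Longrightarrow> f m \<bullet> \<alpha> i > 0\<close> show ?thesis by (simp add: fund_alcove_def)
    qed
    moreover have "f \<longlonglongrightarrow> (1 - 0) *\<^sub>R z + 0 *\<^sub>R x0"
      unfolding f_def by (intro tendsto_intros LIMSEQ_Suc[OF lim_1_over_n])
    ultimately show "z \<in> closure C0" unfolding closure_sequential by auto
  qed
qed

lemma cl_hull: "cl = convex hull (fv ` {..DIM('a)})"
proof
  have "cl = (\<Inter>i\<in>{1..DIM('a)}. {x. x \<bullet> \<alpha> i \<ge> 0}) \<inter> {x. x \<bullet> \<theta> \<le> 1}" by (auto simp: cl_def)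
  moreover have "convex {x. x \<bullet> a \<ge> 0}" for a :: 'a
    using convex_halfspace_ge[of 0 a] by (simp add: inner_commute)
  moreover have "convex {x. x \<bullet> \<theta> \<le> 1}"
    using convex_halfspace_le[of \<theta> 1] by (simp add: inner_commute)
  ultimately have "convex cl" by (simp add: convex_INT convex_Int)
  then show "convex hull (fv ` {..DIM('a)}) \<subseteq> cl" using fv_cl by (intro hull_minimal) auto
  show "cl \<subseteq> convex hull (fv ` {..DIM('a)})"
  proof
    fix x assume x: "x \<in> cl"
    \<comment> \<open>Barycentric coordinates: the factor of \<open>fv i\<close> is the mark times
      the value of the simple root, and the vertex 0 takes what is missing to 1.\<close>
    define c where "c i = (if i = 0 then 1 - x \<bullet> \<theta> else (\<theta> \<bullet> \<omega> i) * (x \<bullet> \<alpha> i))" for i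
    have split: "{..DIM('a)} = insert 0 {1..DIM('a)}" by auto
    have "(\<Sum>i\<in>{1..DIM('a)}. c i) = x \<bullet> \<theta>"
      unfolding inner_expansion[of x \<theta>] by (rule sum.cong) (auto simp: c_def)
    then have s1: "sum c {..DIM('a)} = 1" unfolding split by (simp add: c_def)
    have c0: "c i \<ge> 0" if "i \<in> {..DIM('a)}" for i
      using x highest_root_coeff_pos[of i] that I_cases[of i] by (auto simp: c_def cl_def less_imp_le)
    have "(\<Sum>i\<in>{..DIM('a)}. c i *\<^sub>R fv i) = (\<Sum>i\<in>{1..DIM('a)}. c i *\<^sub>R fv i)" unfolding split by simp
    also have "\<dots> = (\<Sum>i\<in>{1..DIM('a)}. (x \<bullet> \<alpha> i) *\<^sub>R \<omega> i)"
    proof (rule sum.cong)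
      fix i assume i: "i \<in> {1..DIM('a)}"
      then show "c i *\<^sub>R fv i = (x \<bullet> \<alpha> i) *\<^sub>R \<omega> i"
        using mark_pos[OF i] by (simp add: c_def fund_vertex_def)
    qed simp
    also have "\<dots> = x" by (rule coweight_expansion[symmetric])
    finally have x: "x = (\<Sum>i\<in>{..DIM('a)}. c i *\<^sub>R fv i)" ..
    show "x \<in> convex hull (fv ` {..DIM('a)})" unfolding x
      by (rule convex_sum) (use c0 s1 in \<open>auto simp: hull_inc\<close>)
  qed
qed

lemma aff_extreme:
  assumes f: "aff f" and x: "x extreme_point_of S"
  shows "f x extreme_point_of f ` S"
  unfolding extreme_point_of_def
proof (intro conjI ballI)
  show "f x \<in> f ` S" using x by (simp add: extreme_point_of_def)
  fix a' b' assume "a' \<in> f ` S" "b' \<in> f ` S"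
  then obtain a b where ab: "a \<in> S" "b \<in> S" "a' = f a" "b' = f b" by blast
  show "f x \<notin> open_segment a' b'"
  proof
    assume "f x \<in> open_segment a' b'"
    then obtain u where u: "0 < u" "u < 1" "f x = (1 - u) *\<^sub>R f a + u *\<^sub>R f b" "f a \<noteq> f b"
      unfolding in_segment ab(3,4) by blast
    then have "f x = f ((1 - u) *\<^sub>R a + u *\<^sub>R b)" using aff_affine_combination[OF f] by simp
    then have "x = (1 - u) *\<^sub>R a + u *\<^sub>R b" using aff_inj[OF f] by blast
    then have "x \<in> open_segment a b" using u unfolding in_segment by blast
    then show False using x ab by (auto simp: extreme_point_of_def)
  qed
qed

text \<open>If \<open>fv i\<close> lies strictly between two points of the closed alcove, both
  satisfy with equality the inequalities of all walls but the \<open>i\<close>-th, and these walls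
  meet only in \<open>fv i\<close>.\<close>

lemma fv_extreme:
  assumes i: "i \<in> {..DIM('a)}" shows "fv i extreme_point_of cl"
  unfolding extreme_point_of_def
proof (intro conjI ballI)
  show "fv i \<in> cl" using fv_cl i by blast
  fix a b assume ab: "a \<in> cl" "b \<in> cl"
  show "fv i \<notin> open_segment a b"
  proof
    assume "fv i \<in> open_segment a b"
    then obtain u where u: "0 < u" "u < 1" "fv i = (1 - u) *\<^sub>R a + u *\<^sub>R b" and "a \<noteq> b"
      unfolding in_segment by blast
    have zero: "c = 0 \<and> d = 0" if "c \<ge> 0" "d \<ge> 0" "(1 - u) * c + u * d = 0" for c d :: real
      using that u by (simp add: add_nonneg_eq_0_iff)
    have "a \<in> wall j \<and> b \<in> wall j" if j: "j \<in> {..DIM('a)}" "j \<noteq> i" for j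
    proof (cases "j = 0")
      case True
      have "fv i \<bullet> \<theta> = 1" using fv_highest i j True by auto
      then have "(1 - u) * (1 - a \<bullet> \<theta>) + u * (1 - b \<bullet> \<theta>) = 0"
        unfolding u(3) by (simp add: inner_add_left algebra_simps)
      then show ?thesis using zero[of "1 - a \<bullet> \<theta>" "1 - b \<bullet> \<theta>"] ab True
        by (auto simp: cl_def wall_def hyperplane_def)
    next
      case False
      then have j0: "j \<in> {1..DIM('a)}" using j by auto
      have "fv i \<bullet> \<alpha> j = 0" using fv_simple[OF i j0] j by simp
      then have "(1 - u) * (a \<bullet> \<alpha> j) + u * (b \<bullet> \<alpha> j) = 0" unfolding u(3) by (simp add: inner_add_left)
      then show ?thesis using zero[of "a \<bullet> \<alpha> j" "b \<bullet> \<alpha> j"] ab False j0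
        by (auto simp: cl_def wall_def hyperplane_def)
    qed
    then have "a = fv i" "b = fv i" using fv_unique[OF i] by blast+
    then show False using \<open>a \<noteq> b\<close> by simp
  qed
qed

lemma extreme_points_alcove:
  assumes w: "w \<in> W" shows "{v. v extreme_point_of closure (w ` C0)} = w ` fv ` {..DIM('a)}"
proof -
  have aw: "aff w" using aff_W w by blast
  obtain L v where L: "linear L" "w = (\<lambda>x. L x + v)" using aff_linear[OF aw] .
  have inj: "inj L" using aff_bij[OF aw] by (auto simp: L(2) inj_def bij_def)
  have "closure (w ` C0) = closure ((+) v ` (L ` C0))" by (simp add: L(2) image_image add.commute)
  also have "\<dots> = (+) v ` (L ` closure C0)"
    by (simp only: closure_translation closure_injective_linear_image[OF L(1) inj])
  also have "\<dots> = w ` cl" by (simp add: L(2) closure_alcove image_image add.commute)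
  finally have c: "closure (w ` C0) = w ` cl" .
  have "x extreme_point_of w ` cl \<longleftrightarrow> iv w x extreme_point_of cl" for x
    using aff_extreme[OF aw, of "iv w x" cl] aff_extreme[OF aff_inv[OF aw], of x "w ` cl"]
      inv_image_aff(1)[OF aw] aff_inv_app(2)[OF aw] by auto
  moreover have "y extreme_point_of cl \<longleftrightarrow> y \<in> fv ` {..DIM('a)}" for y
    using fv_extreme extreme_point_of_convex_hull[of y "fv ` {..DIM('a)}"] cl_hull by auto
  ultimately show ?thesis unfolding c using aff_inv_app[OF aw] by (auto simp: image_iff) (metis atMost_iff)
qed

lemma coxeter_complex_eq: "coxeter_complex R = {t. \<exists>w\<in>W. t \<subseteq> w ` fv ` {..DIM('a)}}"
proof (intro equalityI subsetI)
  fix t assume "t \<in> coxeter_complex R"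
  then obtain w where "w \<in> W" "t \<subseteq> {v. v extreme_point_of closure (w ` C0)}"
    unfolding coxeter_complex_def alcoves_eq by blast
  then show "t \<in> {t. \<exists>w\<in>W. t \<subseteq> w ` fv ` {..DIM('a)}}" unfolding extreme_points_alcove[OF \<open>w \<in> W\<close>] by blast
next
  fix t assume "t \<in> {t. \<exists>w\<in>W. t \<subseteq> w ` fv ` {..DIM('a)}}"
  then obtain w where "w \<in> W" "t \<subseteq> w ` fv ` {..DIM('a)}" by blast
  then show "t \<in> coxeter_complex R"
    unfolding coxeter_complex_def alcoves_eq extreme_points_alcove[OF \<open>w \<in> W\<close>, symmetric] by blast
qed

lemma coxeter_vertices: "\<Union>(coxeter_complex R) = {w (fv i) | w i. w \<in> W \<and> i \<in> {..DIM('a)}}"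
  unfolding coxeter_complex_eq by blast

section \<open>Coweights and the extended affine Weyl group\<close>

lemma coweight_iff: "v \<in> P \<longleftrightarrow> (\<forall>a\<in>R. v \<bullet> a \<in> \<int>)"
proof
  assume "v \<in> P"
  then obtain c :: "nat \<Rightarrow> int" where c: "v = (\<Sum>i\<in>{1..DIM('a)}. of_int (c i) *\<^sub>R \<omega> i)"
    by (auto simp: coweight_lattice_def)
  have "v \<bullet> a = (\<Sum>i\<in>{1..DIM('a)}. of_int (c i) * (a \<bullet> \<omega> i))" for a
    unfolding c inner_sum_left by (rule sum.cong) (auto simp: inner_commute)
  then show "\<forall>a\<in>R. v \<bullet> a \<in> \<int>" using root_coeff_int by (auto intro!: Ints_sum Ints_mult)
next
  assume "\<forall>a\<in>R. v \<bullet> a \<in> \<int>"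
  then have "\<forall>i\<in>{1..DIM('a)}. \<exists>z. v \<bullet> \<alpha> i = of_int z" using simple_root by (meson Ints_cases)
  then obtain c where c: "\<forall>i\<in>{1..DIM('a)}. v \<bullet> \<alpha> i = of_int (c i)" by metis
  have "v = (\<Sum>i\<in>{1..DIM('a)}. (v \<bullet> \<alpha> i) *\<^sub>R \<omega> i)" by (rule coweight_expansion)
  also have "\<dots> = (\<Sum>i\<in>{1..DIM('a)}. of_int (c i) *\<^sub>R \<omega> i)" by (rule sum.cong) (use c in auto)
  finally show "v \<in> P" by (auto simp: coweight_lattice_def)
qed

lemma aff_0_coweight: "aff f \<Longrightarrow> f 0 \<in> P"
  unfolding coweight_iff aff_def by (auto simp: orthogonal_transformation_def linear_0)

lemma aff_coweight:
  assumes "aff f" "v \<in> P" shows "f v \<in> P"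
proof -
  have "aff (f \<circ> transl v)" using assms by (intro aff_comp aff_transl) (auto simp: coweight_iff)
  then show ?thesis using aff_0_coweight by (fastforce simp: transl_def)
qed

lemma weyl_stabilizer_0: "W0 = {w \<in> W. w 0 = 0}"
  using parabolic_stabilizer[of 0] by simp

lemma W0_id: "id \<in> W0" and W0_comp: "u \<in> W0 \<Longrightarrow> v \<in> W0 \<Longrightarrow> u \<circ> v \<in> W0"
  and W0_inv: "u \<in> W0 \<Longrightarrow> iv u \<in> W0" and W0_W: "u \<in> W0 \<Longrightarrow> u \<in> W"
  unfolding weyl_stabilizer_0 using W_id W_comp W_inv aff_inv_app(1)[OF aff_W]
  by (auto simp del: comp_apply) (simp_all, metis)

lemma aff_fix0_linear: "aff u \<Longrightarrow> u 0 = 0 \<Longrightarrow> linear u"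
proof -
  assume u: "aff u" "u 0 = 0"
  obtain L v where L: "linear L" "u = (\<lambda>x. L x + v)" using aff_linear[OF u(1)] .
  then have "v = 0" using u(2) linear_0[OF L(1)] by simp
  then show ?thesis using L by simp
qed

lemma W0_linear: "u \<in> W0 \<Longrightarrow> linear u"
  using aff_fix0_linear aff_W by (auto simp: weyl_stabilizer_0)

lemma WE_iff: "g \<in> WE \<longleftrightarrow> (\<exists>v\<in>P. \<exists>u\<in>W0. g = transl v \<circ> u)"
  by (auto simp: extended_affine_weyl_def)

lemma aff_transl_P: "v \<in> P \<Longrightarrow> aff (transl v)"
  by (rule aff_transl) (auto simp: coweight_iff)

lemma aff_WE: "g \<in> WE \<Longrightarrow> aff g"
  unfolding WE_iff using aff_comp aff_transl_P aff_W W0_W by blast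

lemma W0_transl: "u \<in> W0 \<Longrightarrow> u \<circ> transl v = transl (u v) \<circ> u"
  using linear_add[OF W0_linear] by (auto simp: transl_def)

lemma coweight_add: "v \<in> P \<Longrightarrow> w \<in> P \<Longrightarrow> v + w \<in> P" and coweight_uminus: "v \<in> P \<Longrightarrow> - v \<in> P"
  and coweight_0: "0 \<in> P"
  by (auto simp: coweight_iff inner_add_left)

lemma WE_comp:
  assumes "g \<in> WE" "h \<in> WE" shows "g \<circ> h \<in> WE"
proof -
  obtain v u where g: "v \<in> P" "u \<in> W0" "g = transl v \<circ> u" using assms(1) WE_iff by blast
  obtain v' u' where h: "v' \<in> P" "u' \<in> W0" "h = transl v' \<circ> u'" using assms(2) WE_iff by blast
  have "g \<circ> h = transl v \<circ> (u \<circ> transl v') \<circ> u'" unfolding g h by (simp only: comp_assoc)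
  also have "\<dots> = transl (v + u v') \<circ> (u \<circ> u')"
    unfolding W0_transl[OF g(2)] by (auto simp: transl_def add.commute add.left_commute)
  finally show ?thesis
    unfolding WE_iff using g h coweight_add aff_coweight aff_W W0_W W0_comp by blast
qed

lemma WE_inv:
  assumes "g \<in> WE" shows "iv g \<in> WE"
proof -
  obtain v u where g: "v \<in> P" "u \<in> W0" "g = transl v \<circ> u" using assms WE_iff by blast
  have u: "iv u \<in> W0" using W0_inv g by blast
  have "iv g = transl (- iv u v) \<circ> iv u"
  proof (rule inv_unique_comp)
    have uu: "u (iv u x) = x" "iv u (u x) = x" for x using aff_inv_app[OF aff_W[OF W0_W[OF g(2)]]] by auto
    have l: "linear u" using W0_linear g(2) by blast
    show "g \<circ> (transl (- iv u v) \<circ> iv u) = id"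
      by (auto simp: g(3) transl_def linear_diff[OF l] uu)
    show "transl (- iv u v) \<circ> iv u \<circ> g = id"
      using linear_add[OF W0_linear[OF u]] by (auto simp: g(3) transl_def uu)
  qed
  then show ?thesis unfolding WE_iff using u g(1) coweight_uminus aff_coweight aff_W W0_W by blast
qed

lemma WE_transl: "v \<in> P \<Longrightarrow> transl v \<in> WE"
  unfolding WE_iff using W0_id by (metis comp_id)

lemma W0_WE: "u \<in> W0 \<Longrightarrow> u \<in> WE"
  unfolding WE_iff using coweight_0 by (force simp: transl_def)

lemma simple_WE: "i \<in> {..DIM('a)} \<Longrightarrow> s i \<in> WE"
proof -
  assume "i \<in> {..DIM('a)}"
  then obtain a k where a: "a \<in> R" "s i = affine_refl a k" using simple_cases by metis
  have 0: "affine_refl a 0 \<in> W0"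
    using W_refl[OF a(1)] by (simp add: weyl_stabilizer_0 affine_refl_def)
  have "of_int k *\<^sub>R coroot a \<in> P"
    using aff_0_coweight[OF aff_affine_refl[OF a(1), of k]] affine_refl_eq[of a k 0] by (simp add: affine_refl_linear)
  moreover have "s i = transl (of_int k *\<^sub>R coroot a) \<circ> affine_refl a 0"
    unfolding a(2) using affine_refl_eq[of a k] by (auto simp: transl_def)
  ultimately show ?thesis using 0 WE_iff by blast
qed

lemma W_WE: "w \<in> W \<Longrightarrow> w \<in> WE"
proof (elim W_cases)
  fix "is" assume "set is \<subseteq> {..DIM('a)}" "w = wp is"
  moreover have "wp is \<in> WE" if "set is \<subseteq> {..DIM('a)}" for "is"
    using that
  proof (induction "is")
    case Nil
    show ?case unfolding wp_Nil by (rule W0_WE[OF W0_id])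
  next
    case (Cons i "is")
    then have "s i \<circ> wp is \<in> WE" by (intro WE_comp simple_WE) auto
    then show ?case unfolding wp_Cons .
  qed
  ultimately show "w \<in> WE" by blast
qed

lemma WE_fix_0: "g \<in> WE \<Longrightarrow> g 0 = 0 \<Longrightarrow> g \<in> W0"
proof -
  assume "g \<in> WE" "g 0 = 0"
  then obtain v u where g: "u \<in> W0" "g = transl v \<circ> u" "v + u 0 = 0" unfolding WE_iff by (auto simp: transl_def add.commute)
  then have "v = 0" by (simp add: weyl_stabilizer_0)
  then have "g = u" using g(2) by (auto simp: transl_def)
  then show ?thesis using g(1) by simp
qed

lemma conj_W:
  assumes g: "aff g" and w: "w \<in> W" shows "g \<circ> w \<circ> iv g \<in> W"
proof -
  have "g \<circ> wp is \<circ> iv g \<in> W" if "set is \<subseteq> {..DIM('a)}" for "is"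
    using that
  proof (induction "is")
    case Nil
    have "g \<circ> id \<circ> iv g \<in> W" using aff_inv_comp(2)[OF g] W_id by simp
    then show ?case unfolding wp_Nil .
  next
    case (Cons i "is")
    then have "i \<in> {..DIM('a)}" by simp
    then obtain a k where a: "a \<in> R" "s i = affine_refl a k" using simple_cases by metis
    obtain b m where b: "b \<in> R" "g ` hyperplane a k = hyperplane b m"
      using aff_hyps[OF g hyperplane_in_hyps[OF a(1)]] hyps_cases by metis
    have "g \<circ> s i = affine_refl b m \<circ> g" unfolding a(2) by (rule refl_conj[OF g b(1) a(1) b(2)])
    then have "g \<circ> (s i \<circ> wp is) \<circ> iv g = affine_refl b m \<circ> (g \<circ> wp is \<circ> iv g)"
      by (metis comp_assoc)
    moreover have "g \<circ> wp is \<circ> iv g \<in> W"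
      using Cons.IH Cons.prems unfolding list.set insert_subset by blast
    ultimately have "g \<circ> (s i \<circ> wp is) \<circ> iv g \<in> W" using W_comp W_refl[OF b(1)] by simp
    then show ?case unfolding wp_Cons .
  qed
  then show ?thesis using w W_cases by metis
qed

text \<open>No hyperplane meets an alcove, so one point represents each alcove in the definition of
  \<open>weyl_length\<close>; \<open>len_inv\<close> then removes the inverse.\<close>

lemma weyl_length_eq:
  assumes "aff w" shows "weyl_length R \<alpha> w = len w"
proof -
  have f: "aff (iv w)" using aff_inv assms by blast
  have "separating_hyperplanes R C0 (iv w ` C0) = sep x0 (iv w x0)"
  proof
    show "separating_hyperplanes R C0 (iv w ` C0) \<subseteq> sep x0 (iv w x0)"
    proof
      fix h assume "h \<in> separating_hyperplanes R C0 (iv w ` C0)"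
      then obtain a k where a: "a \<in> R" "h = hyperplane a k"
        "(\<forall>x\<in>C0. x \<bullet> a < of_int k) \<and> (\<forall>x\<in>iv w ` C0. x \<bullet> a > of_int k) \<or>
         (\<forall>x\<in>C0. x \<bullet> a > of_int k) \<and> (\<forall>x\<in>iv w ` C0. x \<bullet> a < of_int k)"
        by (auto simp: separating_hyperplanes_def)
      then have "x0 \<bullet> a < of_int k \<and> iv w x0 \<bullet> a > of_int k \<or> x0 \<bullet> a > of_int k \<and> iv w x0 \<bullet> a < of_int k"
        using x0 by blast
      then show "h \<in> sep x0 (iv w x0)" unfolding a(2) sep_iff[OF a(1)] by (auto simp: mult_less_0_iff)
    qed
    show "sep x0 (iv w x0) \<subseteq> separating_hyperplanes R C0 (iv w ` C0)"
    proof
      fix h assume h: "h \<in> sep x0 (iv w x0)"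
      then obtain a k where a: "a \<in> R" "h = hyperplane a k" using sep_subset_hyps hyps_cases by metis
      have neg: "(x0 \<bullet> a - of_int k) * (iv w x0 \<bullet> a - of_int k) < 0" using h sep_iff a by blast
      obtain b m where b: "b \<in> R" "\<And>x. x \<bullet> b - of_int m = iv w x \<bullet> a - of_int k"
        using aff_level_inv[OF f a(1)] by metis
      have "(x0 \<bullet> a - of_int k) * (x \<bullet> a - of_int k) > 0" if "x \<in> C0" for x
        using alcove_sep[OF x0 that a(1)] .
      moreover have "(iv w x0 \<bullet> a - of_int k) * (iv w x \<bullet> a - of_int k) > 0" if "x \<in> C0" for x
        using alcove_sep[OF x0 that b(1), of m] unfolding b(2) .
      ultimately have "(\<forall>x\<in>C0. x \<bullet> a < of_int k) \<and> (\<forall>x\<in>iv w ` C0. x \<bullet> a > of_int k) \<or>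
         (\<forall>x\<in>C0. x \<bullet> a > of_int k) \<and> (\<forall>x\<in>iv w ` C0. x \<bullet> a < of_int k)"
        using neg unfolding mult_less_0_iff zero_less_mult_iff by force
      then show "h \<in> separating_hyperplanes R C0 (iv w ` C0)"
        unfolding separating_hyperplanes_def a(2) using a(1) by blast
    qed
  qed
  then have "weyl_length R \<alpha> w = len (iv w)" by (simp add: weyl_length_def len_def N_def)
  then show ?thesis using len_inv assms by simp
qed

section \<open>Elements of length zero and good types\<close>

definition GG :: "('a \<Rightarrow> 'a) set" where "GG = {g \<in> WE. N g = {}}"

lemma length_zero_group_eq: "length_zero_group R \<alpha> = GG"
  unfolding length_zero_group_def GG_def using weyl_length_eq aff_WE len_eq_0 by auto

lemma GG_WE: "g \<in> GG \<Longrightarrow> g \<in> WE" and GG_N: "g \<in> GG \<Longrightarrow> N g = {}" and GG_aff: "g \<in> GG \<Longrightarrow> aff g"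
  using aff_WE by (auto simp: GG_def)

lemma GG_id: "id \<in> GG"
  using W0_WE[OF W0_id] by (simp add: GG_def N_id)

lemma GG_inv: "g \<in> GG \<Longrightarrow> iv g \<in> GG"
  using WE_inv N_inv[OF GG_aff] GG_N unfolding GG_def by blast

lemma GG_comp: "g \<in> GG \<Longrightarrow> h \<in> GG \<Longrightarrow> g \<circ> h \<in> GG"
proof -
  assume g: "g \<in> GG" and h: "h \<in> GG"
  have "N (g \<circ> h) = image g ` N h" by (rule N_comp_empty_left[OF GG_aff GG_aff GG_N]) (rule g h)+
  then have "N (g \<circ> h) = {}" using GG_N[OF h] by (simp del: comp_apply)
  then show "g \<circ> h \<in> GG" using WE_comp[OF GG_WE[OF g] GG_WE[OF h]] unfolding GG_def by blast
qed

lemma GG_W: "g \<in> GG \<Longrightarrow> g \<in> W \<Longrightarrow> g = id"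
  using N_empty_id GG_N by blast

text \<open>Fold \<open>g x0\<close> back into the fundamental alcove by a word; what remains of
  \<open>g\<close> crosses no hyperplane.\<close>

lemma WE_decomp:
  assumes "g \<in> WE" obtains w h where "w \<in> W" "h \<in> GG" "g = w \<circ> h"
proof -
  have ag: "aff g" using aff_WE assms by blast
  obtain "is" where "is": "set is \<subseteq> {..DIM('a)}" "wp is (g x0) \<in> C0"
    using gallery_to_alcove[OF gen_aff[OF ag gen_x0]] by blast
  let ?h = "wp is \<circ> g"
  have "len ?h = 0" using len_eq_0_alcove[OF aff_comp[OF aff_wp[OF "is"(1)] ag]] "is"(2) by simp
  then have h: "?h \<in> GG" using WE_comp[OF W_WE[OF wp_in_W[OF "is"(1)]] assms] len_eq_0 by (simp add: GG_def)
  have "iv (wp is) \<in> W" using W_inv wp_in_W "is"(1) by blast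
  moreover have "g = iv (wp is) \<circ> ?h"
    using aff_inv_comp(1)[OF aff_wp[OF "is"(1)]] by (metis comp_assoc id_comp)
  ultimately show ?thesis using h that by blast
qed

lemma decomp_unique:
  assumes "w \<in> W" "h \<in> GG" "w' \<in> W" "h' \<in> GG" "w \<circ> h = w' \<circ> h'"
  shows "w = w' \<and> h = h'"
proof -
  have aw: "aff w'" "aff h" using aff_W GG_aff assms by auto
  have "h' \<circ> iv h = iv w' \<circ> (w' \<circ> h') \<circ> iv h"
    by (auto simp: aff_inv_app[OF aw(1)])
  also have "\<dots> = iv w' \<circ> w"
    unfolding assms(5)[symmetric] by (auto simp: aff_inv_app[OF aw(2)])
  finally have e: "h' \<circ> iv h = iv w' \<circ> w" .
  moreover have "iv w' \<circ> w \<in> W" using W_comp W_inv assms by blast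
  moreover have "h' \<circ> iv h \<in> GG" using GG_comp GG_inv assms by blast
  ultimately have e1: "h' \<circ> iv h = id" "iv w' \<circ> w = id" using GG_W by metis+
  have "h' = (h' \<circ> iv h) \<circ> h" by (auto simp: aff_inv_app[OF aw(2)])
  moreover have "w = w' \<circ> (iv w' \<circ> w)" by (auto simp: aff_inv_app[OF aw(1)])
  ultimately show ?thesis using e1 by simp
qed

lemma len_GG_comp: "g \<in> GG \<Longrightarrow> aff f \<Longrightarrow> len (g \<circ> f) = len f"
  by (subst len_comp_disjoint) (auto simp: GG_aff GG_N len_def)

lemma len_comp_GG: "g \<in> GG \<Longrightarrow> aff f \<Longrightarrow> len (f \<circ> g) = len f"
  by (subst len_comp_disjoint) (auto simp: GG_aff GG_N len_def)

lemma len_conj_GG: "g \<in> GG \<Longrightarrow> aff f \<Longrightarrow> len (g \<circ> f \<circ> iv g) = len f"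
  by (simp add: len_comp_GG len_GG_comp GG_inv GG_aff aff_comp del: comp_apply)

text \<open>Conjugation by a length zero element preserves both the affine Weyl group and the
  length, so it carries elements of length one to elements of length one.\<close>

lemma conj_simple_ex:
  assumes g: "g \<in> GG" and i: "i \<in> {..DIM('a)}"
  shows "\<exists>!j. j \<in> {..DIM('a)} \<and> g \<circ> s i \<circ> iv g = s j"
proof (rule ex_ex1I)
  have W: "g \<circ> s i \<circ> iv g \<in> W" using conj_W GG_aff g W_simple i by blast
  then obtain "is" where r: "reduced_word R \<alpha> is" "wp is = g \<circ> s i \<circ> iv g" using W_reduced by metis
  have "len (g \<circ> s i \<circ> iv g) = len (s i)" using len_conj_GG g aff_simple i by blast
  also have "\<dots> = 1" using N_simple[OF i] by (simp add: len_def)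
  finally have "length is = 1" using r by (simp only: reduced_word_iff)
  then obtain j where "is = [j]" by (cases "is") auto
  then show "\<exists>j. j \<in> {..DIM('a)} \<and> g \<circ> s i \<circ> iv g = s j"
    using r by (intro exI[of _ j]) (simp add: reduced_word_iff)
  show "\<And>j k. j \<in> {..DIM('a)} \<and> g \<circ> s i \<circ> iv g = s j \<Longrightarrow> k \<in> {..DIM('a)} \<and> g \<circ> s i \<circ> iv g = s k \<Longrightarrow> j = k"
    using inj_simple_refl by metis
qed

text \<open>The permutation of types attached to \<open>g\<close>, indexed by the group element
  rather than by the good type \<open>rot g 0\<close>; \<open>type_rotation_rot\<close> relates the
  two.\<close>

definition rot :: "('a \<Rightarrow> 'a) \<Rightarrow> nat \<Rightarrow> nat" where
  "rot g i = (THE j. j \<in> {..DIM('a)} \<and> g \<circ> s i \<circ> iv g = s j)"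

lemma rot: assumes "g \<in> GG" "i \<in> {..DIM('a)}" shows "rot g i \<in> {..DIM('a)}" "g \<circ> s i \<circ> iv g = s (rot g i)"
  using theI'[OF conj_simple_ex[OF assms]] unfolding rot_def by blast+

lemma rot_eqI: "g \<in> GG \<Longrightarrow> i \<in> {..DIM('a)} \<Longrightarrow> j \<in> {..DIM('a)} \<Longrightarrow> g \<circ> s i \<circ> iv g = s j \<Longrightarrow> rot g i = j"
  using rot inj_simple_refl by metis

lemma rot_comp_simple:
  assumes "g \<in> GG" "i \<in> {..DIM('a)}" shows "g \<circ> s i = s (rot g i) \<circ> g"
  unfolding rot(2)[OF assms, symmetric] by (auto simp: aff_inv_app[OF GG_aff[OF assms(1)]])

text \<open>Since \<open>g\<close> permutes the simple reflections by conjugation, it permutes their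
  walls, so the image of \<open>fv i\<close> lies on all walls except that of
  \<open>rot g i\<close>.\<close>

lemma GG_fv:
  assumes g: "g \<in> GG" and i: "i \<in> {..DIM('a)}" shows "g (fv i) = fv (rot g i)"
proof (rule fv_unique)
  show "rot g i \<in> {..DIM('a)}" using rot g i by blast
  fix k assume k: "k \<in> {..DIM('a)}" "k \<noteq> rot g i"
  define j where "j = rot (iv g) k"
  have j: "j \<in> {..DIM('a)}" "iv g \<circ> s k = s j \<circ> iv g"
    using rot(1) rot_comp_simple GG_inv[OF g] k(1) by (auto simp: j_def simp del: comp_apply)
  have "g \<circ> s j \<circ> iv g = g \<circ> (iv g \<circ> s k)" unfolding j(2) by (simp only: comp_assoc)
  also have "\<dots> = s k" by (auto simp: aff_inv_app[OF GG_aff[OF g]])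
  finally have gk: "g \<circ> s j \<circ> iv g = s k" .
  then have "j \<noteq> i" using rot_eqI[OF g j(1) k(1)] k(2) by blast
  then have fj: "s j (fv i) = fv i" using simple_fixes_fv i j(1) by metis
  have "s k (g (fv i)) = g (s j (fv i))" unfolding gk[symmetric] by (simp add: aff_inv_app[OF GG_aff[OF g]])
  then show "g (fv i) \<in> wall k" using simple_fixes_iff[OF k(1)] fj by simp
qed

lemma GG_0: "g \<in> GG \<Longrightarrow> g 0 = fv (rot g 0)"
  using GG_fv[of g 0] by simp

text \<open>Splitting the translation as \<open>w \<circ> g\<close> shows \<open>v\<close> as the
  image of \<open>g 0\<close> under \<open>w\<close>, and \<open>w\<close> preserves types.\<close>

lemma coweight_type:
  assumes "v \<in> P"
  obtains w g where "w \<in> W" "g \<in> GG" "transl v = w \<circ> g" "v = w (fv (rot g 0))" "vertex_type R \<alpha> v = rot g 0"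
proof -
  obtain w g where wg: "w \<in> W" "g \<in> GG" "transl v = w \<circ> g" using WE_decomp[OF WE_transl[OF assms]] .
  have "v = transl v 0" by (simp add: transl_def)
  also have "\<dots> = w (fv (rot g 0))" using wg(3) GG_0[OF wg(2)] by simp
  finally have v: "v = w (fv (rot g 0))" .
  moreover have "vertex_type R \<alpha> v = rot g 0" unfolding v
    using vertex_type_eq[OF wg(1) rot(1)[OF wg(2)]] by simp
  ultimately show ?thesis using wg that by blast
qed

lemma good_types_eq: "good_types R \<alpha> = {rot g 0 | g. g \<in> GG}"
proof
  show "good_types R \<alpha> \<subseteq> {rot g 0 | g. g \<in> GG}"
  proof
    fix i assume "i \<in> good_types R \<alpha>"
    then obtain v where "v \<in> P" "i = vertex_type R \<alpha> v" by (auto simp: good_types_def)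
    then show "i \<in> {rot g 0 | g. g \<in> GG}" using coweight_type[of v] by blast
  qed
  show "{rot g 0 | g. g \<in> GG} \<subseteq> good_types R \<alpha>"
  proof clarify
    fix g assume g: "g \<in> GG"
    have "vertex_type R \<alpha> (g 0) = rot g 0"
      using vertex_type_eq[OF W_id rot(1)[OF g, of 0]] GG_0[OF g] by simp
    then show "rot g 0 \<in> good_types R \<alpha>"
      unfolding good_types_def using aff_0_coweight[OF GG_aff[OF g]] by (metis imageI)
  qed
qed

lemma GG_eq_0: "g \<in> GG \<Longrightarrow> h \<in> GG \<Longrightarrow> g 0 = h 0 \<Longrightarrow> g = h"
proof -
  assume g: "g \<in> GG" and h: "h \<in> GG" and e: "g 0 = h 0"
  have "(iv g \<circ> h) 0 = 0" using e[symmetric] by (simp add: aff_inv_app[OF GG_aff[OF g]])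
  moreover have gh: "iv g \<circ> h \<in> GG" using GG_comp GG_inv g h by blast
  ultimately have "iv g \<circ> h \<in> W0" using WE_fix_0 GG_WE by blast
  then have "iv g \<circ> h = id" using GG_W gh W0_W by blast
  then have "g \<circ> (iv g \<circ> h) = g" by simp
  then show ?thesis by (simp add: comp_assoc[symmetric] aff_inv_comp(2)[OF GG_aff[OF g]])
qed

lemma rot_elem_rot:
  assumes g: "g \<in> GG" shows "rot_elem R \<alpha> (rot g 0) = g"
  unfolding rot_elem_def length_zero_group_eq
  using g GG_0[OF g] GG_eq_0 by (intro the_equality) auto

lemma type_rotation_rot:
  assumes g: "g \<in> GG" and i: "i \<in> {..DIM('a)}" shows "type_rotation R \<alpha> (rot g 0) i = rot g i"
  unfolding type_rotation_def rot_elem_rot[OF g] unfolding rot_def ..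

lemma GG_complex:
  assumes g: "g \<in> GG" shows "g ` fv ` {..DIM('a)} = fv ` {..DIM('a)}"
proof -
  have *: "h ` fv ` {..DIM('a)} \<subseteq> fv ` {..DIM('a)}" if "h \<in> GG" for h using GG_fv[OF that] rot(1)[OF that] by auto
  moreover have "g ` (iv g ` fv ` {..DIM('a)}) = fv ` {..DIM('a)}" using inv_image_aff(2)[OF GG_aff[OF g]] by blast
  ultimately show ?thesis using GG_inv[OF g] g by (metis image_mono subset_antisym)
qed

lemma WE_alcove:
  assumes g: "g \<in> WE" and w: "w \<in> W" obtains w' where "w' \<in> W" "g ` w ` fv ` {..DIM('a)} = w' ` fv ` {..DIM('a)}"
proof -
  obtain w' h where wh: "w' \<in> W" "h \<in> GG" "g \<circ> w = w' \<circ> h" using WE_decomp[OF WE_comp[OF g W_WE[OF w]]] .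
  have "g ` w ` fv ` {..DIM('a)} = (g \<circ> w) ` fv ` {..DIM('a)}" by (simp add: image_comp)
  also have "\<dots> = w' ` h ` fv ` {..DIM('a)}" unfolding wh(3) by (simp add: image_comp)
  finally show ?thesis using that wh GG_complex by metis
qed

lemma WE_complex: "g \<in> WE \<Longrightarrow> t \<in> coxeter_complex R \<Longrightarrow> g ` t \<in> coxeter_complex R"
  unfolding coxeter_complex_eq by (auto elim!: WE_alcove) (metis WE_alcove image_mono)

lemma WE_complex_image: assumes g: "g \<in> WE" shows "image g ` coxeter_complex R = coxeter_complex R"
proof
  show "image g ` coxeter_complex R \<subseteq> coxeter_complex R" using WE_complex[OF g] by blast
  show "coxeter_complex R \<subseteq> image g ` coxeter_complex R"
  proof
    fix t assume "t \<in> coxeter_complex R"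
    then have "iv g ` t \<in> coxeter_complex R" using WE_complex WE_inv g by blast
    then show "t \<in> image g ` coxeter_complex R" using inv_image_aff(2)[OF aff_WE[OF g], of t] by (metis imageI)
  qed
qed

section \<open>Inversion sets in the finite Weyl group\<close>

lemma N_through_fixed:
  assumes "w \<in> W" "z \<in> cl" "w z = z" "h \<in> N w" shows "z \<in> h"
proof -
  obtain a k where a: "a \<in> R" "h = hyperplane a k" using N_hyps[OF assms(4)] hyps_cases by metis
  have aw: "aff w" using aff_W assms by blast
  have "(x0 \<bullet> a - of_int k) * (w x0 \<bullet> a - of_int k) < 0"
    using assms(4) unfolding N_def a(2) sep_iff[OF a(1)] .
  moreover have "(x0 \<bullet> a - of_int k) * (z \<bullet> a - of_int k) \<ge> 0" using cl_side[OF assms(2) a(1), of k] by simp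
  moreover have "(w x0 \<bullet> a - of_int k) * (z \<bullet> a - of_int k) \<ge> 0"
    using aff_cl_side[OF aw assms(2) a(1), of k] assms(3) by simp
  ultimately have "z \<bullet> a - real_of_int k = 0" unfolding mult_less_0_iff zero_le_mult_iff by linarith
  then show ?thesis unfolding a(2) by (simp add: hyperplane_def)
qed

lemma N_through_0:
  assumes "w \<in> W0" "h \<in> N w" obtains a where "a \<in> R" "h = hyperplane a 0"
proof -
  obtain a k where a: "a \<in> R" "h = hyperplane a k" using N_hyps[OF assms(2)] hyps_cases by metis
  have "w \<in> W" "w 0 = 0" using assms(1) by (auto simp: weyl_stabilizer_0)
  then have "0 \<in> h" using N_through_fixed fv_cl[of 0] assms(2) by simp
  then have "k = 0" by (simp add: a(2) hyperplane_def)
  then show ?thesis using a that by blast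
qed

text \<open>By \<open>sep_triangle\<close> nothing separates \<open>u x0\<close> from
  \<open>w x0\<close>. Finiteness of \<open>W0\<close> and uniqueness of its longest element
  follow.\<close>

lemma inj_on_N: "inj_on N W"
proof (rule inj_onI)
  fix u w assume uw: "u \<in> W" "w \<in> W" "N u = N w"
  have a: "aff u" "aff w" using aff_W uw by auto
  have "sep (u x0) (w x0) = {}"
    using sep_triangle[OF gen_aff[OF a(1) gen_x0] gen_x0 gen_aff[OF a(2) gen_x0]] uw(3)
    unfolding N_def by (auto simp: sep_sym[of "u x0"])
  then have "N (iv u \<circ> w) = {}"
    using sep_image[OF aff_inv[OF a(1)], of "u x0" "w x0"] aff_inv_app(1)[OF a(1)] by (simp add: N_def)
  then have "iv u \<circ> w = id" using N_empty_id W_comp W_inv uw by blast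
  then have "u \<circ> (iv u \<circ> w) = u" by simp
  moreover have "u \<circ> (iv u \<circ> w) = w" using aff_inv_app(2)[OF a(1)] by auto
  ultimately show "u = w" by simp
qed

lemma finite_W0: "finite W0"
proof (rule inj_on_finite[OF inj_on_subset[OF inj_on_N]])
  show "W0 \<subseteq> W" using W0_W by blast
  show "N ` W0 \<subseteq> Pow ((\<lambda>a. hyperplane a 0) ` R)" using N_through_0 by blast
qed (simp add: finite_roots)

end

section \<open>Distances, galleries and partial isometries in a building\<close>

lemma gallery_append: "gallery adj (is @ js) c d \<longleftrightarrow> (\<exists>e. gallery adj is c e \<and> gallery adj js e d)"
  by (induction "is" arbitrary: c) auto

text \<open>The argument \<open>\<alpha>\<close> only serves to fix the rank.\<close>

definition cotype_residue ::
    "(nat \<Rightarrow> 'a::euclidean_space) \<Rightarrow> (nat \<Rightarrow> ('c \<times> 'c) set) \<Rightarrow> nat \<Rightarrow> 'c \<Rightarrow> 'c set" where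
  "cotype_residue \<alpha> adj i c = residue adj ({..DIM('a)} - {i}) c"

locale regular_affine_building = based_root_system R \<alpha>
  for R :: "'a::euclidean_space set" and \<alpha> :: "nat \<Rightarrow> 'a" +
  fixes C :: "'c set" and adj :: "nat \<Rightarrow> ('c \<times> 'c) set" and \<delta> :: "'c \<Rightarrow> 'c \<Rightarrow> 'a \<Rightarrow> 'a" and q :: "nat \<Rightarrow> nat"
  assumes building: "locally_finite_regular_affine_building R \<alpha> C adj \<delta> q"
begin

lemma adj_equiv: "i \<in> {..DIM('a)} \<Longrightarrow> equiv C (adj i)"
  and panel_nontrivial: "i \<in> {..DIM('a)} \<Longrightarrow> c \<in> C \<Longrightarrow> \<exists>d\<in>C. (c, d) \<in> adj i \<and> d \<noteq> c"
  and dist_W: "c \<in> C \<Longrightarrow> d \<in> C \<Longrightarrow> \<delta> c d \<in> W"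
  and dist_gallery: "reduced_word R \<alpha> is \<Longrightarrow> c \<in> C \<Longrightarrow> d \<in> C \<Longrightarrow> \<delta> c d = wp is \<longleftrightarrow> gallery adj is c d"
  and finite_panel: "i \<in> {..DIM('a)} \<Longrightarrow> c \<in> C \<Longrightarrow> finite (adj i `` {c})"
  and card_panel: "i \<in> {..DIM('a)} \<Longrightarrow> c \<in> C \<Longrightarrow> card {b \<in> C. \<delta> c b = s i} = q i"
  and q_Aut: "\<sigma> \<in> Aut_tr R \<alpha> \<Longrightarrow> i \<in> {..DIM('a)} \<Longrightarrow> q (\<sigma> i) = q i"
  using building unfolding locally_finite_regular_affine_building_def affine_building_def by blast+

lemma adj_C: "i \<in> {..DIM('a)} \<Longrightarrow> (c, d) \<in> adj i \<Longrightarrow> c \<in> C \<and> d \<in> C"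
  using adj_equiv[of i] by (auto simp: equiv_def refl_on_def)

lemma adj_sym: "i \<in> {..DIM('a)} \<Longrightarrow> (c, d) \<in> adj i \<Longrightarrow> (d, c) \<in> adj i"
  using adj_equiv[of i] by (auto simp: equiv_def elim: symE)

lemma adj_trans: "i \<in> {..DIM('a)} \<Longrightarrow> (c, d) \<in> adj i \<Longrightarrow> (d, e) \<in> adj i \<Longrightarrow> (c, e) \<in> adj i"
  using adj_equiv[of i] by (auto simp: equiv_def elim: transE)

lemma aff_dist: "c \<in> C \<Longrightarrow> d \<in> C \<Longrightarrow> aff (\<delta> c d)"
  using dist_W aff_W by blast

lemma reduced_Nil: "reduced_word R \<alpha> []"
  by (simp add: reduced_word_def)

lemma reduced_single: "i \<in> {..DIM('a)} \<Longrightarrow> reduced_word R \<alpha> [i]"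
  by (rule reduced_ConsI[OF _ reduced_Nil]) (auto simp: N_id)

lemma reduced_rev: "reduced_word R \<alpha> is \<Longrightarrow> reduced_word R \<alpha> (rev is)"
  unfolding reduced_word_iff by (metis aff_wp inv_wp len_inv length_rev set_rev)

lemma gallery_rev: "set is \<subseteq> {..DIM('a)} \<Longrightarrow> gallery adj is c d \<Longrightarrow> gallery adj (rev is) d c"
proof (induction "is" arbitrary: c)
  case (Cons i "is")
  then obtain e where "(c, e) \<in> adj i" "c \<noteq> e" "gallery adj is e d" "i \<in> {..DIM('a)}" "set is \<subseteq> {..DIM('a)}" by auto
  then show ?case using Cons.IH adj_sym[of i c e] by (auto simp: gallery_append)
qed simp

lemma dist_eq_id: "c \<in> C \<Longrightarrow> d \<in> C \<Longrightarrow> \<delta> c d = id \<longleftrightarrow> c = d"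
  using dist_gallery[OF reduced_Nil, of c d] by simp

lemma dist_simple: "i \<in> {..DIM('a)} \<Longrightarrow> c \<in> C \<Longrightarrow> d \<in> C \<Longrightarrow> \<delta> c d = s i \<longleftrightarrow> (c, d) \<in> adj i \<and> c \<noteq> d"
  using dist_gallery[OF reduced_single, of i c d] by auto

lemma dist_sym:
  assumes "c \<in> C" "d \<in> C" shows "\<delta> d c = iv (\<delta> c d)"
proof -
  obtain "is" where r: "reduced_word R \<alpha> is" "wp is = \<delta> c d" using W_reduced dist_W assms by metis
  then have "gallery adj (rev is) d c" using gallery_rev dist_gallery assms by (metis reduced_word_iff)
  then have "\<delta> d c = wp (rev is)" using dist_gallery reduced_rev r(1) assms by blast
  then show ?thesis using inv_wp r by (metis reduced_word_iff)
qed

lemma dist_step_up: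
  assumes "i \<in> {..DIM('a)}" "(c', c) \<in> adj i" "c' \<noteq> c" "d \<in> C" "wall i \<notin> N (\<delta> c d)"
  shows "\<delta> c' d = s i \<circ> \<delta> c d"
proof -
  have C: "c \<in> C" "c' \<in> C" using adj_C assms by blast+
  obtain "is" where r: "reduced_word R \<alpha> is" "wp is = \<delta> c d" using W_reduced dist_W assms(4) C by metis
  have "gallery adj (i # is) c' d" using dist_gallery[OF r(1) C(1) assms(4)] r(2) assms(2,3) by auto
  moreover have "reduced_word R \<alpha> (i # is)" using reduced_ConsI assms(1,5) r by simp
  ultimately have "\<delta> c' d = wp (i # is)" using dist_gallery C assms(4) by blast
  then show ?thesis using r(2) by (simp only: wp_Cons)
qed

lemma dist_down:
  assumes "i \<in> {..DIM('a)}" "c \<in> C" "d \<in> C" "wall i \<in> N (\<delta> c d)"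
  obtains c' where "c' \<in> C" "(c, c') \<in> adj i" "c \<noteq> c'" "\<delta> c' d = s i \<circ> \<delta> c d"
proof -
  have aw: "aff (\<delta> c d)" using aff_dist assms by blast
  obtain "is" where r: "reduced_word R \<alpha> is" "wp is = s i \<circ> \<delta> c d"
    using W_reduced W_comp W_simple dist_W assms by metis
  have "wall i \<notin> N (wp is)" using wall_N_simple_comp[OF assms(1) aw] assms(4) r(2) by simp
  then have "reduced_word R \<alpha> (i # is)" using reduced_ConsI assms(1) r(1) by blast
  moreover have "wp (i # is) = \<delta> c d" unfolding wp_Cons r(2) by (rule simple_comp_cancel[OF assms(1)])
  ultimately have "gallery adj (i # is) c d" using dist_gallery assms(2,3) by metis
  then obtain c' where c': "(c, c') \<in> adj i" "c \<noteq> c'" "gallery adj is c' d" by auto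
  then have "c' \<in> C" using adj_C assms(1) by blast
  moreover have "\<delta> c' d = s i \<circ> \<delta> c d" using dist_gallery[OF r(1) \<open>c' \<in> C\<close> assms(3)] c'(3) r(2) by simp
  ultimately show ?thesis using that c' by blast
qed

text \<open>If the wall of type \<open>i\<close> is crossed, some chamber \<open>e\<close> of the
  panel is one step closer to \<open>d\<close>, and every other chamber of the panel is one step
  above \<open>e\<close>.\<close>

lemma dist_step:
  assumes "i \<in> {..DIM('a)}" "(c', c) \<in> adj i" "c' \<noteq> c" "d \<in> C"
  shows "\<delta> c' d = \<delta> c d \<or> \<delta> c' d = s i \<circ> \<delta> c d"
proof (cases "wall i \<in> N (\<delta> c d)")
  case False
  then show ?thesis using dist_step_up assms by blast
next
  case True
  have C: "c \<in> C" "c' \<in> C" using adj_C assms by blast+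
  obtain e where e: "e \<in> C" "(c, e) \<in> adj i" "c \<noteq> e" "\<delta> e d = s i \<circ> \<delta> c d"
    using dist_down[OF assms(1) C(1) assms(4) True] .
  show ?thesis
  proof (cases "c' = e")
    case False
    have "wall i \<notin> N (\<delta> e d)" unfolding e(4) wall_N_simple_comp[OF assms(1) aff_dist[OF C(1) assms(4)]] using True by simp
    then have "\<delta> c' d = s i \<circ> \<delta> e d"
      using dist_step_up[OF assms(1) adj_trans[OF assms(1,2) e(2)] False assms(4)] by blast
    then show ?thesis unfolding e(4) by (simp only: simple_comp_cancel[OF assms(1)] simp_thms)
  qed (use e in blast)
qed

lemma dist_step_right:
  assumes "i \<in> {..DIM('a)}" "(d, d') \<in> adj i" "d \<noteq> d'" "c \<in> C"
  shows "\<delta> c d' = \<delta> c d \<or> \<delta> c d' = \<delta> c d \<circ> s i"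
proof -
  have C: "d \<in> C" "d' \<in> C" using adj_C assms by blast+
  have "\<delta> d' c = \<delta> d c \<or> \<delta> d' c = s i \<circ> \<delta> d c"
    using dist_step[OF assms(1) adj_sym[OF assms(1,2)] _ assms(4)] assms(3) by blast
  then have "\<delta> c d' = iv (\<delta> d c) \<or> \<delta> c d' = iv (s i \<circ> \<delta> d c)" using dist_sym[OF C(2) assms(4)] by metis
  then show ?thesis
    using inv_comp_aff[OF aff_simple[OF assms(1)] aff_dist[OF C(1) assms(4)]] inv_simple[OF assms(1)]
      dist_sym[OF C(1) assms(4)] by simp
qed

text \<open>Each step of the gallery multiplies the distance by its letter or leaves it unchanged.
  The bound on the length later shows that no step is lost along a reduced gallery.\<close>

lemma dist_subword:
  assumes "set is \<subseteq> {..DIM('a)}" "c \<in> C" "e \<in> C" "gallery adj is e d"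
  shows "\<exists>js. set js \<subseteq> set is \<and> length js \<le> length is \<and> \<delta> c d = \<delta> c e \<circ> wp js"
  using assms
proof (induction "is" arbitrary: e)
  case Nil
  then have "\<delta> c d = \<delta> c e \<circ> wp []" by simp
  then show ?case by (metis order_refl)
next
  case (Cons i "is")
  then obtain e1 where e1: "(e, e1) \<in> adj i" "e \<noteq> e1" "gallery adj is e1 d" and i: "i \<in> {..DIM('a)}" "set is \<subseteq> {..DIM('a)}" by auto
  have e1C: "e1 \<in> C" using adj_C i e1 by blast
  obtain js where js: "set js \<subseteq> set is" "length js \<le> length is" "\<delta> c d = \<delta> c e1 \<circ> wp js"
    using Cons.IH[OF i(2) Cons.prems(2) e1C e1(3)] by blast
  consider "\<delta> c e1 = \<delta> c e" | "\<delta> c e1 = \<delta> c e \<circ> s i" using dist_step_right[OF i(1) e1(1,2) Cons.prems(2)] by blast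
  then show ?case
  proof cases
    case 1
    have "set js \<subseteq> set (i # is) \<and> length js \<le> length (i # is) \<and> \<delta> c d = \<delta> c e \<circ> wp js"
      using js unfolding 1 by auto
    then show ?thesis by blast
  next
    case 2
    have "\<delta> c d = \<delta> c e \<circ> wp (i # js)" using js(3) unfolding 2 wp_Cons by (simp only: comp_assoc)
    moreover have "set (i # js) \<subseteq> set (i # is) \<and> length (i # js) \<le> length (i # is)" using js by auto
    ultimately show ?thesis by blast
  qed
qed

section \<open>Residues, spheres of chambers and the parameters\<close>

abbreviation "res \<equiv> cotype_residue \<alpha> adj"

text \<open>The transitive closure becomes a condition on distances: a step of type other than
  \<open>i\<close> keeps the distance in \<open>Wi i\<close>, and an element of \<open>Wi i\<close>
  has a reduced word in the letters of that subgroup.\<close>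

lemma residue_eq:
  assumes "c \<in> C" shows "res i c = {d \<in> C. \<delta> c d \<in> Wi i}"
proof
  let ?r = "\<Union>j\<in>{..DIM('a)} - {i}. adj j"
  show "res i c \<subseteq> {d \<in> C. \<delta> c d \<in> Wi i}"
  proof
    fix d assume "d \<in> res i c"
    then have "(c, d) \<in> ?r\<^sup>*" by (simp add: cotype_residue_def residue_def)
    then show "d \<in> {d \<in> C. \<delta> c d \<in> Wi i}"
    proof (induction rule: rtrancl_induct)
      case base
      have "\<delta> c c = id" using dist_eq_id[OF assms assms] by simp
      then show ?case using assms words_id unfolding parabolic_words by simp
    next
      case (step d e)
      then obtain j where j: "j \<in> {..DIM('a)}" "j \<noteq> i" "(d, e) \<in> adj j" by blast
      then have e: "e \<in> C" using adj_C by blast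
      show ?case
      proof (cases "d = e")
        case False
        have "s j \<in> Wi i" using j words_simple by (simp add: parabolic_words)
        then have "\<delta> c d \<circ> s j \<in> Wi i" using step.IH words_comp by (simp only: parabolic_words mem_Collect_eq)
        then show ?thesis using dist_step_right[OF j(1,3) False assms] step.IH e by auto
      qed (use step.IH in simp)
    qed
  qed
  show "{d \<in> C. \<delta> c d \<in> Wi i} \<subseteq> res i c"
  proof
    fix d assume d: "d \<in> {d \<in> C. \<delta> c d \<in> Wi i}"
    then obtain "is" where "is": "set is \<subseteq> {..DIM('a)} - {i}" "length is = len (\<delta> c d)" "wp is = \<delta> c d"
      using words_reduced[of "\<delta> c d" "{..DIM('a)} - {i}"] by (auto simp: parabolic_words)
    then have sub: "set is \<subseteq> {..DIM('a)}" by blast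
    then have "reduced_word R \<alpha> is" using "is" by (simp add: reduced_word_iff)
    then have "gallery adj is c d" using dist_gallery[of "is" c d] assms d "is"(3) by simp
    then have "(c, d) \<in> ?r\<^sup>*" using "is"(1)
    proof (induction "is" arbitrary: c)
      case (Cons j js)
      then obtain e where e: "(c, e) \<in> adj j" "gallery adj js e d" "j \<in> {..DIM('a)} - {i}" "set js \<subseteq> {..DIM('a)} - {i}" by auto
      then have "(c, e) \<in> ?r" by blast
      then show ?case using Cons.IH[OF e(2,4)] by (rule converse_rtrancl_into_rtrancl)
    qed simp
    then show "d \<in> res i c" by (simp add: cotype_residue_def residue_def)
  qed
qed

lemma res_eq_iff:
  assumes "c \<in> C" "d \<in> C" shows "res i c = res i d \<longleftrightarrow> \<delta> c d \<in> Wi i"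
proof
  assume "res i c = res i d"
  moreover have "d \<in> res i d" by (simp add: cotype_residue_def residue_def)
  ultimately show "\<delta> c d \<in> Wi i" using residue_eq assms by blast
next
  assume *: "\<delta> c d \<in> Wi i"
  then have "\<delta> d c \<in> Wi i" using dist_sym[OF assms] words_inv by (auto simp: parabolic_words)
  then have "d \<in> res i c" "c \<in> res i d" using * residue_eq assms by auto
  then show "res i c = res i d" unfolding cotype_residue_def residue_def by (auto intro: rtrancl_trans)
qed

text \<open>Count by the first chamber of the gallery. Two first chambers serving the same
  \<open>d\<close> would be adjacent of type \<open>i\<close>, and then one would be a step further
  from \<open>d\<close> than the other.\<close>

lemma sphere_card:
  assumes "reduced_word R \<alpha> is" "c \<in> C"
  shows "finite {d \<in> C. \<delta> c d = wp is} \<and> card {d \<in> C. \<delta> c d = wp is} = prod_list (map q is)"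
  using assms
proof (induction "is" arbitrary: c)
  case Nil
  then have "{d \<in> C. \<delta> c d = wp []} = {c}" using dist_eq_id by auto
  then have "finite {d \<in> C. \<delta> c d = wp []} \<and> card {d \<in> C. \<delta> c d = wp []} = prod_list (map q [])"
    by (simp del: wp_Nil)
  then show ?case .
next
  case (Cons i "is")
  note r = reduced_Cons[OF Cons.prems(1)]
  let ?E = "{e \<in> C. \<delta> c e = s i}"
  let ?S = "\<lambda>e. {d \<in> C. \<delta> e d = wp is}"
  have "?E \<subseteq> adj i `` {c}" using dist_simple[OF r(1) Cons.prems(2)] by auto
  then have finE: "finite ?E" using finite_panel[OF r(1) Cons.prems(2)] by (rule finite_subset)
  have "{d \<in> C. \<delta> c d = wp (i # is)} = (\<Union>e\<in>?E. ?S e)"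
  proof (intro equalityI subsetI)
    fix d assume "d \<in> {d \<in> C. \<delta> c d = wp (i # is)}"
    then have d: "d \<in> C" "gallery adj (i # is) c d" using dist_gallery[OF Cons.prems] by auto
    then obtain e where e: "(c, e) \<in> adj i" "c \<noteq> e" "gallery adj is e d" by auto
    then have "e \<in> C" using adj_C r(1) by blast
    then have "e \<in> ?E" "d \<in> ?S e" using e d dist_simple[OF r(1) Cons.prems(2)] dist_gallery[OF r(2)] by auto
    then show "d \<in> (\<Union>e\<in>?E. ?S e)" by blast
  next
    fix d assume "d \<in> (\<Union>e\<in>?E. ?S e)"
    then obtain e where e: "e \<in> C" "(c, e) \<in> adj i" "c \<noteq> e" "d \<in> C" "\<delta> e d = wp is"
      using dist_simple[OF r(1) Cons.prems(2)] by auto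
    then have "gallery adj (i # is) c d" using dist_gallery[OF r(2)] by auto
    then show "d \<in> {d \<in> C. \<delta> c d = wp (i # is)}" using dist_gallery[OF Cons.prems] e by blast
  qed
  moreover have "?S e \<inter> ?S e' = {}" if "e \<in> ?E" "e' \<in> ?E" "e \<noteq> e'" for e e'
  proof (rule ccontr)
    assume "?S e \<inter> ?S e' \<noteq> {}"
    then obtain d where d: "d \<in> C" "\<delta> e d = wp is" "\<delta> e' d = wp is" by blast
    have "(c, e) \<in> adj i" "(c, e') \<in> adj i" using that dist_simple[OF r(1) Cons.prems(2)] by auto
    then have "(e, e') \<in> adj i" using adj_sym adj_trans r(1) by blast
    then have "\<delta> e d = s i \<circ> \<delta> e' d" using dist_step_up[OF r(1) _ that(3) d(1)] d(3) r(3) by simp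
    then have "s i \<circ> wp is = wp is" using d by simp
    then show False using r(3,4) by (simp only: wp_Cons)
  qed
  moreover have fin: "finite (?S e) \<and> card (?S e) = prod_list (map q is)" if "e \<in> ?E" for e
    using Cons.IH[OF r(2)] that by blast
  moreover have "card (\<Union>e\<in>?E. ?S e) = (\<Sum>e\<in>?E. card (?S e))"
    by (rule card_UN_disjoint) (use finE calculation in blast)+
  moreover have "(\<Sum>e\<in>?E. card (?S e)) = q i * prod_list (map q is)"
    using fin card_panel[OF r(1) Cons.prems(2)] by simp
  moreover have "finite (\<Union>e\<in>?E. ?S e)" using finE fin by blast
  ultimately have "finite {d \<in> C. \<delta> c d = wp (i # is)} \<and>
      card {d \<in> C. \<delta> c d = wp (i # is)} = prod_list (map q (i # is))"
    by (simp del: wp_Cons)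
  then show ?case .
qed

abbreviation "qw \<equiv> q_elem R \<alpha> q"

text \<open>All reduced words of \<open>w\<close> count the same set of chambers, so their products
  of parameters agree and the description in \<open>q_elem\<close> is unambiguous.\<close>

lemma q_elem_card:
  assumes "w \<in> W" "c \<in> C" shows "qw w = card {d \<in> C. \<delta> c d = w}" "finite {d \<in> C. \<delta> c d = w}"
proof -
  obtain "is" where r: "reduced_word R \<alpha> is" "wp is = w" using W_reduced assms(1) by metis
  show "finite {d \<in> C. \<delta> c d = w}" using sphere_card[OF r(1) assms(2)] r(2) by simp
  show "qw w = card {d \<in> C. \<delta> c d = w}"
    unfolding q_elem_def
  proof (rule the_equality)
    show "\<exists>is. reduced_word R \<alpha> is \<and> wp is = w \<and> card {d \<in> C. \<delta> c d = w} = prod_list (map q is)"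
      using r sphere_card[OF r(1) assms(2)] by blast
    show "\<And>k. \<exists>is. reduced_word R \<alpha> is \<and> wp is = w \<and> k = prod_list (map q is) \<Longrightarrow> k = card {d \<in> C. \<delta> c d = w}"
      using sphere_card assms(2) by auto
  qed
qed

lemma q_elem_word:
  assumes "reduced_word R \<alpha> is" "C \<noteq> {}" shows "qw (wp is) = prod_list (map q is)"
proof -
  obtain c where "c \<in> C" using assms(2) by blast
  then show ?thesis using sphere_card[OF assms(1)] q_elem_card(1)[of "wp is" c] wp_in_W assms(1)
    by (simp add: reduced_word_iff)
qed

lemma q_elem_comp:
  assumes "C \<noteq> {}" "u \<in> W" "v \<in> W" "\<And>h. h \<in> N u \<Longrightarrow> iv u ` h \<notin> N v"
  shows "qw (u \<circ> v) = qw u * qw v"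
proof -
  obtain us where u: "reduced_word R \<alpha> us" "wp us = u" using W_reduced assms(2) by metis
  obtain vs where v: "reduced_word R \<alpha> vs" "wp vs = v" using W_reduced assms(3) by metis
  have "len (u \<circ> v) = len u + len v" using len_comp_disjoint aff_W assms(2-4) by blast
  then have "reduced_word R \<alpha> (us @ vs)" using u v by (simp add: reduced_word_iff wp_append del: comp_apply)
  then show ?thesis using q_elem_word[OF _ assms(1)] u v by (metis map_append prod_list.append wp_append)
qed

lemma q_elem_id: "C \<noteq> {} \<Longrightarrow> qw id = 1"
  using q_elem_word[OF reduced_Nil] by simp

lemma q_elem_inv: "C \<noteq> {} \<Longrightarrow> w \<in> W \<Longrightarrow> qw (iv w) = qw w"
proof -
  assume C: "C \<noteq> {}" and w: "w \<in> W"
  obtain ws where ws: "reduced_word R \<alpha> ws" "wp ws = w" using W_reduced w by metis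
  have "iv w = wp (rev ws)" using inv_wp ws by (metis reduced_word_iff)
  then show ?thesis using q_elem_word[OF reduced_rev[OF ws(1)] C] q_elem_word[OF ws(1) C] ws(2)
    by (simp add: rev_map[symmetric] prod_mset_prod_list[symmetric])
qed

lemma q_rot: "g \<in> GG \<Longrightarrow> i \<in> {..DIM('a)} \<Longrightarrow> q (rot g i) = q i"
proof -
  assume g: "g \<in> GG" and i: "i \<in> {..DIM('a)}"
  have "type_rotation R \<alpha> (rot g 0) \<in> Aut_tr R \<alpha>" unfolding Aut_tr_def using good_types_eq g by blast
  then show ?thesis using q_Aut[OF _ i] type_rotation_rot[OF g i] by metis
qed

lemma wp_rot:
  assumes g: "g \<in> GG" and "set is \<subseteq> {..DIM('a)}" shows "wp (map (rot g) is) \<circ> g = g \<circ> wp is"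
  using assms(2)
proof (induction "is")
  case Nil
  have "id \<circ> g = g \<circ> id" by simp
  then show ?case by (simp only: list.map wp_Nil)
next
  case (Cons i "is")
  then have "wp (map (rot g) is) \<circ> g = g \<circ> wp is" and i: "i \<in> {..DIM('a)}" unfolding list.set insert_subset by blast+
  then have "s (rot g i) \<circ> wp (map (rot g) is) \<circ> g = g \<circ> (s i \<circ> wp is)"
    using rot_comp_simple[OF g i] by (metis comp_assoc)
  then show ?case by (simp only: list.map wp_Cons)
qed

text \<open>The word transported by \<open>rot g\<close> keeps its length and is therefore reduced,
  and the convention on the parameters gives it the same product.\<close>

lemma q_elem_conj:
  assumes "C \<noteq> {}" "g \<in> GG" "w \<in> W" shows "qw (g \<circ> w \<circ> iv g) = qw w"
proof -
  obtain ws where ws: "reduced_word R \<alpha> ws" "wp ws = w" using W_reduced assms(3) by metis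
  have sub: "set ws \<subseteq> {..DIM('a)}" using ws by (simp add: reduced_word_iff)
  have ag: "aff g" using GG_aff assms by blast
  have e: "g \<circ> w \<circ> iv g = wp (map (rot g) ws)"
    unfolding ws(2)[symmetric] wp_rot[OF assms(2) sub, symmetric] by (simp only: comp_assoc aff_inv_comp(2)[OF ag] comp_id)
  have "len (wp (map (rot g) ws)) = length (map (rot g) ws)"
    using len_conj_GG[OF assms(2) aff_W[OF assms(3)]] ws unfolding e by (simp add: reduced_word_iff)
  moreover have "set (map (rot g) ws) \<subseteq> {..DIM('a)}" using rot(1)[OF assms(2)] sub by auto
  ultimately have "reduced_word R \<alpha> (map (rot g) ws)" unfolding reduced_word_iff by simp
  then have "qw (g \<circ> w \<circ> iv g) = prod_list (map q (map (rot g) ws))" unfolding e using q_elem_word assms(1) by blast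
  also have "map q (map (rot g) ws) = map q ws" using q_rot[OF assms(2)] sub by auto
  finally show ?thesis using q_elem_word[OF ws(1) assms(1)] ws(2) by metis
qed

text \<open>The distances from \<open>c\<close> along the gallery cannot fold, since its type is reduced; they stay
  beyond the wall, so every chamber on the way sees the same first step \<open>c'\<close> from \<open>c\<close>.\<close>

lemma same_projection:
  assumes i: "i \<in> {..DIM('a)}" "(c, c') \<in> adj i" "c \<noteq> c'"
    and "reduced_word R \<alpha> f" "e0 \<in> C" "gallery adj f e0 e" "w \<in> W"
    and "\<delta> c e0 = w" "\<delta> c' e0 = s i \<circ> w" "wall i \<in> N w"
    and "\<delta> c e = w \<circ> wp f" "wall i \<in> N (w \<circ> wp f)"
  shows "\<delta> c' e = s i \<circ> (w \<circ> wp f)"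
  using assms(4-)
proof (induction f arbitrary: e0 w)
  case Nil
  then show ?case by simp
next
  case (Cons j f)
  note r = reduced_Cons[OF Cons.prems(1)]
  have cC: "c \<in> C" "c' \<in> C" using adj_C i by blast+
  have fI: "set f \<subseteq> {..DIM('a)}" using r(2) by (simp add: reduced_word_iff)
  have aw: "aff w" using aff_W Cons.prems(4) by blast
  obtain e1 where e1: "(e0, e1) \<in> adj j" "e0 \<noteq> e1" "gallery adj f e1 e" using Cons.prems(3) by auto
  have e1C: "e1 \<in> C" using adj_C r(1) e1(1) by blast
  \<comment> \<open>If the distance stalled here, the rest of the gallery would express the reduced
    word \<open>j # f\<close> with fewer letters.\<close>
  have d1: "\<delta> c e1 = w \<circ> s j"
  proof (rule ccontr)
    assume "\<delta> c e1 \<noteq> w \<circ> s j"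
    then have "\<delta> c e1 = w" using dist_step_right[OF r(1) e1(1,2) cC(1)] Cons.prems(5) by simp
    then obtain js where js: "set js \<subseteq> set f" "length js \<le> length f" "\<delta> c e = w \<circ> wp js"
      using dist_subword[OF fI cC(1) e1C e1(3)] by metis
    then have "w \<circ> wp js = w \<circ> wp (j # f)" using Cons.prems(8) by metis
    then have "wp js = wp (j # f)" using aff_inv_comp(1)[OF aw] by (metis comp_assoc id_comp)
    moreover have "set js \<subseteq> {..DIM('a)}" using js(1) fI by blast
    ultimately have "length (j # f) \<le> length js" using Cons.prems(1) unfolding reduced_word_def by metis
    then show False using js(2) by simp
  qed
  \<comment> \<open>If this letter crossed the wall, the reduced word \<open>j # f\<close>, which
    crosses \<open>wall j\<close>, would leave the final chamber on the wrong side.\<close>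
  have w1: "wall i \<in> N (w \<circ> s j)"
  proof (rule ccontr)
    assume "wall i \<notin> N (w \<circ> s j)"
    then have "iv w ` wall i = wall j"
      using N_comp[OF aw aff_simple[OF r(1)], of "wall i"] Cons.prems(7) by (simp add: N_simple[OF r(1)])
    moreover have "aff (wp (j # f))" by (rule aff_wp) (use fI r(1) in auto)
    ultimately have "wall i \<notin> N (w \<circ> wp (j # f))"
      using N_comp[OF aw, of "wp (j # f)" "wall i"] Cons.prems(7) r(4) by simp
    then show False using Cons.prems(9) by blast
  qed
  \<comment> \<open>The distance is computed once by moving the target and once by moving the
    source. Failing the claim, it would equal both \<open>s i \<circ> w\<close> and
    \<open>w \<circ> s j\<close>, of which only the second has \<open>wall i\<close> in its
    inversion set.\<close>
  have d2: "\<delta> c' e1 = s i \<circ> (w \<circ> s j)"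
  proof (rule ccontr)
    assume ne: "\<delta> c' e1 \<noteq> s i \<circ> (w \<circ> s j)"
    then have "\<delta> c' e1 = s i \<circ> w"

      using dist_step_right[OF r(1) e1(1,2) cC(2)] unfolding Cons.prems(6) by (simp only: comp_assoc simp_thms)
    moreover have "\<delta> c' e1 = w \<circ> s j"
      using dist_step[OF i(1) adj_sym[OF i(1,2)] _ e1C] ne i(3) d1 by metis
    ultimately have "wall i \<in> N (s i \<circ> w)" using w1 by simp
    then show False using wall_N_simple_comp[OF i(1) aw] Cons.prems(7) by blast
  qed
  have assoc: "w \<circ> wp (j # f) = (w \<circ> s j) \<circ> wp f" by (simp only: wp_Cons comp_assoc)
  have "\<delta> c' e = s i \<circ> ((w \<circ> s j) \<circ> wp f)"
    by (rule Cons.IH[OF r(2) e1C e1(3) W_comp[OF Cons.prems(4) W_simple[OF r(1)]] d1 d2 w1])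
       (use Cons.prems(8,9) in \<open>simp_all only: assoc\<close>)
  then show ?case by (simp only: assoc)
qed

text \<open>A set of pairs, so that unions of chains are immediate. It is single-valued all the
  same, because distance \<open>id\<close> means equality.\<close>

definition partial_isometry :: "(('a \<Rightarrow> 'a) \<times> 'c) set \<Rightarrow> bool" where
  "partial_isometry M \<longleftrightarrow> M \<subseteq> W \<times> C \<and> (\<forall>u c v d. (u, c) \<in> M \<longrightarrow> (v, d) \<in> M \<longrightarrow> \<delta> c d = iv u \<circ> v)"

text \<open>If no chamber of the domain lies beyond the wall of type \<open>i\<close> seen from
  \<open>c\<close>, any neighbour will do. Otherwise take the first step towards one such chamber;
  \<open>same_projection\<close> shows that it is the first step towards all of them.\<close>

lemma isometry_extension_step:
  assumes M: "partial_isometry M" and uc: "(u, c) \<in> M" and i: "i \<in> {..DIM('a)}"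
  shows "\<exists>c'\<in>C. \<forall>v d. (v, d) \<in> M \<longrightarrow> \<delta> c' d = s i \<circ> (iv u \<circ> v)"
proof -
  have uW: "u \<in> W" and cC: "c \<in> C" using M uc by (auto simp: partial_isometry_def)
  have MC: "v \<in> W" "d \<in> C" "\<delta> c d = iv u \<circ> v" if "(v, d) \<in> M" for v d
    using M uc that unfolding partial_isometry_def by blast+
  show ?thesis
  proof (cases "\<exists>v d. (v, d) \<in> M \<and> wall i \<in> N (\<delta> c d)")
    case False
    obtain c' where c': "c' \<in> C" "(c, c') \<in> adj i" "c' \<noteq> c" using panel_nontrivial[OF i cC] by blast
    have "\<delta> c' d = s i \<circ> (iv u \<circ> v)" if "(v, d) \<in> M" for v d
      using dist_step_up[OF i adj_sym[OF i c'(2)] c'(3) MC(2)[OF that]] False that MC(3)[OF that] by metis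
    then show ?thesis using c'(1) by blast
  next
    case True
    then obtain v1 d1 where v1: "(v1, d1) \<in> M" "wall i \<in> N (\<delta> c d1)" by blast
    obtain c' where c': "c' \<in> C" "(c, c') \<in> adj i" "c \<noteq> c'" "\<delta> c' d1 = s i \<circ> \<delta> c d1"
      using dist_down[OF i cC MC(2)[OF v1(1)] v1(2)] .
    have "\<delta> c' d = s i \<circ> (iv u \<circ> v)" if vd: "(v, d) \<in> M" for v d
    proof (cases "wall i \<in> N (\<delta> c d)")
      case False
      then show ?thesis using dist_step_up[OF i adj_sym[OF i c'(2)] _ MC(2)[OF vd]] c'(3) MC(3)[OF vd] by metis
    next
      case True
      have dd: "\<delta> d1 d = iv v1 \<circ> v" using M v1(1) vd unfolding partial_isometry_def by blast
      obtain f where f: "reduced_word R \<alpha> f" "wp f = \<delta> d1 d"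
        using W_reduced dist_W MC(2)[OF v1(1)] MC(2)[OF vd] by metis
      have gal: "gallery adj f d1 d" using dist_gallery[OF f(1) MC(2)[OF v1(1)] MC(2)[OF vd]] f(2) by simp
      have e: "\<delta> c d = \<delta> c d1 \<circ> wp f"
        unfolding f(2) dd MC(3)[OF v1(1)] MC(3)[OF vd] using aff_inv_app(2)[OF aff_W[OF MC(1)[OF v1(1)]]] by auto
      have "\<delta> c' d = s i \<circ> (\<delta> c d1 \<circ> wp f)"
        by (rule same_projection[OF i c'(2,3) f(1) MC(2)[OF v1(1)] gal _ refl c'(4) v1(2) e])
           (use True e dist_W cC MC(2)[OF v1(1)] in auto)
      then show ?thesis using e MC(3)[OF vd] by simp
    qed
    then show ?thesis using c'(1) by blast
  qed
qed

text \<open>A maximal extension has a domain closed under right multiplication by simple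
  reflections, and every element of \<open>W\<close> is reached from \<open>u0\<close> in this
  way.\<close>

lemma isometry_extension:
  assumes M0: "partial_isometry M0" "(u0, c0) \<in> M0"
  shows "\<exists>f. (\<forall>(u, c)\<in>M0. f u = c) \<and> (\<forall>u\<in>W. f u \<in> C) \<and> (\<forall>u\<in>W. \<forall>v\<in>W. \<delta> (f u) (f v) = iv u \<circ> v)"
proof -
  define \<A> where "\<A> = {M. partial_isometry M \<and> M0 \<subseteq> M}"
  have "\<exists>M\<in>\<A>. \<forall>X\<in>\<A>. M \<subseteq> X \<longrightarrow> X = M"
  proof (rule subset_Zorn_nonempty)
    show "\<A> \<noteq> {}" using M0 by (auto simp: \<A>_def)
    fix \<C> assume c: "\<C> \<noteq> {}" "subset.chain \<A> \<C>"
    have sub: "\<And>X. X \<in> \<C> \<Longrightarrow> partial_isometry X \<and> M0 \<subseteq> X" using c(2) by (auto simp: subset.chain_def \<A>_def)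
    have tot: "\<And>X Y. X \<in> \<C> \<Longrightarrow> Y \<in> \<C> \<Longrightarrow> X \<subseteq> Y \<or> Y \<subseteq> X" using c(2) by (auto simp: subset_chain_def)
    have "\<delta> c d = iv u \<circ> v" if "(u, c) \<in> \<Union>\<C>" "(v, d) \<in> \<Union>\<C>" for u c v d
    proof -
      obtain X Y where XY: "X \<in> \<C>" "Y \<in> \<C>" "(u, c) \<in> X" "(v, d) \<in> Y" using \<open>(u, c) \<in> \<Union>\<C>\<close> \<open>(v, d) \<in> \<Union>\<C>\<close> by blast
      then obtain Z where "Z \<in> \<C>" "(u, c) \<in> Z" "(v, d) \<in> Z" using tot[OF XY(1,2)] by blast
      then show ?thesis using sub unfolding partial_isometry_def by blast
    qed
    moreover have "\<Union>\<C> \<subseteq> W \<times> C" using sub unfolding partial_isometry_def by blast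
    moreover have "M0 \<subseteq> \<Union>\<C>" using c(1) sub by blast
    ultimately show "\<Union>\<C> \<in> \<A>" unfolding \<A>_def partial_isometry_def by blast
  qed
  then obtain M where M': "M \<in> \<A>" "\<forall>X\<in>\<A>. M \<subseteq> X \<longrightarrow> X = M" by blast
  then have M: "partial_isometry M" "M0 \<subseteq> M" by (simp_all add: \<A>_def)
  have M_max: "X = M" if "partial_isometry X" "M \<subseteq> X" for X
  proof -
    have "X \<in> \<A>" using that M(2) by (simp add: \<A>_def)
    then show ?thesis using M'(2) that(2) by simp
  qed
  have MM: "\<And>u c v d. (u, c) \<in> M \<Longrightarrow> (v, d) \<in> M \<Longrightarrow> \<delta> c d = iv u \<circ> v" "M \<subseteq> W \<times> C"
    using M(1) unfolding partial_isometry_def by blast+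
  have step: "\<exists>c'. (u \<circ> s i, c') \<in> M" if uc: "(u, c) \<in> M" and i: "i \<in> {..DIM('a)}" for u c i
  proof -
    obtain c' where c': "c' \<in> C" "\<And>v d. (v, d) \<in> M \<Longrightarrow> \<delta> c' d = s i \<circ> (iv u \<circ> v)"
      using isometry_extension_step[OF M(1) uc i] by blast
    have uW: "u \<in> W" using uc MM(2) by blast
    have iu: "iv (u \<circ> s i) = s i \<circ> iv u"
      using inv_comp_aff[OF aff_W[OF uW] aff_simple[OF i]] inv_simple[OF i] by simp
    have wW: "u \<circ> s i \<in> W" using W_comp W_simple uW i by blast
    have d1: "\<delta> c' d = iv (u \<circ> s i) \<circ> v" if "(v, d) \<in> M" for v d
      using c'(2)[OF that] unfolding iu by (simp only: comp_assoc)
    have d2: "\<delta> d c' = iv v \<circ> (u \<circ> s i)" if vd: "(v, d) \<in> M" for v d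
    proof -
      have v: "v \<in> W" "d \<in> C" using vd MM(2) by blast+
      have "\<delta> d c' = iv (iv (u \<circ> s i) \<circ> v)" using dist_sym[OF c'(1) v(2)] d1[OF vd] by simp
      also have "\<dots> = iv v \<circ> (u \<circ> s i)"
        using inv_comp_aff[OF aff_inv[OF aff_W[OF wW]] aff_W[OF v(1)]] inv_inv_aff[OF aff_W[OF wW]] by simp
      finally show ?thesis .
    qed
    have d3: "\<delta> c' c' = iv (u \<circ> s i) \<circ> (u \<circ> s i)"
      using dist_eq_id[OF c'(1) c'(1)] aff_inv_comp(1)[OF aff_W[OF wW]] by simp
    have "partial_isometry (insert (u \<circ> s i, c') M)"
      unfolding partial_isometry_def
    proof (intro conjI allI impI)
      show "insert (u \<circ> s i, c') M \<subseteq> W \<times> C" using wW c'(1) MM(2) by blast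
      fix v d v' d' assume "(v, d) \<in> insert (u \<circ> s i, c') M" "(v', d') \<in> insert (u \<circ> s i, c') M"
      then show "\<delta> d d' = iv v \<circ> v'" using MM(1) d1 d2 d3 by (elim insertE) (simp_all only: prod.inject)
    qed
    then have "insert (u \<circ> s i, c') M = M" using M_max by blast
    then show ?thesis by blast
  qed
  have all: "\<exists>c. (w, c) \<in> M" if w: "w \<in> W" for w
  proof -
    have u0: "(u0, c0) \<in> M" "u0 \<in> W" using M0(2) M(2) MM(2) by blast+
    have "\<exists>c. (u0 \<circ> wp is, c) \<in> M" if "set is \<subseteq> {..DIM('a)}" for "is"
      using that
    proof (induction "is" rule: rev_induct)
      case Nil
      have "(u0 \<circ> id, c0) \<in> M" using u0 by simp
      then show ?case unfolding wp_Nil by blast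
    next
      case (snoc i "is")
      then have "i \<in> {..DIM('a)}" "set is \<subseteq> {..DIM('a)}" by auto
      then obtain c where "(u0 \<circ> wp is, c) \<in> M" using snoc.IH by blast
      then have "\<exists>c. ((u0 \<circ> wp is) \<circ> s i, c) \<in> M" using step \<open>i \<in> {..DIM('a)}\<close> by blast
      moreover have "(u0 \<circ> wp is) \<circ> s i = u0 \<circ> wp (is @ [i])" by (simp only: wp_append wp_Cons wp_Nil comp_id comp_assoc)
      ultimately show ?case by metis
    qed
    moreover obtain "is" where "is": "set is \<subseteq> {..DIM('a)}" "iv u0 \<circ> w = wp is" using W_cases W_comp W_inv u0(2) w by metis
    moreover have "u0 \<circ> wp is = w" unfolding "is"(2)[symmetric] using aff_inv_app(2)[OF aff_W[OF u0(2)]] by auto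
    ultimately show ?thesis by metis
  qed
  have uniq: "c = d" if "(u, c) \<in> M" "(u, d) \<in> M" for u c d
  proof -
    have "u \<in> W" "c \<in> C" "d \<in> C" using that MM(2) by blast+
    then show ?thesis using MM(1)[OF that] dist_eq_id aff_inv_comp(1)[OF aff_W] by metis
  qed
  define f where "f u = (SOME c. (u, c) \<in> M)" for u
  have f: "(u, f u) \<in> M" if "u \<in> W" for u unfolding f_def using someI_ex[OF all[OF that]] .
  have "f u = c" if "(u, c) \<in> M0" for u c
    using f[of u] uniq[of u "f u" c] that M(2) MM(2) by blast
  then show ?thesis using f MM by (intro exI[of _ f]) blast
qed

definition isometry :: "(('a \<Rightarrow> 'a) \<Rightarrow> 'c) \<Rightarrow> bool" where
  "isometry f \<longleftrightarrow> (\<forall>u\<in>W. f u \<in> C) \<and> (\<forall>u\<in>W. \<forall>v\<in>W. \<delta> (f u) (f v) = iv u \<circ> v)"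

lemma isometry_through:
  assumes "c \<in> C" "d \<in> C"
  obtains f where "isometry f" "f id = c" "f (\<delta> c d) = d"
proof -
  have w: "\<delta> c d \<in> W" using dist_W assms by blast
  have "partial_isometry {(id, c), (\<delta> c d, d)}"
    unfolding partial_isometry_def
    using assms w W_id dist_eq_id dist_sym[OF assms] aff_inv_comp(1)[OF aff_W[OF w]] inv_id
    by (auto simp del: comp_apply)
  from isometry_extension[OF this, of id c] obtain f where
    f: "\<forall>(u, c)\<in>{(id, c), (\<delta> c d, d)}. f u = c" "\<forall>u\<in>W. f u \<in> C" "\<forall>u\<in>W. \<forall>v\<in>W. \<delta> (f u) (f v) = iv u \<circ> v"
    by blast
  show ?thesis by (rule that[of f]) (use f in \<open>auto simp: isometry_def\<close>)
qed

end

section \<open>Apartments and spheres of vertices\<close>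

context regular_affine_building
begin

lemma chamber_vertices_eq: "chamber_vertices DIM('a) adj c = (\<lambda>i. (i, res i c)) ` {..DIM('a)}"
  by (auto simp: chamber_vertices_def cotype_residue_def)

lemma building_vertices: "\<Union>(building_complex DIM('a) C adj) = {(i, res i c) | i c. i \<in> {..DIM('a)} \<and> c \<in> C}"
  unfolding building_complex_def chamber_vertices_eq by blast

lemma isometry_C: "isometry f \<Longrightarrow> u \<in> W \<Longrightarrow> f u \<in> C"
  and isometry_dist: "isometry f \<Longrightarrow> u \<in> W \<Longrightarrow> v \<in> W \<Longrightarrow> \<delta> (f u) (f v) = iv u \<circ> v"
  by (auto simp: isometry_def)

text \<open>One direction makes the vertex map of the associated apartment well defined, the other
  makes it injective.\<close>

lemma isometry_res:
  assumes f: "isometry f" and uw: "u \<in> W" "w \<in> W" and i: "i \<in> {..DIM('a)}"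
  shows "res i (f u) = res i (f w) \<longleftrightarrow> u (fv i) = w (fv i)"
proof -
  have au: "aff u" using aff_W uw by blast
  have "res i (f u) = res i (f w) \<longleftrightarrow> iv u \<circ> w \<in> Wi i"
    using res_eq_iff[OF isometry_C[OF f uw(1)] isometry_C[OF f uw(2)]] isometry_dist[OF f uw] by simp
  also have "\<dots> \<longleftrightarrow> iv u (w (fv i)) = fv i"
    using W_comp[OF W_inv[OF uw(1)] uw(2)] by (simp add: parabolic_stabilizer[OF i])
  also have "\<dots> \<longleftrightarrow> u (fv i) = w (fv i)" using aff_inv_app[OF au] by metis
  finally show ?thesis .
qed

lemma apartment_of_isometry:
  assumes f: "isometry f"
  obtains A \<psi> where "subcomplex A (building_complex DIM('a) C adj)" "type_preserving_iso R \<alpha> A \<psi>"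
    "\<And>w i. w \<in> W \<Longrightarrow> i \<in> {..DIM('a)} \<Longrightarrow> (i, res i (f w)) \<in> \<Union>A \<and> \<psi> (i, res i (f w)) = w (fv i)"
proof -
  define A where "A = {t. \<exists>w\<in>W. t \<subseteq> chamber_vertices DIM('a) adj (f w)}"
  define \<psi> where "\<psi> x = (THE p. \<exists>w\<in>W. snd x = res (fst x) (f w) \<and> p = w (fv (fst x)))" for x
  have \<psi>: "\<psi> (i, res i (f w)) = w (fv i)" if "w \<in> W" "i \<in> {..DIM('a)}" for w i
    unfolding \<psi>_def fst_conv snd_conv
    by (rule the_equality) (use isometry_res[OF f] that in blast)+
  have UA: "\<Union>A = {(i, res i (f w)) | i w. i \<in> {..DIM('a)} \<and> w \<in> W}"
    unfolding A_def chamber_vertices_eq by blast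
  have sub: "subcomplex A (building_complex DIM('a) C adj)"
    unfolding subcomplex_def A_def building_complex_def using isometry_C[OF f] by blast
  have img: "\<psi> ` chamber_vertices DIM('a) adj (f w) = w ` fv ` {..DIM('a)}" if "w \<in> W" for w
    unfolding chamber_vertices_eq image_image using \<psi>[OF that] by (intro image_cong) auto
  have "inj_on \<psi> (\<Union>A)"
  proof (rule inj_onI)
    fix x y assume "x \<in> \<Union>A" "y \<in> \<Union>A" and e: "\<psi> x = \<psi> y"
    then obtain i j u w where x: "x = (i, res i (f u))" "i \<in> {..DIM('a)}" "u \<in> W" and y: "y = (j, res j (f w))" "j \<in> {..DIM('a)}" "w \<in> W"
      unfolding UA by blast
    have e': "u (fv i) = w (fv j)" using e \<psi> x y by simp
    then have "i = j" using fv_orbit2 x y by blast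
    then show "x = y" using isometry_res[OF f x(3) y(3) x(2)] e' x y by simp
  qed
  moreover have "\<psi> ` \<Union>A = \<Union>(coxeter_complex R)"
  proof
    show "\<psi> ` \<Union>A \<subseteq> \<Union>(coxeter_complex R)" unfolding UA coxeter_vertices using \<psi> by auto
    show "\<Union>(coxeter_complex R) \<subseteq> \<psi> ` \<Union>A"
    proof
      fix p assume "p \<in> \<Union>(coxeter_complex R)"
      then obtain w i where "w \<in> W" "i \<in> {..DIM('a)}" "p = w (fv i)" unfolding coxeter_vertices by blast
      moreover from this have "(i, res i (f w)) \<in> \<Union>A" unfolding UA by blast
      ultimately show "p \<in> \<psi> ` \<Union>A" using \<psi> by (metis imageI)
    qed
  qed
  moreover have "image \<psi> ` A = coxeter_complex R"
  proof
    show "image \<psi> ` A \<subseteq> coxeter_complex R"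
    proof
      fix t assume "t \<in> image \<psi> ` A"
      then obtain t' w where "w \<in> W" "t' \<subseteq> chamber_vertices DIM('a) adj (f w)" "t = \<psi> ` t'" unfolding A_def by blast
      then have "t \<subseteq> w ` fv ` {..DIM('a)}" using img image_mono by metis
      then show "t \<in> coxeter_complex R" unfolding coxeter_complex_eq using \<open>w \<in> W\<close> by blast
    qed
    show "coxeter_complex R \<subseteq> image \<psi> ` A"
    proof
      fix t assume "t \<in> coxeter_complex R"
      then obtain w where w: "w \<in> W" "t \<subseteq> w ` fv ` {..DIM('a)}" unfolding coxeter_complex_eq by blast
      then obtain t' where "t' \<subseteq> chamber_vertices DIM('a) adj (f w)" "t = \<psi> ` t'"
        unfolding img[OF w(1), symmetric] by (auto elim: subset_imageE)
      then show "t \<in> image \<psi> ` A" using w(1) unfolding A_def by blast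
    qed
  qed
  moreover have "vertex_type R \<alpha> (\<psi> v) = fst v" if "v \<in> \<Union>A" for v
    using that \<psi> vertex_type_eq unfolding UA by auto
  ultimately have tp: "type_preserving_iso R \<alpha> A \<psi>"
    unfolding type_preserving_iso_def simplicial_iso_def bij_betw_def by blast
  have mem: "(i, res i (f w)) \<in> \<Union>A" if "w \<in> W" "i \<in> {..DIM('a)}" for w i using that unfolding UA by blast
  show ?thesis by (rule that[OF sub tp]) (intro conjI mem \<psi>)
qed

text \<open>Choose for each \<open>w\<close> a chamber with vertices over those of the alcove of
  \<open>w\<close>. The chambers of \<open>w\<close> and \<open>w \<circ> s i\<close> share all
  vertices except that of type \<open>i\<close>, so by \<open>fixes_face\<close> they are equal or
  adjacent, and the vertex of type \<open>i\<close> excludes equality. Words thus become galleries,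
  and reduced words give distances.\<close>

lemma isometry_of_apartment:
  assumes sub: "subcomplex A (building_complex DIM('a) C adj)" and iso: "type_preserving_iso R \<alpha> A \<psi>"
  obtains f where "isometry f"
    "\<And>w i. w \<in> W \<Longrightarrow> i \<in> {..DIM('a)} \<Longrightarrow> (i, res i (f w)) \<in> \<Union>A \<and> \<psi> (i, res i (f w)) = w (fv i)"
proof -
  have inj: "inj_on \<psi> (\<Union>A)" and im: "image \<psi> ` A = coxeter_complex R"
    and ty: "\<And>v. v \<in> \<Union>A \<Longrightarrow> vertex_type R \<alpha> (\<psi> v) = fst v"
    using iso unfolding type_preserving_iso_def simplicial_iso_def bij_betw_def by blast+
  have ex: "\<exists>c. c \<in> C \<and> (\<forall>i\<in>{..DIM('a)}. (i, res i c) \<in> \<Union>A \<and> \<psi> (i, res i c) = w (fv i))" if w: "w \<in> W" for w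
  proof -
    have "w ` fv ` {..DIM('a)} \<in> coxeter_complex R" unfolding coxeter_complex_eq using w by blast
    then obtain t where t: "t \<in> A" "w ` fv ` {..DIM('a)} = \<psi> ` t" unfolding im[symmetric] by blast
    then have "t \<in> building_complex DIM('a) C adj" using sub unfolding subcomplex_def by blast
    then obtain c where c: "c \<in> C" "t \<subseteq> (\<lambda>i. (i, res i c)) ` {..DIM('a)}"
      unfolding building_complex_def chamber_vertices_eq by blast
    have cc: "(i, res i c) \<in> \<Union>A \<and> \<psi> (i, res i c) = w (fv i)" if i: "i \<in> {..DIM('a)}" for i
    proof -
      have "w (fv i) \<in> \<psi> ` t" unfolding t(2)[symmetric] using i by blast
      then obtain v where v: "v \<in> t" "\<psi> v = w (fv i)" by fastforce
      have vA: "v \<in> \<Union>A" using v(1) t(1) by blast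
      then have "fst v = i" using ty[OF vA] vertex_type_eq[OF w i] v(2) by simp
      then have "v = (i, res i c)" using v(1) c(2) by auto
      then show ?thesis using v vA by simp
    qed
    show ?thesis by (intro exI[of _ c] conjI[OF c(1)] ballI cc)
  qed
  define f where "f w = (SOME c. c \<in> C \<and> (\<forall>i\<in>{..DIM('a)}. (i, res i c) \<in> \<Union>A \<and> \<psi> (i, res i c) = w (fv i)))" for w
  have f: "f w \<in> C" "\<And>i. i \<in> {..DIM('a)} \<Longrightarrow> (i, res i (f w)) \<in> \<Union>A \<and> \<psi> (i, res i (f w)) = w (fv i)" if "w \<in> W" for w
    using someI_ex[OF ex[OF that], folded f_def] by simp_all
  have adjacent: "(f w, f (w \<circ> s i)) \<in> adj i \<and> f w \<noteq> f (w \<circ> s i)" if w: "w \<in> W" and i: "i \<in> {..DIM('a)}" for w i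
  proof -
    have ws: "w \<circ> s i \<in> W" using W_comp W_simple w i by blast
    let ?d = "\<delta> (f w) (f (w \<circ> s i))"
    have "?d (fv j) = fv j" if j: "j \<in> {..DIM('a)}" "j \<noteq> i" for j
    proof -
      have "(w \<circ> s i) (fv j) = w (fv j)" using simple_fixes_fv[OF j(1) i] j(2) by simp
      then have "\<psi> (j, res j (f w)) = \<psi> (j, res j (f (w \<circ> s i)))" using f(2)[OF w j(1)] f(2)[OF ws j(1)] by simp
      then have "res j (f w) = res j (f (w \<circ> s i))"
        using inj_onD[OF inj] f(2)[OF w j(1)] f(2)[OF ws j(1)] by blast
      then have "?d \<in> Wi j" using res_eq_iff f(1) w ws by blast
      then show ?thesis using parabolic_stabilizer[OF j(1)] by blast
    qed
    then have d: "?d = id \<or> ?d = s i" using fixes_face[OF dist_W[OF f(1)[OF w] f(1)[OF ws]] i] by blast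
    have "?d \<noteq> id"
    proof
      assume "?d = id"
      then have "f w = f (w \<circ> s i)" using dist_eq_id f(1) w ws by blast
      then have "w (fv i) = (w \<circ> s i) (fv i)" using f(2)[OF w i] f(2)[OF ws i] by simp
      then have "fv i = s i (fv i)" using aff_inj[OF aff_W[OF w]] by simp
      then show False using simple_fixes_fv[OF i i] by simp
    qed
    then show ?thesis using d dist_simple[OF i f(1)[OF w] f(1)[OF ws]] by blast
  qed
  have gal: "gallery adj is (f w) (f (w \<circ> wp is))" if "set is \<subseteq> {..DIM('a)}" "w \<in> W" for "is" w
    using that
  proof (induction "is" arbitrary: w)
    case Nil
    have "gallery adj [] (f w) (f (w \<circ> id))" by simp
    then show ?case unfolding wp_Nil .
  next
    case (Cons i "is")
    then have i: "i \<in> {..DIM('a)}" "set is \<subseteq> {..DIM('a)}" by auto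
    have "gallery adj is (f (w \<circ> s i)) (f ((w \<circ> s i) \<circ> wp is))"
      by (rule Cons.IH[OF i(2) W_comp[OF Cons.prems(2) W_simple[OF i(1)]]])
    then have "gallery adj (i # is) (f w) (f ((w \<circ> s i) \<circ> wp is))"
      using adjacent[OF Cons.prems(2) i(1)] by auto
    then show ?case by (simp only: wp_Cons comp_assoc)
  qed
  have "\<delta> (f u) (f v) = iv u \<circ> v" if uv: "u \<in> W" "v \<in> W" for u v
  proof -
    obtain "is" where r: "reduced_word R \<alpha> is" "wp is = iv u \<circ> v" using W_reduced W_comp W_inv uv by metis
    have "u \<circ> wp is = v" unfolding r(2) using aff_inv_app(2)[OF aff_W[OF uv(1)]] by auto
    then have "gallery adj is (f u) (f v)" using gal[OF _ uv(1), of "is"] r(1) by (simp add: reduced_word_iff)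
    then show ?thesis using dist_gallery[OF r(1)] f(1) uv r(2) by metis
  qed
  then have iso_f: "isometry f" unfolding isometry_def using f(1) by blast
  show ?thesis by (rule that[OF iso_f]) (rule f(2))
qed

section \<open>Distances modulo residues, and spheres of vertices\<close>

lemma residue_word:
  assumes "c \<in> C" "d \<in> C" "\<delta> c d \<in> Wi i"
  obtains "is" where "set is \<subseteq> {..DIM('a)} - {i}" "gallery adj is c d"
proof -
  obtain "is" where "is": "set is \<subseteq> {..DIM('a)} - {i}" "length is = len (\<delta> c d)" "wp is = \<delta> c d"
    using words_reduced[of "\<delta> c d" "{..DIM('a)} - {i}"] assms(3) by (auto simp: parabolic_words)
  then have "reduced_word R \<alpha> is" by (auto simp: reduced_word_iff)
  then have "gallery adj is c d" using dist_gallery[of "is" c d] assms "is"(3) by simp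
  then show ?thesis using that "is"(1) by blast
qed

lemma dist_residue_right:
  assumes "b \<in> C" "c \<in> C" "d \<in> C" "\<delta> c d \<in> Wi i"
  obtains p where "p \<in> Wi i" "\<delta> b d = \<delta> b c \<circ> p"
proof -
  obtain "is" where "is": "set is \<subseteq> {..DIM('a)} - {i}" "gallery adj is c d" using residue_word assms(2-4) by blast
  then obtain js where "set js \<subseteq> set is" "\<delta> b d = \<delta> b c \<circ> wp js" using dist_subword[of "is" b c d] assms(1,2) by blast
  moreover from this have "wp js \<in> Wi i" using "is"(1) unfolding parabolic_words words_def by blast
  ultimately show ?thesis using that by blast
qed

lemma parabolic_inv: "i \<in> {..DIM('a)} \<Longrightarrow> p \<in> Wi i \<Longrightarrow> iv p \<in> Wi i"
  unfolding parabolic_words by (rule words_inv) auto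

lemma parabolic_W: "p \<in> Wi i \<Longrightarrow> p \<in> W"
  unfolding parabolic_words using words_subset[of "{..DIM('a)} - {i}"] by blast

lemma dist_residue_left:
  assumes "i \<in> {..DIM('a)}" "b \<in> C" "c \<in> C" "d \<in> C" "\<delta> c d \<in> Wi i"
  obtains p where "p \<in> Wi i" "\<delta> d b = p \<circ> \<delta> c b"
proof -
  obtain p where p: "p \<in> Wi i" "\<delta> b d = \<delta> b c \<circ> p" using dist_residue_right assms(2-5) by metis
  have "\<delta> d b = iv (\<delta> b c \<circ> p)" using dist_sym[OF assms(2,4)] p(2) by simp
  also have "\<dots> = iv p \<circ> iv (\<delta> b c)"
    by (rule inv_comp_aff[OF aff_dist[OF assms(2,3)] aff_W[OF parabolic_W[OF p(1)]]])
  also have "iv (\<delta> b c) = \<delta> c b" using dist_sym[OF assms(2,3)] by simp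
  finally show ?thesis using that parabolic_inv[OF assms(1) p(1)] by blast
qed

abbreviation orbit :: "'a \<Rightarrow> 'a set" where
  "orbit \<mu> \<equiv> {u \<mu> | u. u \<in> W0}"

lemma parabolic_conj:
  assumes "g \<in> GG" "i \<in> {..DIM('a)}" shows "p \<in> Wi (rot g i) \<longleftrightarrow> iv g \<circ> p \<circ> g \<in> Wi i"
proof -
  have ag: "aff g" using GG_aff assms by blast
  have gi: "rot g i \<in> {..DIM('a)}" "g (fv i) = fv (rot g i)" using rot(1) GG_fv assms by blast+
  have "p \<in> W \<longleftrightarrow> iv g \<circ> p \<circ> g \<in> W"
  proof
    assume "p \<in> W"
    then show "iv g \<circ> p \<circ> g \<in> W" using conj_W[OF aff_inv[OF ag]] inv_inv_aff[OF ag] by simp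
  next
    assume "iv g \<circ> p \<circ> g \<in> W"
    then have "g \<circ> (iv g \<circ> p \<circ> g) \<circ> iv g \<in> W" using conj_W[OF ag] by blast
    moreover have "g \<circ> (iv g \<circ> p \<circ> g) \<circ> iv g = p" using aff_inv_app(2)[OF ag] by auto
    ultimately show "p \<in> W" by metis
  qed
  moreover have "p (fv (rot g i)) = fv (rot g i) \<longleftrightarrow> (iv g \<circ> p \<circ> g) (fv i) = fv i"
    unfolding gi(2)[symmetric] using aff_inv_app[OF ag] by (metis comp_apply)
  ultimately show ?thesis unfolding parabolic_stabilizer[OF gi(1)] parabolic_stabilizer[OF assms(2)] by blast
qed

lemma parabolic_rot: "g \<in> GG \<Longrightarrow> i \<in> {..DIM('a)} \<Longrightarrow> Wi (rot g i) = (\<lambda>w. g \<circ> w \<circ> iv g) ` Wi i"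
proof (intro equalityI subsetI)
  fix p assume g: "g \<in> GG" "i \<in> {..DIM('a)}" "p \<in> Wi (rot g i)"
  then have "iv g \<circ> p \<circ> g \<in> Wi i" using parabolic_conj by blast
  moreover have "p = g \<circ> (iv g \<circ> p \<circ> g) \<circ> iv g" using aff_inv_app(2)[OF GG_aff[OF g(1)]] by auto
  ultimately show "p \<in> (\<lambda>w. g \<circ> w \<circ> iv g) ` Wi i" by blast
next
  fix p assume g: "g \<in> GG" "i \<in> {..DIM('a)}" "p \<in> (\<lambda>w. g \<circ> w \<circ> iv g) ` Wi i"
  then obtain w where w: "w \<in> Wi i" "p = g \<circ> w \<circ> iv g" by blast
  have "iv g \<circ> p \<circ> g = w" unfolding w(2) using aff_inv_app(1)[OF GG_aff[OF g(1)]] by auto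
  then show "p \<in> Wi (rot g i)" using parabolic_conj g w(1) by metis
qed

lemma good_type_cases:
  assumes "i \<in> good_types R \<alpha>" obtains g where "g \<in> GG" "i = rot g 0" "g 0 = fv i" "i \<in> {..DIM('a)}"
  using assms GG_0 rot(1)[of _ 0] unfolding good_types_eq by auto

text \<open>\<open>Wi (rot g 0)\<close> is the conjugate of \<open>W0\<close> by \<open>g\<close>.
  The condition describing the sphere is therefore the same for every chamber at
  \<open>x\<close>.\<close>

lemma conj_orbit:
  assumes "g \<in> GG" "p \<in> Wi (rot g 0)" "z \<in> g ` orbit \<mu>" shows "p z \<in> g ` orbit \<mu>"
proof -
  have ag: "aff g" using GG_aff assms by blast
  obtain u where u: "u \<in> W0" "z = g (u \<mu>)" using assms(3) by blast
  have "iv g \<circ> p \<circ> g \<in> W0" using parabolic_conj[OF assms(1), of 0] assms(2) by simp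
  then have "(iv g \<circ> p \<circ> g) \<circ> u \<in> W0" using W0_comp u(1) by blast
  moreover have "p z = g (((iv g \<circ> p \<circ> g) \<circ> u) \<mu>)" using aff_inv_app(2)[OF ag] u(2) by simp
  ultimately show ?thesis by blast
qed

text \<open>The orbit of \<open>g \<mu>\<close> under the conjugate of \<open>W0\<close> by
  \<open>g\<close> lies in one \<open>W\<close>-orbit, so all its vertices have the same
  type.\<close>

lemma orbit_type:
  assumes g: "g \<in> GG" and \<mu>: "\<mu> \<in> P" and w: "w \<in> W" "k \<in> {..DIM('a)}" "w (fv k) \<in> g ` orbit \<mu>"
  shows "vertex_type R \<alpha> (g \<mu>) = k"
proof -
  have ag: "aff g" using GG_aff g by blast
  obtain u where u: "u \<in> W0" "w (fv k) = g (u \<mu>)" using w(3) by blast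
  have iu: "iv u \<in> W" using W_inv W0_W u(1) by blast
  have "(g \<circ> iv u \<circ> iv g) \<circ> w \<in> W" using W_comp conj_W[OF ag iu] w(1) by blast
  moreover have "((g \<circ> iv u \<circ> iv g) \<circ> w) (fv k) = g \<mu>"
    using u(2) aff_inv_app(1)[OF ag] aff_inv_app(1)[OF aff_W[OF W0_W[OF u(1)]]] by simp
  ultimately show ?thesis using vertex_type_eq w(2) by metis
qed

lemma vertex_sphere_eq:
  assumes g: "g \<in> GG" and c0: "c0 \<in> C" and \<mu>: "\<mu> \<in> P" and k: "k = vertex_type R \<alpha> (g \<mu>)" "k \<in> {..DIM('a)}"
  shows "vertex_sphere R \<alpha> C adj \<mu> (rot g 0, res (rot g 0) c0) =
    {(k, res k d) | d. d \<in> C \<and> \<delta> c0 d (fv k) \<in> g ` orbit \<mu>}"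
proof (intro equalityI subsetI)
  let ?i = "rot g 0"
  have i: "?i \<in> {..DIM('a)}" "g 0 = fv ?i" using rot(1)[OF g, of 0] GG_0[OF g] by auto
  have ag: "aff g" using GG_aff g by blast
  {
    fix y assume "y \<in> vertex_sphere R \<alpha> C adj \<mu> (?i, res ?i c0)"
    then obtain A \<psi> where A: "apartment R C adj A" "(?i, res ?i c0) \<in> \<Union>A" "y \<in> \<Union>A"
      "type_rotating_iso R \<alpha> A \<psi>" "\<psi> (?i, res ?i c0) = 0" "\<psi> y = \<mu>"
      unfolding vertex_sphere_def by blast
    have sub: "subcomplex A (building_complex DIM('a) C adj)" using A(1) unfolding apartment_def by blast
    obtain h \<psi>1 where h: "h \<in> WE" "type_preserving_iso R \<alpha> A \<psi>1" "\<forall>v\<in>\<Union>A. \<psi> v = h (\<psi>1 v)"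
      using A(4) unfolding type_rotating_iso_def by blast
    obtain f where f: "isometry f"
      "\<And>w i. w \<in> W \<Longrightarrow> i \<in> {..DIM('a)} \<Longrightarrow> (i, res i (f w)) \<in> \<Union>A \<and> \<psi>1 (i, res i (f w)) = w (fv i)"
      using isometry_of_apartment[OF sub h(2)] by metis
    have bij: "inj_on \<psi>1 (\<Union>A)" "\<psi>1 ` \<Union>A = \<Union>(coxeter_complex R)"
      and ty: "\<And>v. v \<in> \<Union>A \<Longrightarrow> vertex_type R \<alpha> (\<psi>1 v) = fst v"
      using h(2) unfolding type_preserving_iso_def simplicial_iso_def bij_betw_def by blast+
    have vert: "\<exists>w\<in>W. fst v \<in> {..DIM('a)} \<and> v = (fst v, res (fst v) (f w)) \<and> \<psi>1 v = w (fv (fst v))" if v: "v \<in> \<Union>A" for v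
    proof -
      have "\<psi>1 v \<in> \<Union>(coxeter_complex R)" using v bij(2) by blast
      then obtain w j where w: "w \<in> W" "j \<in> {..DIM('a)}" "\<psi>1 v = w (fv j)" unfolding coxeter_vertices by blast
      then have j: "fst v = j" using ty[OF v] vertex_type_eq by metis
      have "v = (j, res j (f w))" using inj_onD[OF bij(1) _ v] f(2)[OF w(1,2)] w(3) by metis
      then show ?thesis using w j by auto
    qed
    obtain u where u: "u \<in> W" "res ?i c0 = res ?i (f u)" "\<psi>1 (?i, res ?i c0) = u (fv ?i)"
      using vert[OF A(2)] by auto
    obtain v where v: "v \<in> W" "fst y \<in> {..DIM('a)}" "y = (fst y, res (fst y) (f v))" "\<psi>1 y = v (fv (fst y))"
      using vert[OF A(3)] by blast
    have ah: "aff h" "aff u" using aff_WE h(1) aff_W u(1) by auto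
    have e0: "h (u (g 0)) = 0" using h(3) A(2,5) u(3) i(2) by auto
    have e1: "h (v (fv (fst y))) = \<mu>" using h(3) A(3,6) v(4) by auto
    \<comment> \<open>In the coordinates of \<open>\<psi>1\<close> the vertex \<open>x\<close> is
      \<open>u (g 0)\<close>, which \<open>h\<close> sends to 0. So this composite is an element of
      the extended group fixing 0, that is, of \<open>W0\<close>.\<close>
    define e where "e = h \<circ> u \<circ> g"
    have "e \<in> WE" unfolding e_def using WE_comp h(1) W_WE[OF u(1)] GG_WE[OF g] by blast
    then have e: "e \<in> W0" using WE_fix_0 e0 by (simp add: e_def)
    have "g (iv e \<mu>) = (iv u \<circ> v) (fv (fst y))"
    proof -
      have "e (iv g (iv u (v (fv (fst y))))) = \<mu>"
        unfolding e_def using aff_inv_app(2)[OF ag] aff_inv_app(2)[OF ah(2)] e1 by simp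
      then have "iv e \<mu> = iv g (iv u (v (fv (fst y))))" using aff_inv_app(1)[OF aff_W[OF W0_W[OF e]]] by metis
      then show ?thesis using aff_inv_app(2)[OF ag] by simp
    qed
    then have m: "\<delta> (f u) (f v) (fv (fst y)) \<in> g ` orbit \<mu>"
      using isometry_dist[OF f(1) u(1) v(1)] W0_inv[OF e] by (metis (mono_tags, lifting) imageI mem_Collect_eq)
    have fC: "f u \<in> C" "f v \<in> C" using isometry_C f(1) u v by auto
    have ky: "fst y = k"
      using orbit_type[OF g \<mu> dist_W[OF fC] v(2) m] k by simp
    \<comment> \<open>\<open>c0\<close> may lie outside the apartment, but it shares the vertex
      \<open>x\<close> with the chamber \<open>f u\<close> of the apartment.\<close>
    have "\<delta> (f u) c0 \<in> Wi ?i" using res_eq_iff[OF fC(1) c0, of ?i] u(2) by simp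
    then obtain p where p: "p \<in> Wi ?i" "\<delta> c0 (f v) = p \<circ> \<delta> (f u) (f v)"
      using dist_residue_left[OF i(1) fC(2) fC(1) c0] by metis
    then have "\<delta> c0 (f v) (fv k) \<in> g ` orbit \<mu>" using conj_orbit[OF g p(1) m] ky by simp
    then show "y \<in> {(k, res k d) | d. d \<in> C \<and> \<delta> c0 d (fv k) \<in> g ` orbit \<mu>}" using v(3) ky fC(2) by auto
  }
  {
    fix y assume "y \<in> {(k, res k d) | d. d \<in> C \<and> \<delta> c0 d (fv k) \<in> g ` orbit \<mu>}"
    then obtain d where d: "d \<in> C" "y = (k, res k d)" "\<delta> c0 d (fv k) \<in> g ` orbit \<mu>" by blast
    then obtain u where u: "u \<in> W0" "\<delta> c0 d (fv k) = g (u \<mu>)" by blast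
    have w: "\<delta> c0 d \<in> W" using dist_W c0 d by blast
    obtain f where f: "isometry f" "f id = c0" "f (\<delta> c0 d) = d" using isometry_through[OF c0 d(1)] .
    obtain A \<psi>1 where A: "subcomplex A (building_complex DIM('a) C adj)" "type_preserving_iso R \<alpha> A \<psi>1"
      "\<And>w i. w \<in> W \<Longrightarrow> i \<in> {..DIM('a)} \<Longrightarrow> (i, res i (f w)) \<in> \<Union>A \<and> \<psi>1 (i, res i (f w)) = w (fv i)"
      using apartment_of_isometry[OF f(1)] by metis
    have xA: "(?i, res ?i c0) \<in> \<Union>A" "\<psi>1 (?i, res ?i c0) = fv ?i" using A(3)[OF W_id i(1)] f(2) by auto
    have yA: "y \<in> \<Union>A" "\<psi>1 y = g (u \<mu>)" using A(3)[OF w k(2)] f(3) d(2) u(2) by auto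
    \<comment> \<open>Sends \<open>g 0\<close>, the position of \<open>x\<close>, to 0 and
      \<open>g (u \<mu>)\<close>, the position of \<open>y\<close>, to \<open>\<mu>\<close>.\<close>
    define h where "h = iv (g \<circ> u)"
    have guE: "g \<circ> u \<in> WE" using WE_comp GG_WE[OF g] W0_WE[OF u(1)] by blast
    have hE: "h \<in> WE" unfolding h_def using WE_inv guE by blast
    have hinv: "h (g (u z)) = z" for z unfolding h_def using aff_inv_app(1)[OF aff_WE[OF guE], of z] by simp
    define \<psi> where "\<psi> = h \<circ> \<psi>1"
    have iso1: "simplicial_iso \<psi>1 A (coxeter_complex R)" using A(2) unfolding type_preserving_iso_def by blast
    have hb: "bij_betw h (\<Union>(coxeter_complex R)) (\<Union>(coxeter_complex R))"
    proof -
      have "h ` \<Union>(coxeter_complex R) = \<Union>(image h ` coxeter_complex R)" by blast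
      also have "\<dots> = \<Union>(coxeter_complex R)" using WE_complex_image[OF hE] by simp
      finally show ?thesis using aff_bij[OF aff_WE[OF hE]] unfolding bij_betw_def by (metis inj_on_subset subset_UNIV)
    qed
    have "image \<psi> ` A = image h ` image \<psi>1 ` A" unfolding \<psi>_def by (simp add: image_image image_comp)
    also have "\<dots> = coxeter_complex R" using iso1 WE_complex_image[OF hE] unfolding simplicial_iso_def by simp
    finally have "simplicial_iso \<psi> A (coxeter_complex R)"
      using iso1 hb unfolding simplicial_iso_def \<psi>_def by (blast intro: bij_betw_trans)
    then have rot_iso: "type_rotating_iso R \<alpha> A \<psi>"
      unfolding type_rotating_iso_def using hE A(2) by (auto simp: \<psi>_def)
    have "\<psi> (?i, res ?i c0) = 0"
      using hinv[of 0] xA(2) i(2) u(1) by (simp add: \<psi>_def weyl_stabilizer_0)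
    moreover have "\<psi> y = \<mu>" using hinv yA(2) by (simp add: \<psi>_def)
    moreover have "apartment R C adj A" unfolding apartment_def using A(1) iso1 by blast
    moreover have "y \<in> good_vertices R \<alpha> C adj"
      unfolding good_vertices_def building_vertices using d(1,2) k aff_coweight[OF ag \<mu>]
      by (auto simp: good_types_def)
    ultimately show "y \<in> vertex_sphere R \<alpha> C adj \<mu> (?i, res ?i c0)"
      unfolding vertex_sphere_def using xA(1) yA(1) rot_iso by blast
  }
qed

section \<open>Counting chambers at the vertices of a sphere\<close>

lemma finite_parabolic: "g \<in> GG \<Longrightarrow> finite (Wi (rot g 0))"
  using parabolic_rot[of g 0] finite_W0 by simp

lemma inj_conj: "aff g \<Longrightarrow> inj (\<lambda>w. g \<circ> w \<circ> iv g)"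
proof (rule injI)
  fix u w assume g: "aff g" and "g \<circ> u \<circ> iv g = g \<circ> w \<circ> iv g"
  then have "iv g \<circ> (g \<circ> u \<circ> iv g) \<circ> g = iv g \<circ> (g \<circ> w \<circ> iv g) \<circ> g" by simp
  moreover have "iv g \<circ> (g \<circ> u \<circ> iv g) \<circ> g = u" for u using aff_inv_app[OF g] by auto
  ultimately show "u = w" by metis
qed

text \<open>The stabiliser of a vertex of good type is conjugate to \<open>W0\<close> by a length
  zero element, so the number of chambers at a good vertex is the same for all good types.\<close>

lemma q_sum_parabolic:
  assumes "C \<noteq> {}" "g \<in> GG" shows "(\<Sum>w\<in>Wi (rot g 0). qw w) = q_sum R \<alpha> q W0"
proof -
  have ag: "aff g" using GG_aff assms(2) by blast
  have "inj_on (\<lambda>w. g \<circ> w \<circ> iv g) W0" by (rule inj_on_subset[OF inj_conj[OF ag]]) simp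
  then have "(\<Sum>w\<in>Wi (rot g 0). qw w) = (\<Sum>w\<in>W0. qw (g \<circ> w \<circ> iv g))"
    using parabolic_rot[OF assms(2), of 0] by (simp add: sum.reindex)
  also have "\<dots> = (\<Sum>w\<in>W0. qw w)" by (rule sum.cong) (use q_elem_conj assms W0_W in auto)
  finally show ?thesis by (simp add: q_sum_def)
qed

lemma card_dist_set:
  assumes "c \<in> C" "finite U" "U \<subseteq> W"
  shows "finite {d \<in> C. \<delta> c d \<in> U} \<and> card {d \<in> C. \<delta> c d \<in> U} = (\<Sum>w\<in>U. qw w)"
proof -
  have e: "{d \<in> C. \<delta> c d \<in> U} = (\<Union>w\<in>U. {d \<in> C. \<delta> c d = w})" by auto
  have f: "\<forall>w\<in>U. finite {d \<in> C. \<delta> c d = w}" using q_elem_card(2) assms by blast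
  have "card (\<Union>w\<in>U. {d \<in> C. \<delta> c d = w}) = (\<Sum>w\<in>U. card {d \<in> C. \<delta> c d = w})"
    by (rule card_UN_disjoint) (use assms f in auto)
  also have "\<dots> = (\<Sum>w\<in>U. qw w)" by (rule sum.cong) (use q_elem_card(1) assms in auto)
  finally show ?thesis unfolding e using f assms(2) by blast
qed

text \<open>The double coset of \<open>W0\<close> and \<open>Wi k\<close> through any of its
  elements (\<open>double_coset_orbit\<close>), described by the action on one vertex and hence free
  of a chosen representative.\<close>

definition orbit_coset :: "'a \<Rightarrow> nat \<Rightarrow> ('a \<Rightarrow> 'a) set" where
  "orbit_coset \<mu> k = {w \<in> W. w (fv k) \<in> orbit \<mu>}"

lemma double_coset_orbit:
  assumes "k \<in> {..DIM('a)}" "w \<in> W" "w (fv k) \<in> orbit \<mu>"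
  shows "double_coset W0 w (Wi k) = orbit_coset \<mu> k"
proof (intro equalityI subsetI)
  obtain u0 where u0: "u0 \<in> W0" "w (fv k) = u0 \<mu>" using assms(3) by blast
  {
    fix v assume "v \<in> double_coset W0 w (Wi k)"
    then obtain u p where up: "u \<in> W0" "p \<in> Wi k" "v = u \<circ> w \<circ> p" unfolding double_coset_def by blast
    have "v \<in> W" using up W_comp W0_W parabolic_W assms(2) by blast
    moreover have "p (fv k) = fv k" using up(2) parabolic_stabilizer[OF assms(1)] by blast
    then have "v (fv k) = (u \<circ> u0) \<mu>" using up(3) u0(2) by simp
    ultimately show "v \<in> orbit_coset \<mu> k" unfolding orbit_coset_def using W0_comp[OF up(1) u0(1)] by blast
  }
  {
    fix v assume "v \<in> orbit_coset \<mu> k"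
    then obtain u where v: "v \<in> W" "u \<in> W0" "v (fv k) = u \<mu>" unfolding orbit_coset_def by blast
    define x where "x = u \<circ> iv u0"
    have x: "x \<in> W0" unfolding x_def using W0_comp W0_inv v(2) u0(1) by blast
    have au: "aff u0" "aff x" "aff w" using aff_W W0_W u0(1) x assms(2) by auto
    define p where "p = iv (x \<circ> w) \<circ> v"
    have axw: "aff (x \<circ> w)" using aff_comp au by blast
    have pW: "p \<in> W" unfolding p_def using W_comp W_inv W0_W[OF x] assms(2) v(1) by blast
    have "(x \<circ> w) (fv k) = v (fv k)" unfolding x_def using u0(2) v(3) aff_inv_app(1)[OF au(1)] by simp
    then have "p (fv k) = fv k" unfolding p_def using aff_inv_app(1)[OF axw, of "fv k"] by simp
    then have p: "p \<in> Wi k" using pW parabolic_stabilizer[OF assms(1)] by blast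
    have "v = x \<circ> w \<circ> p" unfolding p_def using aff_inv_app(2)[OF axw] by (auto simp: fun_eq_iff)
    then show "v \<in> double_coset W0 w (Wi k)" unfolding double_coset_def using x p by blast
  }
qed

text \<open>Stated for all coweights because it serves both \<open>lam\<close> and its dual, and in
  product form so that the count stays in the natural numbers.\<close>

lemma vertex_sphere_card:
  assumes x: "x \<in> good_vertices R \<alpha> C adj" and \<mu>: "\<mu> \<in> P"
  shows "card (vertex_sphere R \<alpha> C adj \<mu> x) * q_sum R \<alpha> q W0 =
    (\<Sum>w\<in>orbit_coset \<mu> (vertex_type R \<alpha> \<mu>). qw w)"
proof -
  obtain i c0 where x': "x = (i, res i c0)" "c0 \<in> C" "i \<in> good_types R \<alpha>"
    using x unfolding good_vertices_def building_vertices by auto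
  obtain g where g: "g \<in> GG" "i = rot g 0" using good_type_cases[OF x'(3)] by metis
  have ag: "aff g" using GG_aff g by blast
  have Cne: "C \<noteq> {}" using x' by blast
  obtain w1 g1 where w1: "w1 \<in> W" "g1 \<in> GG" "\<mu> = w1 (fv (rot g1 0))" "vertex_type R \<alpha> \<mu> = rot g1 0"
    using coweight_type[OF \<mu>] by metis
  define l where "l = vertex_type R \<alpha> \<mu>"
  have l: "l \<in> {..DIM('a)}" "\<mu> = w1 (fv l)" "l = rot g1 0" using w1 rot(1)[OF w1(2), of 0] by (auto simp: l_def)
  define k where "k = vertex_type R \<alpha> (g \<mu>)"
  have "g \<mu> = (g \<circ> w1 \<circ> iv g) (fv (rot g l))"
    using GG_fv[OF g(1) l(1), symmetric] l(2) aff_inv_app(1)[OF ag] by simp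
  then have kl: "k = rot g l" unfolding k_def
    using vertex_type_eq[OF conj_W[OF ag w1(1)] rot(1)[OF g(1) l(1)]] by metis
  have kI: "k \<in> {..DIM('a)}" using rot(1) g l kl by simp
  have gl: "g (fv l) = fv k" using GG_fv[OF g(1) l(1)] kl by simp
  have "fv k = (g \<circ> g1) 0" using gl l(3) GG_0[OF w1(2)] by simp
  then have kk: "k = rot (g \<circ> g1) 0"
    using GG_0[OF GG_comp[OF g(1) w1(2)]] fv_orbit[OF W_id kI rot(1)[OF GG_comp[OF g(1) w1(2)]], of 0] by simp
  have gg1: "g \<circ> g1 \<in> GG" using GG_comp g w1 by blast
  define D where "D = orbit_coset \<mu> l"
  have "\<mu> \<in> orbit \<mu>" using W0_id by (metis (mono_tags, lifting) id_apply mem_Collect_eq)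
  then have "D = double_coset W0 w1 (Wi l)" unfolding D_def using double_coset_orbit[OF l(1) w1(1)] l(2) by simp
  also have "\<dots> = (\<lambda>(u, p). u \<circ> w1 \<circ> p) ` (W0 \<times> Wi l)" unfolding double_coset_def by auto
  finally have finD: "finite D" using finite_W0 finite_parabolic[OF w1(2)] l(3) by simp
  have DW: "D \<subseteq> W" by (auto simp: D_def orbit_coset_def)
  \<comment> \<open>The distances from \<open>c0\<close> to chambers at the vertices of the sphere:
    around a vertex of type \<open>rot g 0\<close> they are the conjugates by \<open>g\<close> of
    the elements of \<open>D\<close>.\<close>
  define D' where "D' = (\<lambda>w. g \<circ> w \<circ> iv g) ` D"
  have D'_iff: "w \<in> D' \<longleftrightarrow> w (fv k) \<in> g ` orbit \<mu>" if w: "w \<in> W" for w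
  proof
    assume "w \<in> D'"
    then obtain v where v: "v \<in> D" "w = g \<circ> v \<circ> iv g" unfolding D'_def by blast
    have "w (fv k) = g (v (fv l))" unfolding v(2) gl[symmetric] using aff_inv_app(1)[OF ag] by simp
    then show "w (fv k) \<in> g ` orbit \<mu>" using v(1) unfolding D_def orbit_coset_def by blast
  next
    assume "w (fv k) \<in> g ` orbit \<mu>"
    then obtain z where z: "z \<in> orbit \<mu>" "w (fv k) = g z" by blast
    define v where "v = iv g \<circ> w \<circ> g"
    have vW: "v \<in> W" using conj_W[OF aff_inv[OF ag] w] inv_inv_aff[OF ag] by (simp add: v_def)
    have "v (fv l) = z" unfolding v_def using gl z(2) aff_inv_app(1)[OF ag] by simp
    then have "v \<in> D" using vW z(1) by (simp add: D_def orbit_coset_def)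
    moreover have "w = g \<circ> v \<circ> iv g" unfolding v_def using aff_inv_app(2)[OF ag] by auto
    ultimately show "w \<in> D'" unfolding D'_def by blast
  qed
  have D'W: "D' \<subseteq> W" unfolding D'_def using conj_W[OF ag] DW by blast
  have finD': "finite D'" using finD by (simp add: D'_def)
  have "inj_on (\<lambda>w. g \<circ> w \<circ> iv g) D" by (rule inj_on_subset[OF inj_conj[OF ag]]) simp
  then have "(\<Sum>w\<in>D'. qw w) = (\<Sum>w\<in>D. qw (g \<circ> w \<circ> iv g))" unfolding D'_def by (simp add: sum.reindex)
  also have "\<dots> = (\<Sum>w\<in>D. qw w)" by (rule sum.cong) (use q_elem_conj[OF Cne g(1)] DW in auto)
  finally have sumD: "(\<Sum>w\<in>D'. qw w) = (\<Sum>w\<in>D. qw w)" .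
  define S where "S = {d \<in> C. \<delta> c0 d \<in> D'}"
  have S: "finite S" "card S = (\<Sum>w\<in>D'. qw w)" using card_dist_set[OF x'(2) finD' D'W] by (auto simp: S_def)
  define V where "V = vertex_sphere R \<alpha> C adj \<mu> x"
  have "V = {(k, res k d) | d. d \<in> C \<and> \<delta> c0 d (fv k) \<in> g ` orbit \<mu>}"
    unfolding V_def x'(1) g(2) by (rule vertex_sphere_eq[OF g(1) x'(2) \<mu> k_def kI])
  also have "\<dots> = (\<lambda>d. (k, res k d)) ` S"
    unfolding S_def using D'_iff[OF dist_W[OF x'(2)]] by blast
  finally have V: "V = (\<lambda>d. (k, res k d)) ` S" .
  \<comment> \<open>The chambers of \<open>S\<close> at one vertex form a full residue, whose size
    is the q-sum of a conjugate of \<open>W0\<close>.\<close>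
  have fiber: "card {e \<in> S. (k, res k e) = y} = q_sum R \<alpha> q W0" if "y \<in> V" for y
  proof -
    obtain d where d: "d \<in> S" "y = (k, res k d)" using \<open>y \<in> V\<close> V by blast
    have dC: "d \<in> C" using d by (simp add: S_def)
    have "{e \<in> S. (k, res k e) = y} = {e \<in> C. \<delta> d e \<in> Wi k}"
    proof (intro equalityI subsetI)
      fix e assume "e \<in> {e \<in> S. (k, res k e) = y}"
      then show "e \<in> {e \<in> C. \<delta> d e \<in> Wi k}" using res_eq_iff[OF dC, of e k] d(2) by (auto simp: S_def)
    next
      fix e assume "e \<in> {e \<in> C. \<delta> d e \<in> Wi k}"
      then have e: "e \<in> C" "\<delta> d e \<in> Wi k" by auto
      obtain p where p: "p \<in> Wi k" "\<delta> c0 e = \<delta> c0 d \<circ> p" using dist_residue_right[OF x'(2) dC e] by metis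
      have "p (fv k) = fv k" using p(1) parabolic_stabilizer[OF kI] by blast
      then have "\<delta> c0 e (fv k) = \<delta> c0 d (fv k)" using p(2) by simp
      moreover have "\<delta> c0 d (fv k) \<in> g ` orbit \<mu>" using d(1) D'_iff[OF dist_W[OF x'(2) dC]] by (simp add: S_def)
      ultimately have "\<delta> c0 e \<in> D'" using D'_iff[OF dist_W[OF x'(2) e(1)]] by simp
      then show "e \<in> {e \<in> S. (k, res k e) = y}" using e res_eq_iff[OF dC e(1), of k] d(2) by (simp add: S_def)
    qed
    moreover have "Wi k \<subseteq> W" using parabolic_W by blast
    ultimately have "card {e \<in> S. (k, res k e) = y} = (\<Sum>w\<in>Wi k. qw w)"
      using card_dist_set[OF dC finite_parabolic[OF gg1]] kk by simp
    then show ?thesis using q_sum_parabolic[OF Cne gg1] kk by simp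
  qed
  have "card S = (\<Sum>e\<in>S. 1)" by simp
  also have "\<dots> = (\<Sum>y\<in>(\<lambda>d. (k, res k d)) ` S. \<Sum>e\<in>{e \<in> S. (k, res k e) = y}. 1)"
    by (rule sum.image_gen[OF S(1)])
  also have "\<dots> = (\<Sum>y\<in>V. q_sum R \<alpha> q W0)" unfolding V[symmetric] by (rule sum.cong) (use fiber in auto)
  also have "\<dots> = card V * q_sum R \<alpha> q W0" by simp
  finally show ?thesis using S(2) sumD by (simp add: V_def D_def l_def)
qed

end

section \<open>Minimal coset representatives\<close>

context based_root_system
begin

lemma refl_len_less:
  assumes "w \<in> W" "a \<in> R" "hyperplane a k \<in> N w" shows "len (affine_refl a k \<circ> w) < len w"
proof -
  obtain "is" where r: "reduced_word R \<alpha> is" "wp is = w" using W_reduced assms(1) by metis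
  obtain js where js: "set js \<subseteq> set is" "Suc (length js) = length is" "wp js = affine_refl a k \<circ> w"
    using strong_exchange[of "is" a k] r assms(2,3) by (auto simp: reduced_word_iff)
  have "set js \<subseteq> {..DIM('a)}" using js(1) r(1) by (auto simp: reduced_word_iff)
  then have "len (affine_refl a k \<circ> w) \<le> length js" using len_wp_le js(3) by metis
  also have "length js < len w" using js(2) r by (simp add: reduced_word_iff)
  finally show ?thesis .
qed

text \<open>The definite description needs uniqueness. If no simple reflection lengthens
  \<open>w\<close>, then \<open>iv w x0\<close> is negative on all simple roots, so the inverse
  crosses every hyperplane through 0; \<open>inj_on_N\<close> finishes. Membership places the dual
  coweight in the \<open>W0\<close>-orbit of the negative of \<open>lam\<close>.\<close>

lemma longest_weyl_mem: "longest_weyl R \<alpha> \<in> W0"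
proof -
  let ?P = "\<lambda>w. is_arg_max (weyl_length R \<alpha>) (\<lambda>w. w \<in> W0) w"
  have wl: "weyl_length R \<alpha> w = len w" if "w \<in> W0" for w
    using weyl_length_eq aff_W W0_W that by blast
  have all: "N (iv w) = {h. \<exists>a\<in>R. h = hyperplane a 0}" if "?P w" for w
  proof -
    have w: "w \<in> W0" "\<And>y. y \<in> W0 \<Longrightarrow> len y \<le> len w"
      using that wl unfolding is_arg_max_def by (auto simp: not_less)
    have aw: "aff w" using aff_W W0_W w(1) by blast
    \<comment> \<open>By maximality \<open>w \<circ> s i\<close> is no longer than \<open>w\<close>;
      read on the inverse, this says that \<open>wall i\<close> is crossed.\<close>
    have neg: "iv w x0 \<bullet> \<alpha> i < 0" if i: "i \<in> {1..DIM('a)}" for i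
    proof -
      have iI: "i \<in> {..DIM('a)}" using i by simp
      have "s i \<in> W0" using words_simple[of i "{..DIM('a)} - {0}"] i by (simp add: parabolic_words)
      then have "len (w \<circ> s i) \<le> len w" using w W0_comp by blast
      then have "len (s i \<circ> iv w) \<le> len (iv w)" using len_comp_simple[OF iI aw] len_inv[OF aw] by simp
      then have "wall i \<in> N (iv w)" using len_simple_comp_up[OF iI aff_inv[OF aw]] by fastforce
      then have "(x0 \<bullet> \<alpha> i - of_int 0) * (iv w x0 \<bullet> \<alpha> i - of_int 0) < 0"
        using i sep_iff[OF simple_root[OF i], of 0 x0 "iv w x0"] by (simp add: N_def wall_def)
      moreover have "x0 \<bullet> \<alpha> i > 0" using x0 i by (simp add: fund_alcove_def)
      ultimately show ?thesis by (simp add: mult_less_0_iff)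
    qed
    have mem: "hyperplane a 0 \<in> N (iv w)" if a: "a \<in> R" for a
    proof -
      obtain b m where b: "b \<in> R" "pos b" "hyperplane a 0 = hyperplane b m"
        using hyps_pos_cases[OF hyperplane_in_hyps[OF a, of 0]] by metis
      have "0 \<in> hyperplane b m" unfolding b(3)[symmetric] by (simp add: hyperplane_def)
      then have m: "m = 0" by (simp add: hyperplane_def)
      have "0 < (- iv w x0) \<bullet> b" by (rule pos_strict[OF _ b(1,2)]) (use neg in simp)
      moreover have "0 < x0 \<bullet> b" using alcove_pos[OF x0 b(1,2)] by simp
      ultimately show ?thesis unfolding b(3) m N_def sep_iff[OF b(1)] by (simp add: mult_less_0_iff)
    qed
    have "\<exists>a\<in>R. h = hyperplane a 0" if "h \<in> N (iv w)" for h
      using N_through_0[OF W0_inv[OF w(1)] that] by blast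
    then show ?thesis using mem by blast
  qed
  have "\<exists>!w. ?P w"
  proof (rule ex_ex1I)
    have "\<exists>w. is_arg_min (\<lambda>w. - int (len w)) (\<lambda>w. w \<in> W0) w"
      using ex_is_arg_min_if_finite[OF finite_W0, of "\<lambda>w. - int (len w)"] W0_id by blast
    then show "\<exists>w. ?P w" unfolding is_arg_min_def is_arg_max_def using wl by fastforce
    fix w w' assume ww: "?P w" "?P w'"
    then have W0: "w \<in> W0" "w' \<in> W0" by (auto simp: is_arg_max_def)
    have "iv w = iv w'" using all[OF ww(1)] all[OF ww(2)] inj_onD[OF inj_on_N] W_inv W0_W W0 by metis
    then show "w = w'" using inv_inv_aff aff_W W0_W W0 by metis
  qed
  from theI'[OF this] show ?thesis unfolding longest_weyl_def is_arg_max_def by blast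
qed

lemma dominant:
  assumes "v \<in> dominant_coweights \<alpha>" shows "v \<in> P" "i \<in> {1..DIM('a)} \<Longrightarrow> v \<bullet> \<alpha> i \<ge> 0"
proof -
  obtain a :: "nat \<Rightarrow> nat" where a: "v = (\<Sum>i=1..DIM('a). of_nat (a i) *\<^sub>R \<omega> i)"
    using assms unfolding dominant_coweights_def by blast
  then have "v = (\<Sum>i=1..DIM('a). of_int (int (a i)) *\<^sub>R \<omega> i)" by simp
  then show "v \<in> P" unfolding coweight_lattice_def by (intro CollectI exI[of _ "\<lambda>i. int (a i)"])
  assume i: "i \<in> {1..DIM('a)}"
  have "v \<bullet> \<alpha> i = (\<Sum>j\<in>{1..DIM('a)}. if j = i then real (a i) else 0)"
    unfolding a inner_sum_left by (rule sum.cong) (use i in \<open>auto simp: fund_coweight_inner\<close>)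
  then show "v \<bullet> \<alpha> i \<ge> 0" by simp
qed

lemma transl_affine_part:
  assumes "v \<in> P"
  shows "transl_affine_part R \<alpha> v \<in> W" "transl_affine_part R \<alpha> v (fv (vertex_type R \<alpha> v)) = v"
proof -
  obtain w g where wg: "w \<in> W" "g \<in> GG" "transl v = w \<circ> g" "v = w (fv (rot g 0))" "vertex_type R \<alpha> v = rot g 0"
    using coweight_type[OF assms] .
  have "transl_affine_part R \<alpha> v = w"
    unfolding transl_affine_part_def length_zero_group_eq
  proof (rule the_equality)
    show "w \<in> W \<and> (\<exists>g\<in>GG. transl v = w \<circ> g)" using wg by blast
    fix w' assume "w' \<in> W \<and> (\<exists>g\<in>GG. transl v = w' \<circ> g)"
    then obtain g' where g': "w' \<in> W" "g' \<in> GG" "transl v = w' \<circ> g'" by blast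
    have "w' \<circ> g' = w \<circ> g" using g'(3) wg(3) by simp
    then show "w' = w" using decomp_unique[OF g'(1,2) wg(1,2)] by blast
  qed
  then show "transl_affine_part R \<alpha> v \<in> W" "transl_affine_part R \<alpha> v (fv (vertex_type R \<alpha> v)) = v"
    using wg by simp_all
qed

end

locale dominant_coweight = regular_affine_building R \<alpha> C adj \<delta> q
  for R :: "'a::euclidean_space set" and \<alpha> :: "nat \<Rightarrow> 'a"
    and C :: "'c set" and adj :: "nat \<Rightarrow> ('c \<times> 'c) set" and \<delta> :: "'c \<Rightarrow> 'c \<Rightarrow> 'a \<Rightarrow> 'a" and q :: "nat \<Rightarrow> nat" +
  fixes lam :: 'a
  assumes chambers: "C \<noteq> {}" and lam_dominant: "lam \<in> dominant_coweights \<alpha>"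
begin

abbreviation "l \<equiv> vertex_type R \<alpha> lam"
abbreviation "W0l \<equiv> weyl_stabilizer R \<alpha> lam"

lemma lam_P: "lam \<in> P"
  using dominant(1)[OF lam_dominant] .

lemma lam_pos: "b \<in> R \<Longrightarrow> pos b \<Longrightarrow> lam \<bullet> b \<ge> 0"
  using pos_le_highest(1)[of lam b] dominant(2)[OF lam_dominant] by blast

lemma l_type: obtains g where "g \<in> GG" "l = rot g 0" "l \<in> {..DIM('a)}"
  using coweight_type[OF lam_P] rot(1)[of _ 0] by (metis atMost_iff le0)

lemma l_I: "l \<in> {..DIM('a)}"
  using l_type by blast

lemma W0l_iff: "z \<in> W0l \<longleftrightarrow> z \<in> W0 \<and> z lam = lam"
  by (auto simp: weyl_stabilizer_def)

lemma W0l_comp: "z \<in> W0l \<Longrightarrow> y \<in> W0l \<Longrightarrow> z \<circ> y \<in> W0l"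
  using W0_comp by (simp add: W0l_iff)

lemma W0l_inv: "z \<in> W0l \<Longrightarrow> iv z \<in> W0l"
  using W0_inv aff_inv_app(1)[OF aff_W[OF W0_W]] unfolding W0l_iff by metis

lemma W0l_id: "id \<in> W0l"
  using W0_id by (simp add: W0l_iff)

section \<open>The minimal element and factorisation of the double coset\<close>

lemma ex_min_vertex: "\<exists>v. v \<in> W \<and> v (fv l) = lam \<and> (\<forall>w\<in>W. w (fv l) = lam \<longrightarrow> len v \<le> len w)"
proof -
  have "\<exists>w. w \<in> W \<and> w (fv l) = lam" using transl_affine_part[OF lam_P] by blast
  then show ?thesis using ex_has_least_nat[of "\<lambda>w. w \<in> W \<and> w (fv l) = lam" _ len] by blast
qed

text \<open>Shortest only among the elements sending \<open>fv l\<close> to \<open>lam\<close>,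
  which is a single left coset of \<open>Wi l\<close>. Dominance of \<open>lam\<close>, through
  \<open>N_W0_w_lam\<close>, makes it shortest in the whole double coset
  (\<open>min_coset_elem_eq\<close>).\<close>

definition w_lam :: "'a \<Rightarrow> 'a" where
  "w_lam = (SOME v. v \<in> W \<and> v (fv l) = lam \<and> (\<forall>w\<in>W. w (fv l) = lam \<longrightarrow> len v \<le> len w))"

lemma w_lam_W: "w_lam \<in> W" and w_lam_fv: "w_lam (fv l) = lam"
  and w_lam_min: "w \<in> W \<Longrightarrow> w (fv l) = lam \<Longrightarrow> len w_lam \<le> len w"
  using someI_ex[OF ex_min_vertex] unfolding w_lam_def by blast+

text \<open>The reflection in a crossed hyperplane through \<open>lam\<close> would shorten
  \<open>w_lam\<close> and still send \<open>fv l\<close> to \<open>lam\<close>.\<close>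

lemma N_w_lam:
  assumes "h \<in> N w_lam" shows "lam \<notin> h"
proof
  assume h: "lam \<in> h"
  obtain a k where a: "a \<in> R" "h = hyperplane a k" using N_hyps[OF assms] hyps_cases by metis
  have "affine_refl a k \<circ> w_lam \<in> W" using W_comp W_refl a(1) w_lam_W by blast
  moreover have "(affine_refl a k \<circ> w_lam) (fv l) = lam" using w_lam_fv affine_refl_fixed h a(2) by simp
  ultimately have "len w_lam \<le> len (affine_refl a k \<circ> w_lam)" using w_lam_min by blast
  then show False using refl_len_less[OF w_lam_W a(1), of k] assms a(2) by simp
qed

lemma N_inv_image: "aff f \<Longrightarrow> h \<in> N f \<Longrightarrow> iv f ` h \<in> N (iv f)"
  using N_inv inv_image_aff(2) by metis

text \<open>A hyperplane through 0 separating the fundamental alcove from its image under \<open>w_lam\<close>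
  weakly separates it from the dominant vertex \<open>lam\<close>, hence contains \<open>lam\<close>.\<close>

lemma N_W0_w_lam:
  assumes u: "u \<in> W0" and h: "h \<in> N u" shows "iv u ` h \<notin> N w_lam"
proof
  assume hm: "iv u ` h \<in> N w_lam"
  have "iv u ` h \<in> N (iv u)" using N_inv_image aff_W W0_W u h by blast
  then obtain a where a: "a \<in> R" "iv u ` h = hyperplane a 0" using N_through_0[OF W0_inv[OF u]] by metis
  obtain b k where b: "b \<in> R" "pos b" "iv u ` h = hyperplane b k"
    using hyps_pos_cases[OF hyperplane_in_hyps[OF a(1), of 0]] a(2) by metis
  have "0 \<in> iv u ` h" unfolding a(2) by (simp add: hyperplane_def)
  then have k: "k = 0" unfolding b(3) by (simp add: hyperplane_def)
  have "(x0 \<bullet> b - of_int k) * (w_lam x0 \<bullet> b - of_int k) < 0" using hm unfolding b(3) N_def sep_iff[OF b(1)] .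
  moreover have "0 < x0 \<bullet> b" using alcove_pos[OF x0 b(1,2)] by simp
  ultimately have "w_lam x0 \<bullet> b < 0" using k by (simp add: mult_less_0_iff)
  moreover have "(w_lam x0 \<bullet> b - of_int 0) * (w_lam (fv l) \<bullet> b - of_int 0) \<ge> 0"
    by (rule aff_cl_side[OF aff_W[OF w_lam_W] fv_cl[OF l_I] b(1)])
  ultimately have "lam \<bullet> b \<le> 0" by (simp add: w_lam_fv zero_le_mult_iff)
  then have "lam \<bullet> b = 0" using lam_pos[OF b(1,2)] by simp
  then have "lam \<in> iv u ` h" unfolding b(3) k by (simp add: hyperplane_def)
  then show False using N_w_lam hm by blast
qed

text \<open>The shortest representatives of the left cosets of \<open>W0l\<close> in
  \<open>W0\<close>, in a geometric form from which additivity of lengths in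
  \<open>u \<circ> z\<close> and \<open>u \<circ> w_lam \<circ> y\<close> can be read off.\<close>

definition coset_reps :: "('a \<Rightarrow> 'a) set" where
  "coset_reps = {u \<in> W0. \<forall>h\<in>N (iv u). lam \<notin> h}"

lemma coset_reps_W0: "u \<in> coset_reps \<Longrightarrow> u \<in> W0"
  by (simp add: coset_reps_def)

text \<open>A shortest element \<open>u\<close> of the coset qualifies: the reflection in a
  hyperplane through both 0 and \<open>lam\<close> belongs to \<open>W0l\<close>, and if
  \<open>iv u\<close> crossed that hyperplane it would shorten \<open>u\<close>.\<close>

lemma coset_reps_cover:
  assumes "u' \<in> W0" obtains u z where "u \<in> coset_reps" "z \<in> W0l" "u' = u \<circ> z"
proof -
  have "\<exists>z. z \<in> W0l" using W0l_id by blast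
  then obtain z where z: "z \<in> W0l" "\<And>y. y \<in> W0l \<Longrightarrow> len (u' \<circ> z) \<le> len (u' \<circ> y)"
    using ex_has_least_nat[of "\<lambda>z. z \<in> W0l" _ "\<lambda>z. len (u' \<circ> z)"] by blast
  define u where "u = u' \<circ> z"
  have u: "u \<in> W0" unfolding u_def using W0_comp assms z(1) W0l_iff by blast
  have au: "aff u" using aff_W W0_W u by blast
  have "lam \<notin> h" if h: "h \<in> N (iv u)" for h
  proof
    assume lh: "lam \<in> h"
    obtain a where a: "a \<in> R" "h = hyperplane a 0" using N_through_0[OF W0_inv[OF u] h] by blast
    let ?r = "affine_refl a 0"
    have ar: "aff ?r" using aff_affine_refl a by blast
    have r: "?r \<in> W0l"
      using W_refl[OF a(1)] affine_refl_fixed lh a(2) by (simp add: W0l_iff weyl_stabilizer_0 affine_refl_def[of a 0 0])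
    have "len (?r \<circ> iv u) < len (iv u)" using refl_len_less[OF W_inv[OF W0_W[OF u]] a(1)] h a(2) by simp
    moreover have "iv (?r \<circ> iv u) = u \<circ> ?r"
    proof -
      have "iv ?r = ?r" by (rule inv_unique_comp) (rule affine_refl_comp_self[OF root_nonzero[OF a(1)]])+
      then show ?thesis using inv_comp_aff[OF ar aff_inv[OF au]] inv_inv_aff[OF au] by simp
    qed
    then have "len (?r \<circ> iv u) = len (u \<circ> ?r)" using len_inv[OF aff_comp[OF ar aff_inv[OF au]]] by simp
    ultimately have "len (u' \<circ> (z \<circ> ?r)) < len (u' \<circ> z)" using len_inv[OF au] unfolding u_def by (simp only: comp_assoc)
    then show False using z(2)[OF W0l_comp[OF z(1) r]] by simp
  qed
  then have "u \<in> coset_reps" using u by (simp add: coset_reps_def)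
  moreover have "u' = u \<circ> iv z" unfolding u_def using aff_inv_app(2)[OF aff_W[OF W0_W, of z]] z(1) W0l_iff by auto
  ultimately show ?thesis using that W0l_inv[OF z(1)] by blast
qed

text \<open>\<open>lam\<close> may lie outside the closed alcove, but linear maps fixing it fix all
  its multiples. A multiple inside the closed alcove makes \<open>N_through_fixed\<close> applicable
  to \<open>W0l\<close>.\<close>

lemma scaled_lam_cl: obtains e where "e > 0" "e *\<^sub>R lam \<in> cl"
proof -
  define e where "e = 1 / (1 + \<bar>lam \<bullet> \<theta>\<bar>)"
  have e: "e > 0" by (simp add: e_def)
  have "lam \<bullet> \<theta> \<le> 1 + \<bar>lam \<bullet> \<theta>\<bar>" by linarith
  then have "e * (lam \<bullet> \<theta>) \<le> 1" by (simp add: e_def divide_le_eq)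
  then have "e *\<^sub>R lam \<in> cl" using dominant(2)[OF lam_dominant] e by (simp add: cl_def)
  then show ?thesis using that e by blast
qed

lemma N_W0l:
  assumes "z \<in> W0l" "h \<in> N z" shows "lam \<in> h"
proof -
  have z: "z \<in> W0" "z lam = lam" using assms(1) W0l_iff by auto
  obtain e where e: "e > 0" "e *\<^sub>R lam \<in> cl" using scaled_lam_cl .
  have "z (e *\<^sub>R lam) = e *\<^sub>R lam" using linear_cmul[OF W0_linear[OF z(1)]] z(2) by simp
  then have "e *\<^sub>R lam \<in> h" using N_through_fixed[OF W0_W[OF z(1)] e(2)] assms(2) by blast
  moreover obtain a where "h = hyperplane a 0" using N_through_0[OF z(1) assms(2)] by blast
  ultimately show ?thesis using e(1) by (simp add: hyperplane_def)
qed

lemma N_U_W0l: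
  assumes "u \<in> coset_reps" "z \<in> W0l" "h \<in> N u" shows "iv u ` h \<notin> N z"
  using N_W0l[OF assms(2)] N_inv_image[OF aff_W[OF W0_W[OF coset_reps_W0[OF assms(1)]]] assms(3)] assms(1)
  unfolding coset_reps_def by blast

text \<open>Lengths add both in \<open>u' = u \<circ> x\<close> and in
  \<open>u = u' \<circ> iv x\<close>, so \<open>x\<close> has length zero.\<close>

lemma coset_reps_unique:
  assumes "u \<in> coset_reps" "u' \<in> coset_reps" "x \<in> W0l" "u' = u \<circ> x" shows "u' = u \<and> x = id"
proof -
  have a: "aff u" "aff u'" "aff x" "x \<in> W" using aff_W W0_W coset_reps_W0 assms W0l_iff by blast+
  have "len u' = len u + len x" unfolding assms(4)
    by (rule len_comp_disjoint[OF a(1,3)]) (use N_U_W0l assms in blast)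
  moreover have "u = u' \<circ> iv x" unfolding assms(4) using aff_inv_app(2)[OF a(3)] by auto
  then have "len u = len (u' \<circ> iv x)" by simp
  moreover have "len (u' \<circ> iv x) = len u' + len (iv x)"
    by (rule len_comp_disjoint[OF a(2) aff_inv[OF a(3)]]) (use N_U_W0l assms W0l_inv in blast)
  ultimately have "len x = 0" by simp
  then have "x = id" using len_eq_0 N_empty_id a(4) by blast
  then show ?thesis using assms(4) by simp
qed

lemma finite_sets: "finite coset_reps" "finite W0l" "finite (Wi l)"
proof -
  show "finite coset_reps" using finite_subset[OF _ finite_W0] coset_reps_W0 by blast
  show "finite W0l" using finite_subset[OF _ finite_W0] W0l_iff by blast
  show "finite (Wi l)" using l_type finite_parabolic by metis
qed

text \<open>Identifies the sum over \<open>coset_reps\<close> with the quotient of q-sums in the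
  formula.\<close>

lemma q_sum_W0: "q_sum R \<alpha> q W0 = (\<Sum>u\<in>coset_reps. qw u) * q_sum R \<alpha> q W0l"
proof -
  have "bij_betw (\<lambda>(u, z). u \<circ> z) (coset_reps \<times> W0l) W0"
    unfolding bij_betw_def
  proof
    show "inj_on (\<lambda>(u, z). u \<circ> z) (coset_reps \<times> W0l)"
    proof (rule inj_onI, clarify)
      fix u z u' z' assume *: "u \<in> coset_reps" "z \<in> W0l" "u' \<in> coset_reps" "z' \<in> W0l" "u \<circ> z = u' \<circ> z'"
      have az: "aff z'" "aff z" using * W0l_iff aff_W W0_W by blast+
      have "u' = (u' \<circ> z') \<circ> iv z'" using aff_inv_app(2)[OF az(1)] by auto
      also have "\<dots> = u \<circ> (z \<circ> iv z')" unfolding *(5)[symmetric] by (simp only: comp_assoc)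
      finally have "u' = u \<and> z \<circ> iv z' = id" using coset_reps_unique[OF *(1,3)] W0l_comp W0l_inv * by blast
      moreover have "z = (z \<circ> iv z') \<circ> z'" using aff_inv_app(1)[OF az(1)] by auto
      ultimately show "u = u' \<and> z = z'" by simp
    qed
    show "(\<lambda>(u, z). u \<circ> z) ` (coset_reps \<times> W0l) = W0"
    proof
      show "(\<lambda>(u, z). u \<circ> z) ` (coset_reps \<times> W0l) \<subseteq> W0" using W0_comp coset_reps_W0 W0l_iff by auto
      show "W0 \<subseteq> (\<lambda>(u, z). u \<circ> z) ` (coset_reps \<times> W0l)"
      proof
        fix w assume "w \<in> W0"
        then obtain u z where "u \<in> coset_reps" "z \<in> W0l" "w = u \<circ> z" using coset_reps_cover by blast
        then show "w \<in> (\<lambda>(u, z). u \<circ> z) ` (coset_reps \<times> W0l)" by (intro image_eqI[of _ _ "(u, z)"]) auto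
      qed
    qed
  qed
  then have "q_sum R \<alpha> q W0 = (\<Sum>(u, z)\<in>coset_reps \<times> W0l. qw (u \<circ> z))"
    unfolding q_sum_def by (subst sum.reindex_bij_betw[symmetric]) (auto simp: case_prod_unfold)
  also have "\<dots> = (\<Sum>(u, z)\<in>coset_reps \<times> W0l. qw u * qw z)"
  proof (rule sum.cong, simp, clarify)
    fix u z assume uz: "u \<in> coset_reps" "z \<in> W0l"
    show "qw (u \<circ> z) = qw u * qw z"
      by (rule q_elem_comp[OF chambers]) (use uz coset_reps_W0 W0_W W0l_iff N_U_W0l in blast)+
  qed
  also have "\<dots> = (\<Sum>u\<in>coset_reps. qw u) * (\<Sum>z\<in>W0l. qw z)" by (simp add: sum_product sum.cartesian_product)
  finally show ?thesis by (simp add: q_sum_def)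
qed

lemma rep_w_lam_W: "u \<in> coset_reps \<Longrightarrow> u \<circ> w_lam \<in> W"
  using W_comp W0_W coset_reps_W0 w_lam_W by blast

text \<open>Hyperplanes crossed by \<open>y\<close> pass through \<open>fv l\<close>, so after
  transport by \<open>u \<circ> w_lam\<close> they pass through \<open>u lam\<close>. Pulled back by
  \<open>u\<close>, such a hyperplane contains \<open>lam\<close>, and neither \<open>w_lam\<close>
  nor \<open>iv u\<close> crosses one of those.\<close>

lemma N_rep_parabolic:
  assumes "u \<in> coset_reps" "y \<in> Wi l" "h \<in> N (u \<circ> w_lam)" shows "iv (u \<circ> w_lam) ` h \<notin> N y"
proof
  assume hy: "iv (u \<circ> w_lam) ` h \<in> N y"
  have a: "aff u" "aff w_lam" "aff (u \<circ> w_lam)" using aff_W W0_W coset_reps_W0 assms w_lam_W rep_w_lam_W by blast+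
  have "y (fv l) = fv l" using assms(2) parabolic_stabilizer[OF l_I] by blast
  then have "fv l \<in> iv (u \<circ> w_lam) ` h"
    using N_through_fixed[OF parabolic_W[OF assms(2)] fv_cl[OF l_I]] hy by blast
  then have "(u \<circ> w_lam) (fv l) \<in> (u \<circ> w_lam) ` iv (u \<circ> w_lam) ` h" by blast
  then have "u lam \<in> h" using inv_image_aff(2)[OF a(3)] w_lam_fv by simp
  then have lh: "lam \<in> iv u ` h" using aff_inv_app(1)[OF a(1), of lam] by (metis imageI)
  have "h \<in> N u \<or> iv u ` h \<in> N w_lam" using N_comp[OF a(1,2)] assms(3) by blast
  then show False using lh N_w_lam N_inv_image[OF a(1)] assms(1) unfolding coset_reps_def by blast
qed

text \<open>The value of the composite at \<open>fv l\<close> is \<open>u lam\<close>, which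
  determines the representative \<open>u\<close>; then \<open>y\<close> is what remains.\<close>

lemma orbit_coset_bij: "bij_betw (\<lambda>(u, y). u \<circ> w_lam \<circ> y) (coset_reps \<times> Wi l) (orbit_coset lam l)"
  unfolding bij_betw_def
proof
  have fix_l: "y (fv l) = fv l" if "y \<in> Wi l" for y using that parabolic_stabilizer[OF l_I] by blast
  show "inj_on (\<lambda>(u, y). u \<circ> w_lam \<circ> y) (coset_reps \<times> Wi l)"
  proof (rule inj_onI, clarify)
    fix u y u' y' assume *: "u \<in> coset_reps" "y \<in> Wi l" "u' \<in> coset_reps" "y' \<in> Wi l" "u \<circ> w_lam \<circ> y = u' \<circ> w_lam \<circ> y'"
    have a: "aff u" "aff w_lam" "aff (u \<circ> w_lam)" using aff_W W0_W coset_reps_W0 *(1) w_lam_W rep_w_lam_W by blast+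
    have "u lam = u' lam"
      using fun_cong[OF *(5), of "fv l"] by (simp add: fix_l[OF *(2)] fix_l[OF *(4)] w_lam_fv)
    then have "(iv u \<circ> u') lam = lam" using aff_inv_app(1)[OF a(1), of lam] by simp
    then have "iv u \<circ> u' \<in> W0l" using W0_comp W0_inv coset_reps_W0 *(1,3) W0l_iff by blast
    moreover have "u' = u \<circ> (iv u \<circ> u')" using aff_inv_app(2)[OF a(1)] by auto
    ultimately have "u' = u" using coset_reps_unique[OF *(1,3)] by blast
    moreover have "y = iv (u \<circ> w_lam) \<circ> (u \<circ> w_lam \<circ> y)" for y using aff_inv_app(1)[OF a(3)] by (auto simp: fun_eq_iff)
    ultimately show "u = u' \<and> y = y'" using *(5) by metis
  qed
  show "(\<lambda>(u, y). u \<circ> w_lam \<circ> y) ` (coset_reps \<times> Wi l) = orbit_coset lam l"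
  proof (intro equalityI subsetI)
    fix w assume "w \<in> (\<lambda>(u, y). u \<circ> w_lam \<circ> y) ` (coset_reps \<times> Wi l)"
    then obtain u y where uy: "u \<in> coset_reps" "y \<in> Wi l" "w = u \<circ> w_lam \<circ> y" by auto
    have "w \<in> W" using uy W_comp rep_w_lam_W parabolic_W by blast
    moreover have "w (fv l) = u lam" using uy(3) fix_l[OF uy(2)] w_lam_fv by simp
    ultimately show "w \<in> orbit_coset lam l" unfolding orbit_coset_def using coset_reps_W0[OF uy(1)] by blast
  next
    fix w assume "w \<in> orbit_coset lam l"
    then obtain u' where w: "w \<in> W" "u' \<in> W0" "w (fv l) = u' lam" unfolding orbit_coset_def by blast
    obtain u z where uz: "u \<in> coset_reps" "z \<in> W0l" "u' = u \<circ> z" using coset_reps_cover w(2) by blast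
    have a: "aff (u \<circ> w_lam)" using aff_W rep_w_lam_W uz by blast
    have wl: "w (fv l) = (u \<circ> w_lam) (fv l)" using w(3) uz(2,3) W0l_iff w_lam_fv by simp
    have "(iv (u \<circ> w_lam) \<circ> w) (fv l) = fv l" using wl aff_inv_app(1)[OF a, of "fv l"] by simp
    moreover have "iv (u \<circ> w_lam) \<circ> w \<in> W" using W_comp W_inv rep_w_lam_W uz(1) w(1) by blast
    ultimately have "iv (u \<circ> w_lam) \<circ> w \<in> Wi l" using parabolic_stabilizer[OF l_I] by blast
    moreover have "w = u \<circ> w_lam \<circ> (iv (u \<circ> w_lam) \<circ> w)" using aff_inv_app(2)[OF a] by (auto simp: fun_eq_iff)
    ultimately show "w \<in> (\<lambda>(u, y). u \<circ> w_lam \<circ> y) ` (coset_reps \<times> Wi l)" using uz(1)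
      by (intro image_eqI[of _ _ "(u, iv (u \<circ> w_lam) \<circ> w)"]) auto
  qed
qed

lemma q_sum_orbit_coset:
  "(\<Sum>w\<in>orbit_coset lam l. qw w) = (\<Sum>u\<in>coset_reps. qw u) * qw w_lam * q_sum R \<alpha> q W0"
proof -
  have "(\<Sum>w\<in>orbit_coset lam l. qw w) = (\<Sum>(u, y)\<in>coset_reps \<times> Wi l. qw (u \<circ> w_lam \<circ> y))"
    by (subst sum.reindex_bij_betw[OF orbit_coset_bij, symmetric]) (auto simp: case_prod_unfold)
  also have "\<dots> = (\<Sum>(u, y)\<in>coset_reps \<times> Wi l. qw u * qw w_lam * qw y)"
  proof (rule sum.cong, simp, clarify)
    fix u y assume uy: "u \<in> coset_reps" "y \<in> Wi l"
    have "qw (u \<circ> w_lam \<circ> y) = qw (u \<circ> w_lam) * qw y"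
      by (rule q_elem_comp[OF chambers rep_w_lam_W[OF uy(1)] parabolic_W[OF uy(2)]]) (rule N_rep_parabolic[OF uy])
    also have "qw (u \<circ> w_lam) = qw u * qw w_lam"
      by (rule q_elem_comp[OF chambers W0_W[OF coset_reps_W0[OF uy(1)]] w_lam_W]) (rule N_W0_w_lam[OF coset_reps_W0[OF uy(1)]])
    finally show "qw (u \<circ> w_lam \<circ> y) = qw u * qw w_lam * qw y" .
  qed
  also have "\<dots> = (\<Sum>u\<in>coset_reps. qw u * qw w_lam) * (\<Sum>y\<in>Wi l. qw y)" by (simp add: sum_product sum.cartesian_product)
  also have "\<dots> = (\<Sum>u\<in>coset_reps. qw u) * qw w_lam * (\<Sum>y\<in>Wi l. qw y)" by (simp add: sum_distrib_right)
  also have "(\<Sum>y\<in>Wi l. qw y) = q_sum R \<alpha> q W0" using l_type q_sum_parabolic[OF chambers] by metis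
  finally show ?thesis .
qed

lemma lam_orbit: "lam \<in> orbit lam"
  using W0_id by (metis (mono_tags, lifting) id_apply mem_Collect_eq)

text \<open>The length of \<open>u \<circ> w_lam \<circ> y\<close> is the sum of the three lengths,
  so every other element of the double coset is strictly longer, as the definite description
  requires.\<close>

lemma min_coset_elem_eq: "min_coset_elem R \<alpha> lam = w_lam"
proof -
  have D: "double_coset W0 (transl_affine_part R \<alpha> lam) (Wi l) = orbit_coset lam l"
    using transl_affine_part[OF lam_P] lam_orbit by (intro double_coset_orbit[OF l_I]) auto
  have DW: "weyl_length R \<alpha> w = len w" if "w \<in> orbit_coset lam l" for w
    using that weyl_length_eq aff_W by (auto simp: orbit_coset_def)
  have mD: "w_lam \<in> orbit_coset lam l" using w_lam_W w_lam_fv lam_orbit by (simp add: orbit_coset_def)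
  have lt: "len w_lam < len w" if wD: "w \<in> orbit_coset lam l" "w \<noteq> w_lam" for w
  proof -
    obtain u y where uy: "u \<in> coset_reps" "y \<in> Wi l" "w = u \<circ> w_lam \<circ> y"
      using wD(1) orbit_coset_bij unfolding bij_betw_def by force
    have a: "aff u" "aff w_lam" "aff y" "aff (u \<circ> w_lam)" "u \<in> W" "y \<in> W"
      using aff_W W0_W coset_reps_W0 uy w_lam_W rep_w_lam_W parabolic_W by blast+
    have "len w = len (u \<circ> w_lam) + len y" unfolding uy(3)
      by (rule len_comp_disjoint[OF a(4,3)]) (rule N_rep_parabolic[OF uy(1,2)])
    also have "len (u \<circ> w_lam) = len u + len w_lam"
      by (rule len_comp_disjoint[OF a(1,2)]) (rule N_W0_w_lam[OF coset_reps_W0[OF uy(1)]])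
    finally have l: "len w = len u + len w_lam + len y" .
    have "len u \<noteq> 0 \<or> len y \<noteq> 0"
    proof (rule ccontr)
      assume "\<not> ?thesis"
      then have "u = id" "y = id" using len_eq_0 N_empty_id a(5,6) by auto
      then show False using uy(3) wD(2) by simp
    qed
    then show ?thesis using l by linarith
  qed
  show ?thesis unfolding min_coset_elem_def D
  proof (rule the_equality)
    show "is_arg_min (weyl_length R \<alpha>) (\<lambda>w. w \<in> orbit_coset lam l) w_lam"
      unfolding is_arg_min_def using mD DW lt by (metis less_asym less_irrefl)
    fix w assume "is_arg_min (weyl_length R \<alpha>) (\<lambda>w. w \<in> orbit_coset lam l) w"
    then show "w = w_lam" unfolding is_arg_min_def using mD DW lt by metis
  qed
qed

lemma double_coset_min: "double_coset W0 (min_coset_elem R \<alpha> lam) (Wi l) = orbit_coset lam l"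
  unfolding min_coset_elem_eq using w_lam_W w_lam_fv lam_orbit by (intro double_coset_orbit[OF l_I]) auto

end

section \<open>Inversion and the dual coweight\<close>

context regular_affine_building
begin

text \<open>Since \<open>w (g 0) = u \<mu>\<close>, the composite \<open>w \<circ> g\<close> is an
  element of \<open>W0\<close> followed by translation by \<open>u \<mu>\<close>. Its inverse
  therefore takes 0 into the \<open>W0\<close>-orbit of \<open>- \<mu>\<close>.\<close>

lemma orbit_coset_inverse:
  assumes g: "g \<in> GG" and w: "w \<in> orbit_coset \<mu> (rot g 0)"
  shows "iv g \<circ> iv w \<circ> g \<in> orbit_coset (- \<mu>) (rot (iv g) 0)"
proof -
  have ag: "aff g" using GG_aff g by blast
  obtain u where u: "w \<in> W" "u \<in> W0" "w (g 0) = u \<mu>" using w GG_0[OF g] unfolding orbit_coset_def by auto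
  have aw: "aff w" using aff_W u by blast
  have "w \<circ> g \<in> WE" using WE_comp W_WE GG_WE u(1) g by blast
  then obtain v u1 where F: "u1 \<in> W0" "w \<circ> g = transl v \<circ> u1" unfolding WE_iff by blast
  have "(w \<circ> g) 0 = v" using F(1) unfolding F(2) by (simp add: transl_def weyl_stabilizer_0)
  then have v: "v = u \<mu>" using u(3) by simp
  define x where "x = (iv u1 \<circ> u) (- \<mu>)"
  have "u1 x = - v"
    unfolding x_def v using aff_inv_app(2)[OF aff_W[OF W0_W[OF F(1)]]] linear_neg[OF W0_linear[OF u(2)]] by simp
  then have "(w \<circ> g) x = 0" unfolding F(2) by (simp add: transl_def)
  then have "x = iv g (iv w 0)" using aff_inv_app(1)[OF aw, of "g x"] aff_inv_app(1)[OF ag, of x] by simp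
  moreover have "x \<in> orbit (- \<mu>)" unfolding x_def using W0_comp W0_inv F(1) u(2) by blast
  moreover have "(iv g \<circ> iv w \<circ> g) (fv (rot (iv g) 0)) = iv g (iv w 0)"
    using GG_0[OF GG_inv[OF g]] aff_inv_app(2)[OF ag, of 0] by simp
  moreover have "iv g \<circ> iv w \<circ> g \<in> W"
    using conj_W[OF aff_inv[OF ag] W_inv[OF u(1)]] inv_inv_aff[OF ag] by simp
  ultimately show ?thesis unfolding orbit_coset_def by simp
qed

text \<open>Inversion exchanges the two sides of the double coset; conjugation by
  \<open>iv g\<close> then carries \<open>Wi (rot g 0)\<close> to \<open>W0\<close> and
  \<open>W0\<close> to \<open>Wi (rot (iv g) 0)\<close>. Neither operation changes
  \<open>q_elem\<close>.\<close>

lemma q_sum_orbit_coset_inverse: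
  assumes "C \<noteq> {}" and g: "g \<in> GG"
  shows "(\<Sum>w\<in>orbit_coset \<mu> (rot g 0). qw w) = (\<Sum>w\<in>orbit_coset (- \<mu>) (rot (iv g) 0). qw w)"
proof -
  have ag: "aff g" using GG_aff g by blast
  have ig: "iv g \<in> GG" "iv (iv g) = g" using GG_inv g inv_inv_aff[OF ag] by auto
  have W: "w \<in> W" if "w \<in> orbit_coset \<nu> k" for w \<nu> k using that by (simp add: orbit_coset_def)
  have cancel: "g \<circ> iv (iv g \<circ> iv w \<circ> g) \<circ> iv g = w" if "w \<in> W" for w
  proof -
    have a: "aff w" "aff (iv g \<circ> iv w)" using aff_W that aff_comp aff_inv ag by blast+
    have "iv (iv g \<circ> iv w \<circ> g) = iv g \<circ> (w \<circ> g)"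
      by (simp only: inv_comp_aff[OF a(2) ag] inv_comp_aff[OF aff_inv[OF ag] aff_inv[OF a(1)]] ig(2) inv_inv_aff[OF a(1)])
    then show ?thesis using aff_inv_app(2)[OF ag] by auto
  qed
  have cancel': "iv g \<circ> iv (g \<circ> iv w \<circ> iv g) \<circ> g = w" if "w \<in> W" for w
  proof -
    have a: "aff w" "aff (g \<circ> iv w)" using aff_W that aff_comp aff_inv ag by blast+
    have "iv (g \<circ> iv w \<circ> iv g) = g \<circ> (w \<circ> iv g)"
      by (simp only: inv_comp_aff[OF a(2) aff_inv[OF ag]] inv_comp_aff[OF ag aff_inv[OF a(1)]] ig(2) inv_inv_aff[OF a(1)])
    then show ?thesis using aff_inv_app(1)[OF ag] by auto
  qed
  show ?thesis
  proof (rule sum.reindex_bij_witness[of _ "\<lambda>w. g \<circ> iv w \<circ> iv g" "\<lambda>w. iv g \<circ> iv w \<circ> g"])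
    fix w assume w: "w \<in> orbit_coset \<mu> (rot g 0)"
    show "g \<circ> iv (iv g \<circ> iv w \<circ> g) \<circ> iv g = w" using cancel W w by blast
    show "iv g \<circ> iv w \<circ> g \<in> orbit_coset (- \<mu>) (rot (iv g) 0)" using orbit_coset_inverse g w by blast
    have "qw (iv g \<circ> iv w \<circ> iv (iv g)) = qw (iv w)" using q_elem_conj[OF assms(1) ig(1) W_inv[OF W[OF w]]] .
    then show "qw (iv g \<circ> iv w \<circ> g) = qw w" using q_elem_inv[OF assms(1) W[OF w]] ig(2) by metis
  next
    fix w assume w: "w \<in> orbit_coset (- \<mu>) (rot (iv g) 0)"
    show "iv g \<circ> iv (g \<circ> iv w \<circ> iv g) \<circ> g = w" using cancel' W w by blast
    show "g \<circ> iv w \<circ> iv g \<in> orbit_coset \<mu> (rot g 0)"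
      using orbit_coset_inverse[OF ig(1) w] unfolding ig(2) minus_minus .
  qed
qed

lemma orbit_coset_orbit:
  assumes "u \<in> W0" shows "orbit_coset (u \<mu>) k = orbit_coset \<mu> k"
proof -
  have "orbit (u \<mu>) = orbit \<mu>"
  proof (intro equalityI subsetI)
    fix z assume "z \<in> orbit (u \<mu>)"
    then obtain v where "v \<in> W0" "z = (v \<circ> u) \<mu>" by auto
    then show "z \<in> orbit \<mu>" using W0_comp[OF _ assms] by blast
  next
    fix z assume "z \<in> orbit \<mu>"
    then obtain v where v: "v \<in> W0" "z = v \<mu>" by blast
    then have "z = (v \<circ> iv u) (u \<mu>)" using aff_inv_app(1)[OF aff_W[OF W0_W[OF assms]], of \<mu>] by simp
    then show "z \<in> orbit (u \<mu>)" using W0_comp[OF v(1) W0_inv[OF assms]] by blast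
  qed
  then show ?thesis by (simp only: orbit_coset_def)
qed

end

context dominant_coweight
begin

lemma q_sum_pos: "q_sum R \<alpha> q W0 > 0" "q_sum R \<alpha> q W0l > 0"
proof -
  have "0 < (\<Sum>w\<in>W0. qw w)" by (rule sum_pos2[OF finite_W0 W0_id]) (use q_elem_id[OF chambers] in auto)
  then show "q_sum R \<alpha> q W0 > 0" by (simp add: q_sum_def)
  have "0 < (\<Sum>w\<in>W0l. qw w)" by (rule sum_pos2[OF finite_sets(2) W0l_id]) (use q_elem_id[OF chambers] in auto)
  then show "q_sum R \<alpha> q W0l > 0" by (simp add: q_sum_def)
qed

lemma dual_sphere_card:
  assumes "x \<in> good_vertices R \<alpha> C adj"
  shows "card (vertex_sphere R \<alpha> C adj (dual_coweight R \<alpha> lam) x) * q_sum R \<alpha> q W0 =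
    (\<Sum>w\<in>orbit_coset lam l. qw w)"
proof -
  obtain g where g: "g \<in> GG" "l = rot g 0" using l_type by metis
  define \<mu> where "\<mu> = dual_coweight R \<alpha> lam"
  have \<mu>: "\<mu> = longest_weyl R \<alpha> (- lam)" by (simp add: \<mu>_def dual_coweight_def)
  have aw: "aff (longest_weyl R \<alpha>)" using aff_W W0_W longest_weyl_mem by blast
  have \<mu>P: "\<mu> \<in> P" unfolding \<mu> by (rule aff_coweight[OF aw coweight_uminus[OF lam_P]])
  have c: "orbit_coset \<mu> k = orbit_coset (- lam) k" for k
    unfolding \<mu> by (rule orbit_coset_orbit[OF longest_weyl_mem])
  \<comment> \<open>Any element of the transformed coset exhibits the type of the dual coweight; the
    transform of \<open>w_lam\<close> serves.\<close>
  have "w_lam \<in> orbit_coset lam (rot g 0)" using w_lam_W w_lam_fv lam_orbit g(2) by (simp add: orbit_coset_def)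
  then have "iv g \<circ> iv w_lam \<circ> g \<in> orbit_coset \<mu> (rot (iv g) 0)" unfolding c by (rule orbit_coset_inverse[OF g(1)])
  then have "vertex_type R \<alpha> (id \<mu>) = rot (iv g) 0"
    by (intro orbit_type[OF GG_id \<mu>P, of "iv g \<circ> iv w_lam \<circ> g"] rot(1)[OF GG_inv[OF g(1)]]) (auto simp: orbit_coset_def)
  then have "vertex_type R \<alpha> \<mu> = rot (iv g) 0" by simp
  then show ?thesis
    using vertex_sphere_card[OF assms \<mu>P] q_sum_orbit_coset_inverse[OF chambers g(1), of lam] g(2)
    unfolding c by (simp add: \<mu>_def)
qed

end

theorem theorem5p15:
  fixes R :: "'a::euclidean_space set" and \<alpha> :: "nat \<Rightarrow> 'a"
    and C :: "'c set" and adj :: "nat \<Rightarrow> ('c \<times> 'c) set"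
    and \<delta> :: "'c \<Rightarrow> 'c \<Rightarrow> 'a \<Rightarrow> 'a" and q :: "nat \<Rightarrow> nat"
    and x :: "nat \<times> 'c set" and lam :: 'a and l :: nat
  assumes "irreducible_root_system R" and "root_base R \<alpha>"
    and "locally_finite_regular_affine_building R \<alpha> C adj \<delta> q"
    and "x \<in> good_vertices R \<alpha> C adj"
    and "lam \<in> dominant_coweights \<alpha>" and "vertex_type R \<alpha> lam = l"
  shows "real (card (vertex_sphere R \<alpha> C adj lam x)) =
           1 / real (q_sum R \<alpha> q (weyl R \<alpha>)) *
           (\<Sum>w\<in>double_coset (weyl R \<alpha>) (min_coset_elem R \<alpha> lam) (maximal_parabolic R \<alpha> l).
              real (q_elem R \<alpha> q w))
       \<and> 1 / real (q_sum R \<alpha> q (weyl R \<alpha>)) *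
           (\<Sum>w\<in>double_coset (weyl R \<alpha>) (min_coset_elem R \<alpha> lam) (maximal_parabolic R \<alpha> l).
              real (q_elem R \<alpha> q w)) =
         real (q_sum R \<alpha> q (weyl R \<alpha>)) / real (q_sum R \<alpha> q (weyl_stabilizer R \<alpha> lam)) *
           real (q_elem R \<alpha> q (min_coset_elem R \<alpha> lam))
       \<and> real (q_sum R \<alpha> q (weyl R \<alpha>)) / real (q_sum R \<alpha> q (weyl_stabilizer R \<alpha> lam)) *
           real (q_elem R \<alpha> q (min_coset_elem R \<alpha> lam)) =
         real (card (vertex_sphere R \<alpha> C adj (dual_coweight R \<alpha> lam) x))"
proof -
  have "C \<noteq> {}" using assms(4) by (auto simp: good_vertices_def building_complex_def)
  then interpret dominant_coweight R \<alpha> C adj \<delta> q lam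
    by unfold_locales (use assms in auto)
  let ?D = "double_coset (weyl R \<alpha>) (min_coset_elem R \<alpha> lam) (maximal_parabolic R \<alpha> l)"
  let ?Q = "real (q_sum R \<alpha> q (weyl R \<alpha>))"
  have pos: "?Q > 0" "real (q_sum R \<alpha> q (weyl_stabilizer R \<alpha> lam)) > 0" using q_sum_pos by simp_all
  have D: "(\<Sum>w\<in>?D. real (q_elem R \<alpha> q w)) = real (\<Sum>w\<in>orbit_coset lam l. q_elem R \<alpha> q w)"
    using double_coset_min assms(6) by simp
  have "real (card (vertex_sphere R \<alpha> C adj lam x)) * ?Q = (\<Sum>w\<in>?D. real (q_elem R \<alpha> q w))"
    unfolding D vertex_sphere_card[OF assms(4) lam_P, unfolded assms(6), symmetric] by simp
  moreover have "real (card (vertex_sphere R \<alpha> C adj (dual_coweight R \<alpha> lam) x)) * ?Q =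
      (\<Sum>w\<in>?D. real (q_elem R \<alpha> q w))"
    unfolding D dual_sphere_card[OF assms(4), unfolded assms(6), symmetric] by simp
  moreover have "real (\<Sum>w\<in>orbit_coset lam l. q_elem R \<alpha> q w) =
      real (\<Sum>u\<in>coset_reps. q_elem R \<alpha> q u) * real (q_elem R \<alpha> q (min_coset_elem R \<alpha> lam)) * ?Q"
    unfolding q_sum_orbit_coset[unfolded assms(6)] min_coset_elem_eq by simp
  then have "(\<Sum>w\<in>?D. real (q_elem R \<alpha> q w)) =
      real (\<Sum>u\<in>coset_reps. q_elem R \<alpha> q u) * real (q_elem R \<alpha> q (min_coset_elem R \<alpha> lam)) * ?Q"
    unfolding D .
  moreover have "?Q = real (\<Sum>u\<in>coset_reps. q_elem R \<alpha> q u) * real (q_sum R \<alpha> q (weyl_stabilizer R \<alpha> lam))"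
    unfolding q_sum_W0 by simp
  \<comment> \<open>\<open>T\<close> stands for the sum over \<open>coset_reps\<close>, which is the
    quotient of \<open>Q\<close> by \<open>P\<close>; every expression in the chain equals
    \<open>T * M\<close>.\<close>
  moreover have "a = 1 / Q * S \<and> 1 / Q * S = Q / P * M \<and> Q / P * M = b"
    if "a * Q = S" "b * Q = S" "S = T * M * Q" "Q = T * P" "Q > 0" "P > 0" for a b S Q P M T :: real
  proof -
    have "a = T * M" "b = T * M" "1 / Q * S = T * M" using that(1-3,5) by auto
    moreover have "Q / P = T" using that(4,6) by simp
    ultimately show ?thesis by simp
  qed
  ultimately show ?thesis using pos by blast
qed

end
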